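(* Let $n\ge 2$ be even. The kernel of the (projective) $\mathrm{SL}(2,\mathbb{Z})$-representation on the Higman ideal of $D\mathcal{K}_n$ is a congruence subgroup of $\mathrm{SL}(2,\mathbb{Z})$ of level $2$.
   Context: $D\mathcal{K}_n$ (Drinfeld double of the Nichols Hopf algebra $\mathcal{K}_n$) is the $2^{2n+2}$-dimensional complex Hopf algebra with generators $K,\bar K,\xi_i,\bar\xi_i$ ($1\le i\le n$) and relations $K^2=\bar K^2=(K\bar K)^2=1$, $\xi_i^2=\bar\xi_i^2=0$; $K$ and $\bar K$ each anticommute with every $\xi_i$ and $\bar\xi_i$; $\xi_i\xi_j=-\xi_j\xi_i$, $\bar\xi_i\bar\xi_j=-\bar\xi_j\bar\xi_i$; $\xi_i\bar\xi_j=-\bar\xi_j\xi_i$ for $i\ne j$; $\xi_i\bar\xi_i=1-K\bar K-\bar\xi_i\xi_i$. Also $\Delta(K)=K\otimes K$, $\Delta(\bar K)=\bar K\otimes\bar K$, $\Delta(\xi_i)=K\otimes\xi_i+\xi_i\otimes1$, $\Delta(\bar\xi_i)=\bar K\otimes\bar\xi_i+\bar\xi_i\otimes1$, $\epsilon(K)=\epsilon(\bar K)=1$, $\epsilon(\xi_i)=\epsilon(\bar\xi_i)=0$, $S(K)=K$, $S(\bar K)=\bar K$, $S(\xi_i)=-K\xi_i$, $S(\bar\xi_i)=-\bar K\bar\xi_i$. Let $W$ be the set of words $w=\xi_{i_1}\cdots\xi_{i_k}$, $i_1<\dots<i_k$, $k\ge0$; $|w|=k$ and $\bar w=\bar\xi_{i_1}\cdots\bar\xi_{i_k}$.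 $R$-matrix: $R=\sum_{w\in W}(-1)^{\lfloor|w|/2\rfloor}(w\otimes\bar w\bar K^{|w|})\cdot\frac12(1\otimes1+K\otimes1+1\otimes\bar K-K\otimes\bar K)$. Ribbon element ($n$ even): $\nu=(1+K-\bar K+K\bar K)\sum_{w\in W}\frac{(-1)^{\lfloor(|w|+1)/2\rfloor}}{2}w\bar w$. Integral $\Lambda=\frac12(1+K+\bar K+K\bar K)\xi_1\cdots\xi_n\bar\xi_1\cdots\bar\xi_n$; the integral $\lambda$ of the dual is $2$ times the coefficient functional of $\xi_1\cdots\xi_n\bar\xi_1\cdots\bar\xi_n$ in the basis $\{K^a\bar K^b w\bar w':a,b\in\{0,1\},w,w'\in W\}$. The projective representation of $\mathrm{SL}(2,\mathbb{Z})$ on the center of $H=D\mathcal{K}_n$ is $s=\begin{pmatrix}0&-1\\1&0\end{pmatrix}\mapsto S_{LM}$, $t=\begin{pmatrix}1&1\\0&1\end{pmatrix}\mapsto T_{LM}$, $S_{LM}(x)=(\mathrm{id}\otimes\lambda)(R^{-1}(1\otimes x)R_{21}^{-1})$, $T_{LM}(x)=\nu x$. The Higman ideal is the image of $\tau(x)=\sum S(\Lambda_{(2)})x\Lambda_{(1)}G^{-1}$ with balancing element $G=K$; it is an invariant subspace of the center. The kernel of a projective representation is the set of group elements acting by scalars; a congruence subgroup of level $N$ contains $\Gamma(N)$, with $N$ minimal. *)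

theory Defs
  imports "HOL-Analysis.Analysis" "HOL-Library.Poly_Mapping" "HOL-Algebra.Group"
begin

section \<open>Complex algebras\<close>

class complex_algebra = ring_1 +
  fixes scaleC :: "complex \<Rightarrow> 'a \<Rightarrow> 'a" (infixr "*\<^sub>C" 75)
  assumes scaleC_add_right: "c *\<^sub>C (x + y) = c *\<^sub>C x + c *\<^sub>C y"
    and scaleC_add_left: "(c + d) *\<^sub>C x = c *\<^sub>C x + d *\<^sub>C x"
    and scaleC_scaleC [simp]: "c *\<^sub>C d *\<^sub>C x = (c * d) *\<^sub>C x"
    and scaleC_one [simp]: "1 *\<^sub>C x = x"
    and mult_scaleC_left [simp]: "(c *\<^sub>C x) * y = c *\<^sub>C (x * y)"
    and mult_scaleC_right [simp]: "x * (c *\<^sub>C y) = c *\<^sub>C (x * y)"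

global_interpretation cvec: vector_space "scaleC :: complex \<Rightarrow> 'a \<Rightarrow> 'a::complex_algebra"
  by unfold_locales (simp_all add: scaleC_add_right scaleC_add_left)

global_interpretation cvec: vector_space_pair
  "scaleC :: complex \<Rightarrow> 'a \<Rightarrow> 'a::complex_algebra"
  "scaleC :: complex \<Rightarrow> 'b \<Rightarrow> 'b::complex_algebra"
  by unfold_locales

instantiation complex :: complex_algebra
begin
definition scaleC_complex :: "complex \<Rightarrow> complex \<Rightarrow> complex" where
  "scaleC_complex = (*)"
instance
  by standard (simp_all add: scaleC_complex_def algebra_simps)
end

abbreviation clinear :: "('a::complex_algebra \<Rightarrow> 'b::complex_algebra) \<Rightarrow> bool" where
  "clinear \<equiv> Vector_Spaces.linear scaleC scaleC"

definition cbilinear ::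
  "('a::complex_algebra \<Rightarrow> 'b::complex_algebra \<Rightarrow> 'c::complex_algebra) \<Rightarrow> bool" where
  "cbilinear f \<longleftrightarrow> (\<forall>a. clinear (f a)) \<and> (\<forall>b. clinear (\<lambda>a. f a b))"

lemma clinear_iff:
  "clinear f \<longleftrightarrow> (\<forall>x y. f (x + y) = f x + f y) \<and> (\<forall>c x. f (c *\<^sub>C x) = c *\<^sub>C f x)"
  by (simp add: Vector_Spaces.linear_iff cvec.vector_space_axioms)

lemma clinearI:
  assumes "\<And>x y. f (x + y) = f x + f y" "\<And>c x. f (c *\<^sub>C x) = c *\<^sub>C f x"
  shows "clinear f"
  using assms by (simp add: clinear_iff)

definition ring_inv :: "'a::ring_1 \<Rightarrow> 'a" where
  "ring_inv x = (THE y. x * y = 1 \<and> y * x = 1)"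

lemma ring_inv_eqI:
  assumes "x * y = 1" "y * x = 1"
  shows "ring_inv x = y"
  unfolding ring_inv_def
proof (rule the_equality)
  fix z assume "x * z = 1 \<and> z * x = 1"
  then show "z = y" using assms by (metis mult.assoc mult_1_left mult_1_right)
qed (use assms in auto)

inductive_set two_sided_ideal :: "'a::ring_1 set \<Rightarrow> 'a set" for R where
  zero: "0 \<in> two_sided_ideal R"
| gen: "r \<in> R \<Longrightarrow> a * r * b \<in> two_sided_ideal R"
| add: "x \<in> two_sided_ideal R \<Longrightarrow> y \<in> two_sided_ideal R \<Longrightarrow> x + y \<in> two_sided_ideal R"

lemma two_sided_ideal_mult:
  assumes "x \<in> two_sided_ideal R"
  shows "a * x * b \<in> two_sided_ideal R"
  using assms
proof induction
  case (gen r c d)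
  have "a * (c * r * d) * b = (a * c) * r * (d * b)" by (simp add: mult.assoc)
  then show ?case using two_sided_ideal.gen[OF gen] by metis
qed (simp_all add: two_sided_ideal.zero two_sided_ideal.add distrib_left distrib_right)

lemma two_sided_ideal_multL: "x \<in> two_sided_ideal R \<Longrightarrow> a * x \<in> two_sided_ideal R"
  using two_sided_ideal_mult[of x R a 1] by simp

lemma two_sided_ideal_multR: "x \<in> two_sided_ideal R \<Longrightarrow> x * a \<in> two_sided_ideal R"
  using two_sided_ideal_mult[of x R 1 a] by simp

lemma two_sided_ideal_minus: "x \<in> two_sided_ideal R \<Longrightarrow> - x \<in> two_sided_ideal R"
  using two_sided_ideal_multL[of x R "-1"] by simp

lemma two_sided_ideal_base: "r \<in> R \<Longrightarrow> r \<in> two_sided_ideal R"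
  using two_sided_ideal.gen[of r R 1 1] by simp

definition ideal_cong :: "'a::ring_1 set \<Rightarrow> 'a \<Rightarrow> 'a \<Rightarrow> bool" where
  "ideal_cong R x y \<longleftrightarrow> x - y \<in> two_sided_ideal R"

lemma equivp_ideal_cong: "equivp (ideal_cong R)"
proof (rule equivpI)
  show "reflp (ideal_cong R)"
    by (rule reflpI) (simp add: ideal_cong_def two_sided_ideal.zero)
  show "symp (ideal_cong R)"
    by (rule sympI) (metis ideal_cong_def minus_diff_eq two_sided_ideal_minus)
  show "transp (ideal_cong R)"
  proof (rule transpI)
    fix x y z assume "ideal_cong R x y" "ideal_cong R y z"
    then show "ideal_cong R x z"
      unfolding ideal_cong_def using two_sided_ideal.add[of "x - y" R "y - z"] by simp
  qed
qed

lemma ideal_cong_add: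
  assumes "ideal_cong R x x'" "ideal_cong R y y'"
  shows "ideal_cong R (x + y) (x' + y')"
  using two_sided_ideal.add[of "x - x'" R "y - y'"] assms
  by (simp add: ideal_cong_def algebra_simps)

lemma ideal_cong_minus: "ideal_cong R x x' \<Longrightarrow> ideal_cong R (- x) (- x')"
  using two_sided_ideal_minus[of "x - x'" R] by (simp add: ideal_cong_def)

lemma ideal_cong_diff:
  assumes "ideal_cong R x x'" "ideal_cong R y y'"
  shows "ideal_cong R (x - y) (x' - y')"
  using ideal_cong_add[OF assms(1) ideal_cong_minus[OF assms(2)]] by simp

lemma ideal_cong_mult:
  assumes "ideal_cong R x x'" "ideal_cong R y y'"
  shows "ideal_cong R (x * y) (x' * y')"
proof -
  have "x * y - x' * y' = (x - x') * y + x' * (y - y')" by (simp add: algebra_simps)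
  then show ?thesis
    using assms two_sided_ideal.add two_sided_ideal_multL two_sided_ideal_multR
    unfolding ideal_cong_def by metis
qed

section \<open>Linear extension from monoid algebras\<close>

text \<open>For a monoid \<open>'k\<close>, written additively, \<open>'k \<Rightarrow>\<^sub>0 complex\<close> with convolution is its monoid algebra.\<close>

definition lin_ext :: "('k \<Rightarrow> 'a::complex_algebra) \<Rightarrow> ('k \<Rightarrow>\<^sub>0 complex) \<Rightarrow> 'a" where
  "lin_ext g p = (\<Sum>k\<in>Poly_Mapping.keys p. Poly_Mapping.lookup p k *\<^sub>C g k)"

lemma lin_ext_superset:
  assumes "finite S" "Poly_Mapping.keys p \<subseteq> S"
  shows "lin_ext g p = (\<Sum>k\<in>S. Poly_Mapping.lookup p k *\<^sub>C g k)"
  unfolding lin_ext_def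
  by (rule sum.mono_neutral_left) (use assms in \<open>auto simp: in_keys_iff\<close>)

lemma lin_ext_zero [simp]: "lin_ext g 0 = 0"
  by (simp add: lin_ext_def)

lemma lin_ext_single [simp]: "lin_ext g (Poly_Mapping.single k c) = c *\<^sub>C g k"
  by (simp add: lin_ext_def)

lemma lin_ext_add: "lin_ext g (p + q) = lin_ext g p + lin_ext g q"
proof -
  let ?S = "Poly_Mapping.keys p \<union> Poly_Mapping.keys q"
  have "Poly_Mapping.keys (p + q) \<subseteq> ?S" by (rule Poly_Mapping.keys_add)
  then show ?thesis
    by (simp add: lin_ext_superset[of ?S] lookup_add scaleC_add_left sum.distrib)
qed

lemma lin_ext_diff: "lin_ext g (p - q) = lin_ext g p - lin_ext g q"
  using lin_ext_add[of g "p - q" q] by (simp add: algebra_simps)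

lemma poly_mapping_add_induct [case_names single add]:
  assumes single: "\<And>k c. P (Poly_Mapping.single k c)"
    and add: "\<And>p q. P p \<Longrightarrow> P q \<Longrightarrow> P (p + q)"
  shows "P (p :: 'k \<Rightarrow>\<^sub>0 'b::comm_monoid_add)"
proof (induction p rule: update_induct)
  case const
  then show ?case using single[of undefined 0] by simp
next
  case (update f a b)
  have "Poly_Mapping.update a b f = f + Poly_Mapping.single a b"
    using update by (intro poly_mapping_eqI)
      (auto simp: lookup_update lookup_add lookup_single in_keys_iff when_def)
  then show ?case using add[OF update(3) single] by simp
qed

lemma lin_ext_mult:
  assumes hom: "\<And>k l. g (k + l) = g k * g l"
  shows "lin_ext g (p * q) = lin_ext g p * lin_ext g q"
proof (induction p rule: poly_mapping_add_induct)
  case (single k c)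
  show ?case
    by (induction q rule: poly_mapping_add_induct)
      (simp_all add: mult_single hom distrib_left lin_ext_add mult.commute)
qed (simp add: distrib_right lin_ext_add)

lemma lin_ext_mult_anti:
  assumes hom: "\<And>k l. g (k + l) = g l * g k"
  shows "lin_ext g (p * q) = lin_ext g q * lin_ext g p"
proof (induction p rule: poly_mapping_add_induct)
  case (single k c)
  show ?case
    by (induction q rule: poly_mapping_add_induct)
      (simp_all add: mult_single hom distrib_left distrib_right lin_ext_add scaleC_add_right mult.commute)
qed (simp add: distrib_left distrib_right lin_ext_add)

lemma lin_ext_one: "g 0 = 1 \<Longrightarrow> lin_ext g 1 = 1"
  by (simp flip: single_one)

lemma lin_ext_ideal_hom:
  assumes "\<And>k l. g (k + l) = g k * g l" "\<And>r. r \<in> R \<Longrightarrow> lin_ext g r = 0"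
    and "p \<in> two_sided_ideal R"
  shows "lin_ext g p = 0"
  using assms(3) by induction (simp_all add: lin_ext_mult assms(1,2) lin_ext_add)

lemma lin_ext_ideal_anti:
  assumes "\<And>k l. g (k + l) = g l * g k" "\<And>r. r \<in> R \<Longrightarrow> lin_ext g r = 0"
    and "p \<in> two_sided_ideal R"
  shows "lin_ext g p = 0"
  using assms(3) by induction (simp_all add: lin_ext_mult_anti assms(1,2) lin_ext_add)

abbreviation const_pm :: "complex \<Rightarrow> ('k::zero \<Rightarrow>\<^sub>0 complex)" where
  "const_pm \<equiv> Poly_Mapping.single 0"

lemma const_pm_commute:
  "p * const_pm c = const_pm c * (p :: 'k::monoid_add \<Rightarrow>\<^sub>0 complex)"
  by (induction p rule: poly_mapping_add_induct)
    (simp_all add: mult_single distrib_left distrib_right mult.commute)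

lemma lin_ext_const_pm: "lin_ext g (const_pm c * p) = c *\<^sub>C lin_ext g (p :: 'k::monoid_add \<Rightarrow>\<^sub>0 complex)"
  by (induction p rule: poly_mapping_add_induct)
    (simp_all add: mult_single distrib_left lin_ext_add scaleC_add_right)

lemma ideal_cong_const_pm:
  "ideal_cong R p q \<Longrightarrow> ideal_cong R (const_pm c * p) (const_pm c * q)"
  by (rule ideal_cong_mult) (simp_all add: ideal_cong_def two_sided_ideal.zero)

section \<open>Tensor products of complex algebras\<close>

text \<open>The multiplicative monoid of a ring, written additively.\<close>

datatype 'a mon = Mon (unMon: 'a)

instantiation mon :: (monoid_mult) monoid_add
begin
definition zero_mon :: "'a mon" where "0 = Mon 1"
definition plus_mon :: "'a mon \<Rightarrow> 'a mon \<Rightarrow> 'a mon" where "x + y = Mon (unMon x * unMon y)"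
instance by standard (simp_all add: zero_mon_def plus_mon_def mult.assoc)
end

abbreviation ptens ::
  "'a::monoid_mult \<Rightarrow> 'b::monoid_mult \<Rightarrow> 'a mon \<times> 'b mon \<Rightarrow>\<^sub>0 complex" where
  "ptens a b \<equiv> Poly_Mapping.single (Mon a, Mon b) 1"

inductive_set tensor_relators ::
  "('a::complex_algebra mon \<times> 'b::complex_algebra mon \<Rightarrow>\<^sub>0 complex) set" where
  "ptens (a + a') b - ptens a b - ptens a' b \<in> tensor_relators"
| "ptens a (b + b') - ptens a b - ptens a b' \<in> tensor_relators"
| "ptens (c *\<^sub>C a) b - const_pm c * ptens a b \<in> tensor_relators"
| "ptens a (c *\<^sub>C b) - const_pm c * ptens a b \<in> tensor_relators"

text \<open>A product of a relator with pure tensors on either side is again a relator, so the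
  ideal generated by the relators is their linear span: the quotient is the usual tensor
  product of vector spaces, with \<open>(a \<otimes> b) (c \<otimes> d) = ac \<otimes> bd\<close>.\<close>

definition bil_fun :: "('a \<Rightarrow> 'b \<Rightarrow> 'c) \<Rightarrow> 'a mon \<times> 'b mon \<Rightarrow> 'c" where
  "bil_fun f k = f (unMon (fst k)) (unMon (snd k))"

lemma lin_ext_bil_ideal:
  assumes f: "cbilinear f" and p: "p \<in> two_sided_ideal tensor_relators"
  shows "lin_ext (bil_fun f) p = 0"
proof -
  have L: "f a (x + y) = f a x + f a y" "f a (c *\<^sub>C x) = c *\<^sub>C f a x"
    "f (x' + y') b = f x' b + f y' b" "f (c *\<^sub>C x') b = c *\<^sub>C f x' b" for a b x y x' y' c
    using f by (auto simp: cbilinear_def clinear_iff)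
  have 1: "lin_ext (bil_fun f) (Poly_Mapping.single u c * r * Poly_Mapping.single v d) = 0"
    if "r \<in> tensor_relators" for r u v c d
    using that
    by cases (simp_all add: mult_single left_diff_distrib right_diff_distrib lin_ext_diff
        bil_fun_def plus_prod_def plus_mon_def zero_prod_def zero_mon_def distrib_left
        distrib_right L scaleC_add_right cvec.scale_right_diff_distrib mult.assoc mult.commute)
  have 2: "lin_ext (bil_fun f) (Poly_Mapping.single u c * r * q) = 0"
    if "r \<in> tensor_relators" for r u c q
    by (induction q rule: poly_mapping_add_induct) (simp_all add: 1[OF that] distrib_left lin_ext_add)
  have 3: "lin_ext (bil_fun f) (p * r * q) = 0" if "r \<in> tensor_relators" for r p q
    by (induction p rule: poly_mapping_add_induct) (simp_all add: 2[OF that] distrib_right lin_ext_add)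
  show ?thesis using p by induction (simp_all add: 3 lin_ext_add)
qed

lemma exists_normalized_functional:
  "\<exists>\<phi> :: 'a::complex_algebra \<Rightarrow> complex. clinear \<phi> \<and> \<phi> 1 = 1"
proof -
  have ind: "cvec.independent {1 :: 'a}" by simp
  show ?thesis
    using cvec.linear_construct[OF ind, of "\<lambda>_. 1 :: complex"]
      cvec.construct_basis[OF ind, of 1 "\<lambda>_. 1 :: complex"] by auto
qed

lemma one_notin_tensor_ideal:
  "1 \<notin> two_sided_ideal (tensor_relators :: ('a::complex_algebra mon \<times> 'b::complex_algebra mon \<Rightarrow>\<^sub>0 complex) set)"
proof
  assume *: "1 \<in> two_sided_ideal (tensor_relators :: ('a mon \<times> 'b mon \<Rightarrow>\<^sub>0 complex) set)"
  obtain \<phi> :: "'a \<Rightarrow> complex" and \<psi> :: "'b \<Rightarrow> complex"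
    where \<phi>: "clinear \<phi>" "\<phi> 1 = 1" and \<psi>: "clinear \<psi>" "\<psi> 1 = 1"
    using exists_normalized_functional by metis
  have "cbilinear (\<lambda>a b. \<phi> a * \<psi> b)"
    using \<phi> \<psi> by (auto simp: cbilinear_def clinear_iff algebra_simps)
  from lin_ext_bil_ideal[OF this *] show False
    using \<phi> \<psi> by (simp add: lin_ext_one bil_fun_def zero_prod_def zero_mon_def)
qed

quotient_type (overloaded) ('a, 'b) tensor =
  "'a::complex_algebra mon \<times> 'b::complex_algebra mon \<Rightarrow>\<^sub>0 complex"
  / "ideal_cong tensor_relators"
  by (rule equivp_ideal_cong)

instantiation tensor :: (complex_algebra, complex_algebra) complex_algebra
begin
lift_definition zero_tensor :: "('a, 'b) tensor" is 0 .
lift_definition one_tensor :: "('a, 'b) tensor" is 1 .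
lift_definition plus_tensor :: "('a, 'b) tensor \<Rightarrow> ('a, 'b) tensor \<Rightarrow> ('a, 'b) tensor" is "(+)"
  by (rule ideal_cong_add)
lift_definition uminus_tensor :: "('a, 'b) tensor \<Rightarrow> ('a, 'b) tensor" is uminus
  by (rule ideal_cong_minus)
lift_definition minus_tensor :: "('a, 'b) tensor \<Rightarrow> ('a, 'b) tensor \<Rightarrow> ('a, 'b) tensor" is "(-)"
  by (rule ideal_cong_diff)
lift_definition times_tensor :: "('a, 'b) tensor \<Rightarrow> ('a, 'b) tensor \<Rightarrow> ('a, 'b) tensor" is "(*)"
  by (rule ideal_cong_mult)
lift_definition scaleC_tensor :: "complex \<Rightarrow> ('a, 'b) tensor \<Rightarrow> ('a, 'b) tensor"
  is "\<lambda>c p. const_pm c * p"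
  by (rule ideal_cong_const_pm)
instance
proof
  fix x y z :: "('a, 'b) tensor" and c d :: complex
  note refl = equivp_reflp[OF equivp_ideal_cong]
  show "x + y + z = x + (y + z)" by transfer (simp add: refl add.assoc)
  show "x + y = y + x" by transfer (simp add: refl add.commute)
  show "0 + x = x" by transfer (simp add: refl)
  show "- x + x = 0" by transfer (simp add: refl)
  show "x - y = x + - y" by transfer (simp add: refl)
  show "x * y * z = x * (y * z)" by transfer (simp add: refl mult.assoc)
  show "(x + y) * z = x * z + y * z" by transfer (simp add: refl distrib_right)
  show "x * (y + z) = x * y + x * z" by transfer (simp add: refl distrib_left)
  show "1 * x = x" by transfer (simp add: refl)
  show "x * 1 = x" by transfer (simp add: refl)
  show "(0 :: ('a, 'b) tensor) \<noteq> 1"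
  proof (transfer, unfold ideal_cong_def, rule notI)
    assume "0 - 1 \<in> two_sided_ideal (tensor_relators :: ('a mon \<times> 'b mon \<Rightarrow>\<^sub>0 complex) set)"
    from two_sided_ideal_minus[OF this] show False by (simp add: one_notin_tensor_ideal)
  qed
  show "c *\<^sub>C (x + y) = c *\<^sub>C x + c *\<^sub>C y" by transfer (simp add: refl distrib_left)
  show "(c + d) *\<^sub>C x = c *\<^sub>C x + d *\<^sub>C x" by transfer (simp add: refl single_add distrib_right)
  show "c *\<^sub>C d *\<^sub>C x = (c * d) *\<^sub>C x"
    by transfer (simp add: refl mult_single flip: mult.assoc)
  show "1 *\<^sub>C x = x" by transfer (simp add: refl)
  show "c *\<^sub>C x * y = c *\<^sub>C (x * y)" by transfer (simp add: refl mult.assoc)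
  show "x * c *\<^sub>C y = c *\<^sub>C (x * y)"
    by transfer (simp add: refl const_pm_commute flip: mult.assoc)
qed
end

lift_definition tens :: "'a::complex_algebra \<Rightarrow> 'b::complex_algebra \<Rightarrow> ('a, 'b) tensor"
  (infixr "\<otimes>\<^sub>C" 72) is "\<lambda>a b. ptens a b" .

text \<open>The linear map on the tensor product induced by a bilinear map.  The conditional only
  serves to make the function total.\<close>

lift_definition tensor_lift ::
  "('a::complex_algebra \<Rightarrow> 'b::complex_algebra \<Rightarrow> 'c::complex_algebra) \<Rightarrow> ('a, 'b) tensor \<Rightarrow> 'c"
  is "\<lambda>f p. if cbilinear f then lin_ext (bil_fun f) p else 0"
  by (auto simp: ideal_cong_def lin_ext_diff dest: lin_ext_bil_ideal)

lemma tens_simps: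
  "(a + a') \<otimes>\<^sub>C b = a \<otimes>\<^sub>C b + a' \<otimes>\<^sub>C b"
  "a \<otimes>\<^sub>C (b + b') = a \<otimes>\<^sub>C b + a \<otimes>\<^sub>C b'"
  "(c *\<^sub>C a) \<otimes>\<^sub>C b = c *\<^sub>C (a \<otimes>\<^sub>C b)"
  "a \<otimes>\<^sub>C (c *\<^sub>C b) = c *\<^sub>C (a \<otimes>\<^sub>C b)"
  by (transfer, simp add: ideal_cong_def diff_diff_eq[symmetric],
      intro two_sided_ideal_base tensor_relators.intros)+

lemma tens_minus:
  "(- a) \<otimes>\<^sub>C b = - (a \<otimes>\<^sub>C b)" "a \<otimes>\<^sub>C (- b) = - (a \<otimes>\<^sub>C b)"
  using tens_simps(3)[of "-1" a b] tens_simps(4)[of a "-1" b] by simp_all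

lemma tens_zero: "0 \<otimes>\<^sub>C b = 0" "a \<otimes>\<^sub>C 0 = 0"
  using tens_simps(3)[of 0 0 b] tens_simps(4)[of a 0 0] by simp_all

lemma tens_diff:
  "(a - a') \<otimes>\<^sub>C b = a \<otimes>\<^sub>C b - a' \<otimes>\<^sub>C b"
  "a \<otimes>\<^sub>C (b - b') = a \<otimes>\<^sub>C b - a \<otimes>\<^sub>C b'"
  using tens_simps(1)[of a "- a'" b] tens_simps(2)[of a b "- b'"] by (simp_all add: tens_minus)

lemma tens_mult: "(a \<otimes>\<^sub>C b) * (a' \<otimes>\<^sub>C b') = (a * a') \<otimes>\<^sub>C (b * b')"
  by transfer (simp add: mult_single plus_prod_def plus_mon_def equivp_reflp[OF equivp_ideal_cong])

lemma tens_one: "1 \<otimes>\<^sub>C 1 = 1"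
  by transfer (simp add: equivp_reflp[OF equivp_ideal_cong] flip: single_one zero_mon_def zero_prod_def)

lemma tensor_lift_tens: "cbilinear f \<Longrightarrow> tensor_lift f (a \<otimes>\<^sub>C b) = f a b"
  by transfer (simp add: bil_fun_def)

lemma tensor_lift_linear: "clinear (tensor_lift f)"
  by (rule clinearI; transfer; simp add: lin_ext_add lin_ext_const_pm)

definition tensor_flip :: "('a::complex_algebra, 'b::complex_algebra) tensor \<Rightarrow> ('b, 'a) tensor" where
  "tensor_flip = tensor_lift (\<lambda>a b. b \<otimes>\<^sub>C a)"

section \<open>The Hopf algebra $D\mathcal{K}_n$\<close>

datatype 'n gen = gen_K | gen_Kbar | gen_xi 'n | gen_xibar 'n

text \<open>Words form the free monoid, so \<open>'n gen word \<Rightarrow>\<^sub>0 complex\<close> is the free algebra.\<close>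

datatype 'g word = Word (letters: "'g list")

instantiation word :: (type) monoid_add
begin
definition zero_word :: "'a word" where "0 = Word []"
definition plus_word :: "'a word \<Rightarrow> 'a word \<Rightarrow> 'a word" where "x + y = Word (letters x @ letters y)"
instance by standard (simp_all add: zero_word_def plus_word_def)
end

abbreviation letter :: "'g \<Rightarrow> 'g word \<Rightarrow>\<^sub>0 complex" where
  "letter g \<equiv> Poly_Mapping.single (Word [g]) 1"

inductive dk_relation :: "('n gen word \<Rightarrow>\<^sub>0 complex) \<Rightarrow> ('n gen word \<Rightarrow>\<^sub>0 complex) \<Rightarrow> bool" where
  "dk_relation (letter gen_K * letter gen_K) 1"
| "dk_relation (letter gen_Kbar * letter gen_Kbar) 1"
| "dk_relation ((letter gen_K * letter gen_Kbar) * (letter gen_K * letter gen_Kbar)) 1"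
| "dk_relation (letter (gen_xi i) * letter (gen_xi i)) 0"
| "dk_relation (letter (gen_xibar i) * letter (gen_xibar i)) 0"
| "dk_relation (letter gen_K * letter (gen_xi i)) (- (letter (gen_xi i) * letter gen_K))"
| "dk_relation (letter gen_K * letter (gen_xibar i)) (- (letter (gen_xibar i) * letter gen_K))"
| "dk_relation (letter gen_Kbar * letter (gen_xi i)) (- (letter (gen_xi i) * letter gen_Kbar))"
| "dk_relation (letter gen_Kbar * letter (gen_xibar i)) (- (letter (gen_xibar i) * letter gen_Kbar))"
| "dk_relation (letter (gen_xi i) * letter (gen_xi j)) (- (letter (gen_xi j) * letter (gen_xi i)))"
| "dk_relation (letter (gen_xibar i) * letter (gen_xibar j)) (- (letter (gen_xibar j) * letter (gen_xibar i)))"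
| "i \<noteq> j \<Longrightarrow> dk_relation (letter (gen_xi i) * letter (gen_xibar j)) (- (letter (gen_xibar j) * letter (gen_xi i)))"
| "dk_relation (letter (gen_xi i) * letter (gen_xibar i))
     (1 - letter gen_K * letter gen_Kbar - letter (gen_xibar i) * letter (gen_xi i))"

definition dk_relators :: "('n gen word \<Rightarrow>\<^sub>0 complex) set" where
  "dk_relators = {l - r | l r. dk_relation l r}"

text \<open>The algebra homomorphism, respectively antihomomorphism, out of the free algebra with
  prescribed values on the letters.\<close>

definition free_hom :: "('g \<Rightarrow> 'a::complex_algebra) \<Rightarrow> ('g word \<Rightarrow>\<^sub>0 complex) \<Rightarrow> 'a" where
  "free_hom h = lin_ext (\<lambda>w. prod_list (map h (letters w)))"

definition free_antihom :: "('g \<Rightarrow> 'a::complex_algebra) \<Rightarrow> ('g word \<Rightarrow>\<^sub>0 complex) \<Rightarrow> 'a" where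
  "free_antihom h = lin_ext (\<lambda>w. prod_list (map h (rev (letters w))))"

lemma free_hom_simps:
  "free_hom h (letter g) = h g" "free_hom h 1 = 1" "free_hom h 0 = 0"
  "free_hom h (p + q) = free_hom h p + free_hom h q"
  "free_hom h (p - q) = free_hom h p - free_hom h q"
  "free_hom h (- p) = - free_hom h p"
  "free_hom h (p * q) = free_hom h p * free_hom h q"
  "free_hom h (const_pm c * p) = c *\<^sub>C free_hom h p"
  using lin_ext_diff[of _ 0 p]
  by (simp_all add: free_hom_def lin_ext_one zero_word_def lin_ext_add lin_ext_diff lin_ext_const_pm
      lin_ext_mult plus_word_def)

lemma free_antihom_simps:
  "free_antihom h (letter g) = h g" "free_antihom h 1 = 1" "free_antihom h 0 = 0"
  "free_antihom h (p + q) = free_antihom h p + free_antihom h q"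
  "free_antihom h (p - q) = free_antihom h p - free_antihom h q"
  "free_antihom h (- p) = - free_antihom h p"
  "free_antihom h (p * q) = free_antihom h q * free_antihom h p"
  "free_antihom h (const_pm c * p) = c *\<^sub>C free_antihom h p"
  using lin_ext_diff[of _ 0 p]
  by (simp_all add: free_antihom_def lin_ext_one zero_word_def lin_ext_add lin_ext_diff
      lin_ext_const_pm lin_ext_mult_anti plus_word_def)

lemma free_hom_cong:
  assumes "\<And>l r. dk_relation l r \<Longrightarrow> free_hom h l = free_hom h r" "ideal_cong dk_relators p q"
  shows "free_hom h p = free_hom h q"
proof -
  have "p - q \<in> two_sided_ideal dk_relators" using assms(2) by (simp add: ideal_cong_def)
  then have "free_hom h (p - q) = 0"
    by induction (auto simp: free_hom_simps dk_relators_def assms(1))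
  then show ?thesis by (simp add: free_hom_simps)
qed

lemma free_antihom_cong:
  assumes "\<And>l r. dk_relation l r \<Longrightarrow> free_antihom h l = free_antihom h r" "ideal_cong dk_relators p q"
  shows "free_antihom h p = free_antihom h q"
proof -
  have "p - q \<in> two_sided_ideal dk_relators" using assms(2) by (simp add: ideal_cong_def)
  then have "free_antihom h (p - q) = 0"
    by induction (auto simp: free_antihom_simps dk_relators_def assms(1))
  then show ?thesis by (simp add: free_antihom_simps)
qed

text \<open>Values of the counit on the letters.\<close>

fun counit_gen :: "'n gen \<Rightarrow> complex" where
  "counit_gen gen_K = 1"
| "counit_gen gen_Kbar = 1"
| "counit_gen (gen_xi i) = 0"
| "counit_gen (gen_xibar i) = 0"

lemma counit_gen_relation: "dk_relation l r \<Longrightarrow> free_hom counit_gen l = free_hom counit_gen r"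
  by (cases rule: dk_relation.cases) (auto simp: free_hom_simps)

quotient_type 'n dk = "'n gen word \<Rightarrow>\<^sub>0 complex" / "ideal_cong dk_relators"
  by (rule equivp_ideal_cong)

instantiation dk :: (type) complex_algebra
begin
lift_definition zero_dk :: "'a dk" is 0 .
lift_definition one_dk :: "'a dk" is 1 .
lift_definition plus_dk :: "'a dk \<Rightarrow> 'a dk \<Rightarrow> 'a dk" is "(+)" by (rule ideal_cong_add)
lift_definition uminus_dk :: "'a dk \<Rightarrow> 'a dk" is uminus by (rule ideal_cong_minus)
lift_definition minus_dk :: "'a dk \<Rightarrow> 'a dk \<Rightarrow> 'a dk" is "(-)" by (rule ideal_cong_diff)
lift_definition times_dk :: "'a dk \<Rightarrow> 'a dk \<Rightarrow> 'a dk" is "(*)" by (rule ideal_cong_mult)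
lift_definition scaleC_dk :: "complex \<Rightarrow> 'a dk \<Rightarrow> 'a dk" is "\<lambda>c p. const_pm c * p"
  by (rule ideal_cong_const_pm)
instance
proof
  fix x y z :: "'a dk" and c d :: complex
  note refl = equivp_reflp[OF equivp_ideal_cong]
  show "x + y + z = x + (y + z)" by transfer (simp add: refl add.assoc)
  show "x + y = y + x" by transfer (simp add: refl add.commute)
  show "0 + x = x" by transfer (simp add: refl)
  show "- x + x = 0" by transfer (simp add: refl)
  show "x - y = x + - y" by transfer (simp add: refl)
  show "x * y * z = x * (y * z)" by transfer (simp add: refl mult.assoc)
  show "(x + y) * z = x * z + y * z" by transfer (simp add: refl distrib_right)
  show "x * (y + z) = x * y + x * z" by transfer (simp add: refl distrib_left)
  show "1 * x = x" by transfer (simp add: refl)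
  show "x * 1 = x" by transfer (simp add: refl)
  show "(0 :: 'a dk) \<noteq> 1"
    by transfer (metis counit_gen_relation free_hom_cong free_hom_simps(2,3) zero_neq_one)
  show "c *\<^sub>C (x + y) = c *\<^sub>C x + c *\<^sub>C y" by transfer (simp add: refl distrib_left)
  show "(c + d) *\<^sub>C x = c *\<^sub>C x + d *\<^sub>C x" by transfer (simp add: refl single_add distrib_right)
  show "c *\<^sub>C d *\<^sub>C x = (c * d) *\<^sub>C x"
    by transfer (simp add: refl mult_single flip: mult.assoc)
  show "1 *\<^sub>C x = x" by transfer (simp add: refl)
  show "c *\<^sub>C x * y = c *\<^sub>C (x * y)" by transfer (simp add: refl mult.assoc)
  show "x * c *\<^sub>C y = c *\<^sub>C (x * y)"
    by transfer (simp add: refl const_pm_commute flip: mult.assoc)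
qed
end

lift_definition dk_gen :: "'n gen \<Rightarrow> 'n dk" is letter .

abbreviation dk_K :: "'n dk" where "dk_K \<equiv> dk_gen gen_K"
abbreviation dk_Kbar :: "'n dk" where "dk_Kbar \<equiv> dk_gen gen_Kbar"
abbreviation dk_xi :: "'n \<Rightarrow> 'n dk" where "dk_xi i \<equiv> dk_gen (gen_xi i)"
abbreviation dk_xibar :: "'n \<Rightarrow> 'n dk" where "dk_xibar i \<equiv> dk_gen (gen_xibar i)"

lemma dk_relation_cong: "dk_relation l r \<Longrightarrow> ideal_cong dk_relators l r"
  unfolding ideal_cong_def dk_relators_def by (rule two_sided_ideal_base) blast

lemma dk_rels:
  "dk_K * dk_K = 1" "dk_Kbar * dk_Kbar = 1" "dk_K * dk_Kbar * (dk_K * dk_Kbar) = 1"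
  "dk_xi i * dk_xi i = 0" "dk_xibar i * dk_xibar i = 0"
  "dk_K * dk_xi i = - (dk_xi i * dk_K)" "dk_K * dk_xibar i = - (dk_xibar i * dk_K)"
  "dk_Kbar * dk_xi i = - (dk_xi i * dk_Kbar)" "dk_Kbar * dk_xibar i = - (dk_xibar i * dk_Kbar)"
  "dk_xi i * dk_xi j = - (dk_xi j * dk_xi i)" "dk_xibar i * dk_xibar j = - (dk_xibar j * dk_xibar i)"
  "dk_xi i * dk_xibar i = 1 - dk_K * dk_Kbar - dk_xibar i * dk_xi i"
  by (transfer, rule dk_relation_cong, rule dk_relation.intros)+

lemma dk_xi_xibar:
  "i \<noteq> j \<Longrightarrow> dk_xi i * dk_xibar j = - (dk_xibar j * dk_xi i)"
  by transfer (intro dk_relation_cong dk_relation.intros)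

lemma dk_Kbar_K: "dk_Kbar * dk_K = dk_K * dk_Kbar"
proof -
  have "dk_Kbar * dk_K = dk_K * dk_Kbar * (dk_K * dk_Kbar) * (dk_Kbar * dk_K)"
    by (simp only: dk_rels(3) mult_1_left)
  also have "\<dots> = dk_K * dk_Kbar * (dk_K * (dk_Kbar * dk_Kbar) * dk_K)"
    by (simp only: mult.assoc)
  also have "\<dots> = dk_K * dk_Kbar" by (simp add: dk_rels(1,2))
  finally show ?thesis .
qed

lemma dk_group_left:
  "dk_K * (dk_K * z) = z" "dk_Kbar * (dk_Kbar * z) = z"
  "dk_Kbar * dk_K = dk_K * dk_Kbar" "dk_Kbar * (dk_K * z) = dk_K * (dk_Kbar * z)"
  "dk_xi i * dk_K = - (dk_K * dk_xi i)" "dk_xi i * (dk_K * z) = - (dk_K * (dk_xi i * z))"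
  "dk_xi i * dk_Kbar = - (dk_Kbar * dk_xi i)" "dk_xi i * (dk_Kbar * z) = - (dk_Kbar * (dk_xi i * z))"
  "dk_xibar i * dk_K = - (dk_K * dk_xibar i)" "dk_xibar i * (dk_K * z) = - (dk_K * (dk_xibar i * z))"
  "dk_xibar i * dk_Kbar = - (dk_Kbar * dk_xibar i)"
  "dk_xibar i * (dk_Kbar * z) = - (dk_Kbar * (dk_xibar i * z))"
  by (simp_all add: dk_Kbar_K dk_rels(1,2,6-9) flip: mult.assoc)

fun comult_gen :: "'n gen \<Rightarrow> ('n dk, 'n dk) tensor" where
  "comult_gen gen_K = dk_K \<otimes>\<^sub>C dk_K"
| "comult_gen gen_Kbar = dk_Kbar \<otimes>\<^sub>C dk_Kbar"
| "comult_gen (gen_xi i) = dk_K \<otimes>\<^sub>C dk_xi i + dk_xi i \<otimes>\<^sub>C 1"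
| "comult_gen (gen_xibar i) = dk_Kbar \<otimes>\<^sub>C dk_xibar i + dk_xibar i \<otimes>\<^sub>C 1"

fun antipode_gen :: "'n gen \<Rightarrow> 'n dk" where
  "antipode_gen gen_K = dk_K"
| "antipode_gen gen_Kbar = dk_Kbar"
| "antipode_gen (gen_xi i) = - (dk_K * dk_xi i)"
| "antipode_gen (gen_xibar i) = - (dk_Kbar * dk_xibar i)"

lemmas tens_arith = tens_simps(1,2) tens_mult tens_minus tens_diff tens_zero tens_one distrib_left distrib_right

lemma comult_gen_relation:
  assumes "dk_relation l r"
  shows "free_hom comult_gen l = free_hom comult_gen r"
  using assms
proof cases
  case (10 i j)
  then show ?thesis using dk_rels(10)[of i j]
    by (simp add: free_hom_simps tens_arith dk_rels(1-9))
next
  case (11 i j)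
  then show ?thesis using dk_rels(11)[of i j]
    by (simp add: free_hom_simps tens_arith dk_rels(1-9))
next
  case (12 i j)
  then show ?thesis using dk_xi_xibar[of i j]
    by (simp add: free_hom_simps tens_arith dk_rels(1-9) dk_Kbar_K)
qed (simp_all add: free_hom_simps tens_arith dk_rels(1-9,12) dk_Kbar_K)

lemma antipode_gen_relation:
  assumes "dk_relation l r"
  shows "free_antihom antipode_gen l = free_antihom antipode_gen r"
  using assms
proof cases
  case (10 i j)
  then show ?thesis using dk_rels(10)[of j i]
    by (simp add: free_antihom_simps dk_rels(1,2) dk_group_left mult.assoc)
next
  case (11 i j)
  then show ?thesis using dk_rels(11)[of j i]
    by (simp add: free_antihom_simps dk_rels(1,2) dk_group_left mult.assoc)
next
  case (12 i j)
  then show ?thesis using dk_xi_xibar[of i j]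
    by (simp add: free_antihom_simps dk_rels(1,2) dk_group_left mult.assoc)
next
  case (13 i)
  then show ?thesis
    by (simp add: free_antihom_simps dk_rels(1,2,12) dk_group_left mult.assoc right_diff_distrib)
qed (simp_all add: free_antihom_simps dk_rels(1,2,4,5) dk_group_left mult.assoc)

lift_definition dk_comult :: "'n dk \<Rightarrow> ('n dk, 'n dk) tensor" is "free_hom comult_gen"
  by (rule free_hom_cong[OF comult_gen_relation])

lift_definition dk_antipode :: "'n dk \<Rightarrow> 'n dk" is "free_antihom antipode_gen"
  by (rule free_antihom_cong[OF antipode_gen_relation])

lemma dk_comult_simps:
  fixes x y :: "'n dk"
  shows "dk_comult (dk_gen g) = comult_gen g" "dk_comult 1 = 1"
  "dk_comult (x + y) = dk_comult x + dk_comult y"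
  "dk_comult (c *\<^sub>C x) = c *\<^sub>C dk_comult x"
  "dk_comult (x * y) = dk_comult x * dk_comult y"
proof -
  have "\<exists>p. z = abs_dk p" for z :: "'n dk" by (induction z rule: dk.abs_induct) blast
  then obtain p q where x: "x = abs_dk p" "y = abs_dk q" by metis
  show "dk_comult (dk_gen g) = comult_gen g" "dk_comult 1 = 1"
    "dk_comult (x + y) = dk_comult x + dk_comult y"
    "dk_comult (x * y) = dk_comult x * dk_comult y"
    by (simp_all add: x free_hom_simps dk_gen_def one_dk_def plus_dk.abs_eq times_dk.abs_eq
        dk_comult.abs_eq)
  show "dk_comult (c *\<^sub>C x) = c *\<^sub>C dk_comult x"
    by (simp add: x free_hom_simps(8) scaleC_dk.abs_eq dk_comult.abs_eq)
qed

lemma dk_antipode_simps: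
  fixes x y :: "'n dk"
  shows "dk_antipode (dk_gen g) = antipode_gen g" "dk_antipode 1 = 1"
  "dk_antipode (x + y) = dk_antipode x + dk_antipode y"
  "dk_antipode (c *\<^sub>C x) = c *\<^sub>C dk_antipode x"
  "dk_antipode (x * y) = dk_antipode y * dk_antipode x"
proof -
  have "\<exists>p. z = abs_dk p" for z :: "'n dk" by (induction z rule: dk.abs_induct) blast
  then obtain p q where x: "x = abs_dk p" "y = abs_dk q" by metis
  show "dk_antipode (dk_gen g) = antipode_gen g" "dk_antipode 1 = 1"
    "dk_antipode (x + y) = dk_antipode x + dk_antipode y"
    "dk_antipode (x * y) = dk_antipode y * dk_antipode x"
    by (simp_all add: x free_antihom_simps dk_gen_def one_dk_def plus_dk.abs_eq times_dk.abs_eq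
        dk_antipode.abs_eq)
  show "dk_antipode (c *\<^sub>C x) = c *\<^sub>C dk_antipode x"
    by (simp add: x free_antihom_simps(8) scaleC_dk.abs_eq dk_antipode.abs_eq)
qed

section \<open>$R$-matrix, ribbon element, integrals and the Higman ideal\<close>

text \<open>The index type \<open>'n\<close> plays the role of \<open>{1, \<dots>, n}\<close>; an increasing word is given by
  the set \<open>A\<close> of its indices, and its length is \<open>card A\<close>.\<close>

definition xi_word :: "'n::linorder set \<Rightarrow> 'n dk" where
  "xi_word A = prod_list (map dk_xi (sorted_list_of_set A))"

definition xibar_word :: "'n::linorder set \<Rightarrow> 'n dk" where
  "xibar_word A = prod_list (map dk_xibar (sorted_list_of_set A))"

definition dk_R :: "('n::{finite,linorder} dk, 'n dk) tensor" where
  "dk_R = (\<Sum>A\<in>UNIV. (- 1) ^ (card A div 2) *\<^sub>C (xi_word A \<otimes>\<^sub>C (xibar_word A * dk_Kbar ^ card A)))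
    * ((1 / 2) *\<^sub>C (1 \<otimes>\<^sub>C 1 + dk_K \<otimes>\<^sub>C 1 + 1 \<otimes>\<^sub>C dk_Kbar - dk_K \<otimes>\<^sub>C dk_Kbar))"

definition dk_ribbon :: "'n::{finite,linorder} dk" where
  "dk_ribbon = (1 + dk_K - dk_Kbar + dk_K * dk_Kbar)
    * (\<Sum>A\<in>UNIV. ((- 1) ^ ((card A + 1) div 2) / 2) *\<^sub>C (xi_word A * xibar_word A))"

definition dk_integral :: "'n::{finite,linorder} dk" where
  "dk_integral = (1 / 2) *\<^sub>C (1 + dk_K + dk_Kbar + dk_K * dk_Kbar) * xi_word UNIV * xibar_word UNIV"

definition dk_pbw_basis :: "'n::{finite,linorder} dk set" where
  "dk_pbw_basis = {dk_K ^ a * dk_Kbar ^ b * xi_word A * xibar_word B | a b A B.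
     a \<in> {0, 1} \<and> b \<in> {0, 1}}"

definition dk_cointegral :: "'n::{finite,linorder} dk \<Rightarrow> complex" where
  "dk_cointegral x = 2 * cvec.representation dk_pbw_basis x (xi_word UNIV * xibar_word UNIV)"

definition S_LM :: "'n::{finite,linorder} dk \<Rightarrow> 'n dk" where
  "S_LM x = tensor_lift (\<lambda>a b. dk_cointegral b *\<^sub>C a)
     (ring_inv dk_R * (1 \<otimes>\<^sub>C x) * ring_inv (tensor_flip dk_R))"

definition T_LM :: "'n::{finite,linorder} dk \<Rightarrow> 'n dk" where
  "T_LM x = dk_ribbon * x"

definition dk_center :: "'n dk set" where
  "dk_center = {z. \<forall>x. z * x = x * z}"

definition dk_higman_map :: "'n::{finite,linorder} dk \<Rightarrow> 'n dk" where
  "dk_higman_map x =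
     tensor_lift (\<lambda>a b. dk_antipode b * x * a * ring_inv dk_K) (dk_comult dk_integral)"

definition dk_higman :: "'n::{finite,linorder} dk set" where
  "dk_higman = range dk_higman_map"

section \<open>Projective representations of $\mathrm{SL}(2,\mathbb{Z})$\<close>

definition SL2Z :: "(int^2^2) monoid" where
  "SL2Z = \<lparr>carrier = {A. det A = 1}, mult = (**), one = mat 1\<rparr>"

definition SL2Z_s :: "int^2^2" where "SL2Z_s = vector [vector [0, - 1], vector [1, 0]]"
definition SL2Z_t :: "int^2^2" where "SL2Z_t = vector [vector [1, 1], vector [0, 1]]"

lemma group_SL2Z: "group SL2Z"
proof (rule groupI)
  fix A assume "A \<in> carrier SL2Z"
  then have "det A = 1" by (simp add: SL2Z_def)
  then show "\<exists>B\<in>carrier SL2Z. B \<otimes>\<^bsub>SL2Z\<^esub> A = \<one>\<^bsub>SL2Z\<^esub>"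
    by (intro bexI[of _ "vector [vector [A$2$2, - A$1$2], vector [- A$2$1, A$1$1]]"])
      (auto simp: SL2Z_def det_2 vec_eq_iff forall_2 matrix_matrix_mult_def sum_2 mat_def
        algebra_simps)
qed (auto simp: SL2Z_def det_mul matrix_mul_assoc)

definition principal_congruence_subgroup :: "nat \<Rightarrow> (int^2^2) set" where
  "principal_congruence_subgroup N =
     {A \<in> carrier SL2Z. \<forall>i j. int N dvd A $ i $ j - mat 1 $ i $ j}"

definition congruence_subgroup_of_level :: "nat \<Rightarrow> (int^2^2) set \<Rightarrow> bool" where
  "congruence_subgroup_of_level N G \<longleftrightarrow>
     subgroup G SL2Z \<and> 1 \<le> N \<and> principal_congruence_subgroup N \<subseteq> G \<and>
     (\<forall>M. 1 \<le> M \<and> M < N \<longrightarrow> \<not> principal_congruence_subgroup M \<subseteq> G)"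

definition projective_rep ::
  "'a::complex_algebra set \<Rightarrow> (int^2^2 \<Rightarrow> 'a \<Rightarrow> 'a) \<Rightarrow> bool" where
  "projective_rep V \<rho> \<longleftrightarrow>
     cvec.subspace V \<and>
     (\<forall>g\<in>carrier SL2Z. bij_betw (\<rho> g) V V \<and>
        (\<forall>x\<in>V. \<forall>y\<in>V. \<rho> g (x + y) = \<rho> g x + \<rho> g y) \<and>
        (\<forall>c. \<forall>x\<in>V. \<rho> g (c *\<^sub>C x) = c *\<^sub>C \<rho> g x)) \<and>
     (\<forall>g\<in>carrier SL2Z. \<forall>h\<in>carrier SL2Z.
        \<exists>c. c \<noteq> 0 \<and> (\<forall>x\<in>V. \<rho> (g \<otimes>\<^bsub>SL2Z\<^esub> h) x = c *\<^sub>C \<rho> g (\<rho> h x)))"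

definition projective_kernel ::
  "'a::complex_algebra set \<Rightarrow> (int^2^2 \<Rightarrow> 'a \<Rightarrow> 'a) \<Rightarrow> (int^2^2) set" where
  "projective_kernel V \<rho> = {g \<in> carrier SL2Z. \<exists>c. \<forall>x\<in>V. \<rho> g x = c *\<^sub>C x}"

text \<open>The representation on an invariant subspace \<open>V\<close> of the center.  Since \<open>s\<close> and \<open>t\<close>
  generate \<open>SL(2, \<int>)\<close>, for given \<open>V\<close> these conditions determine \<open>\<rho>\<close> on \<open>V\<close> up to a
  scalar for each group element.\<close>

definition LM_projective_rep ::
  "'n::{finite,linorder} dk set \<Rightarrow> (int^2^2 \<Rightarrow> 'n dk \<Rightarrow> 'n dk) \<Rightarrow> bool" where
  "LM_projective_rep V \<rho> \<longleftrightarrow> V \<subseteq> dk_center \<and> projective_rep V \<rho> \<and>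
     (\<forall>x\<in>V. \<rho> SL2Z_s x = S_LM x) \<and> (\<forall>x\<in>V. \<rho> SL2Z_t x = T_LM x)"

end

theory Submission
  imports Defs
begin

text \<open>Write \<open>L = K Kbar\<close>, a central involution, \<open>P = (1 + L)/2\<close>, \<open>Q = (1 - L)/2\<close>,
  \<open>\<omega> = \<xi>\<^sub>1 \<dots> \<xi>\<^sub>n \<xi>bar\<^sub>1 \<dots> \<xi>bar\<^sub>n\<close> and let \<open>\<gamma>\<close> be the product of the \<open>1 - \<xi>\<^sub>i \<xi>bar\<^sub>i\<close>.
  On the block \<open>P\<close> the algebra is an exterior algebra with \<open>K\<close> adjoined, on the block \<open>Q\<close> it is a
  Clifford algebra with \<open>K\<close> adjoined, and \<open>\<gamma>\<close> is the chirality element there.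
  The Higman ideal is spanned by \<open>P K \<omega>\<close>, \<open>Q\<close> and \<open>Q K \<gamma>\<close>. With the sign \<open>s = (-1)\<^sup>n\<^sup>/\<^sup>2\<close>, the
  operator \<open>T\<close> fixes \<open>s P K \<omega>\<close> and exchanges \<open>Q\<close> and \<open>Q K \<gamma>\<close>, while \<open>s S\<close> exchanges \<open>s P K \<omega>\<close> and \<open>Q\<close>
  and fixes \<open>Q K \<gamma>\<close>. Up to scalars this is the permutation action of \<open>SL(2, \<int>)\<close> on the three nonzero
  vectors mod 2, whose kernel is \<open>\<Gamma>(2)\<close>.\<close>

section \<open>Linear algebra over complex algebras\<close>

text \<open>The algebra is given only as a quotient of a free algebra, so at the start nothing is
  known about its size. The relations yield spanning by PBW monomials, but the integral of the dual
  is a coefficient in a basis, and independence needs a model: a Fock space in which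
  \<open>xi_i\<close> is a creation operator. The Higman map is made computable by reading the
  integral as a group average followed by a word in the odd generators; since the antipode reverses
  products, the word acts letter by letter, as \<open>2 n\<close> successive supercommutators. The
  other obstacle is the sum over all words in the R-matrix and in the ribbon element. The prescribed
  signs are exactly reordering signs, so each sum is a product over the indices \<open>i\<close> of
  factors 1 plus a nilpotent term. This gives the inverse of the R-matrix at once, shows that the
  sum in the ribbon element is half of \<open>\<gamma>\<close>, and turns \<open>S\<close> on a
  central element into one product over the sites. Since the integral of the dual reads only the top
  degree, just the degree 2 part of each factor then matters.\<close>

lemma clinear_span_mem:
  assumes "clinear f" "cvec.subspace U" "\<And>b. b \<in> B \<Longrightarrow> f b \<in> U" "x \<in> cvec.span B"
  shows "f x \<in> U"
proof -
  have "cvec.subspace {x. f x \<in> U}"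
    using assms(1,2) by (auto simp: cvec.subspace_def clinear_iff) (metis cvec.scale_zero_left)
  then show ?thesis
    using cvec.span_minimal[of B "{x. f x \<in> U}"] assms(3,4) by auto
qed

lemma clinear_mult_left: "clinear (\<lambda>x :: 'a::complex_algebra. a * x)"
  by (rule clinearI) (simp_all add: distrib_left)

lemma clinear_mult_right: "clinear (\<lambda>x :: 'a::complex_algebra. x * a)"
  by (rule clinearI) (simp_all add: distrib_right)

lemma two_scaleC: "2 *\<^sub>C x = x + (x :: 'a::complex_algebra)"
  using scaleC_add_left[of 1 1 x] by simp

lemma neg_self_zero:
  assumes "x = - x"
  shows "x = (0 :: 'a::complex_algebra)"
proof -
  have "2 *\<^sub>C x = 0" using assms by (metis add_eq_0_iff two_scaleC)
  then show ?thesis by simp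
qed

section \<open>Words in anticommuting elements\<close>

text \<open>Up to signs, \<open>f i\<close> travels to its own occurrence in the word; there a
  square appears, which is zero because it equals its own negative.\<close>

lemma anticommuting_word_mem:
  fixes f :: "'i \<Rightarrow> 'a::complex_algebra"
  assumes ac: "\<And>i j. f i * f j = - (f j * f i)" and "i \<in> set l"
  shows "f i * prod_list (map f l) = 0"
  using assms(2)
proof (induction l)
  case (Cons j l)
  have sq: "f i * f i = 0" by (rule neg_self_zero) (rule ac)
  show ?case
  proof (cases "i = j")
    case True
    have "f j * (f j * prod_list (map f l)) = 0"
      using sq True by (metis mult.assoc mult_zero_left)
    then show ?thesis using True by simp
  next
    case False
    then have *: "f i * prod_list (map f l) = 0" using Cons by simp
    have "f i * (f j * prod_list (map f l)) = - (f j * (f i * prod_list (map f l)))"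
      by (metis ac mult.assoc mult_minus_left)
    then show ?thesis by (simp add: *)
  qed
qed simp

lemma anticommuting_word_insort:
  fixes f :: "'i::linorder \<Rightarrow> 'a::complex_algebra"
  assumes ac: "\<And>i j. f i * f j = - (f j * f i)"
  shows "\<exists>c. f i * prod_list (map f l) = c *\<^sub>C prod_list (map f (insort i l))"
proof (induction l)
  case (Cons j l)
  show ?case
  proof (cases "i \<le> j")
    case True
    then show ?thesis by (intro exI[of _ 1]) simp
  next
    case False
    obtain c where "f i * prod_list (map f l) = c *\<^sub>C prod_list (map f (insort i l))"
      using Cons by blast
    moreover have "f i * (f j * prod_list (map f l)) = - (f j * (f i * prod_list (map f l)))"
      by (metis ac mult.assoc mult_minus_left)
    ultimately show ?thesis using False by (intro exI[of _ "-c"]) simp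
  qed
qed (intro exI[of _ 1], simp)

lemma anticommuting_word_insert:
  fixes f :: "'i::linorder \<Rightarrow> 'a::complex_algebra"
  assumes ac: "\<And>i j. f i * f j = - (f j * f i)" and "finite A"
  shows "\<exists>c. f i * prod_list (map f (sorted_list_of_set A))
    = c *\<^sub>C prod_list (map f (sorted_list_of_set (insert i A)))"
proof (cases "i \<in> A")
  case True
  then show ?thesis using anticommuting_word_mem[of f i "sorted_list_of_set A", OF ac] \<open>finite A\<close>
    by (intro exI[of _ 0]) simp
next
  case False
  then show ?thesis
    using anticommuting_word_insort[of f i "sorted_list_of_set A", OF ac] \<open>finite A\<close> by simp
qed

section \<open>The generators of $D\mathcal{K}_n$\<close>

text \<open>Classes of words span the quotient, and words grow by one letter on the left. This
  principle serves both centrality and PBW spanning.\<close>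

lemma dk_induct [case_names one add scale gen]:
  assumes one: "P 1" and add: "\<And>x y. P x \<Longrightarrow> P y \<Longrightarrow> P (x + y)"
    and scale: "\<And>c x. P x \<Longrightarrow> P (c *\<^sub>C x)" and gen: "\<And>g x. P x \<Longrightarrow> P (dk_gen g * x)"
  shows "P (x :: 'n dk)"
proof -
  have hom: "abs_dk (p + q) = abs_dk p + abs_dk q" "abs_dk (p * q) = abs_dk p * abs_dk q"
     "abs_dk (const_pm c * p) = c *\<^sub>C abs_dk p" for p q :: "'n gen word \<Rightarrow>\<^sub>0 complex" and c
    by (simp_all add: plus_dk.abs_eq times_dk.abs_eq scaleC_dk.abs_eq)
  have w: "P (abs_dk (Poly_Mapping.single (Word l) 1))" for l :: "'n gen list"
  proof (induction l)
    case Nil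
    then show ?case using one by (simp add: one_dk_def zero_word_def flip: single_one)
  next
    case (Cons g l)
    have "Poly_Mapping.single (Word (g # l)) 1 = letter g * Poly_Mapping.single (Word l) (1::complex)"
      by (simp add: mult_single plus_word_def)
    then show ?case using gen[OF Cons, of g] by (simp add: hom(2) dk_gen_def)
  qed
  have "P (abs_dk p)" for p
  proof (induction p rule: poly_mapping_add_induct)
    case (single k c)
    have "Poly_Mapping.single k c = const_pm c * Poly_Mapping.single k 1"
      by (simp add: mult_single)
    then show ?case using scale[OF w[of "letters k"], of c] by (simp add: hom(3))
  next
    case (add p q)
    then show ?case using assms(2) by (simp add: hom(1))
  qed
  then show ?thesis by (induction x rule: dk.abs_induct) blast
qed

section \<open>Clifford form of the relations between the odd generators\<close>

definition theta :: "'n + 'n \<Rightarrow> 'n dk" where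
  "theta = case_sum dk_xi dk_xibar"

definition dual_index :: "'n + 'n \<Rightarrow> 'n + 'n" where
  "dual_index = case_sum Inr Inl"

definition dk_L :: "'n dk" where "dk_L = dk_K * dk_Kbar"

abbreviation theta_word :: "('n + 'n) list \<Rightarrow> 'n dk" where
  "theta_word l \<equiv> prod_list (map theta l)"

lemma theta_simps [simp]: "theta (Inl i) = dk_xi i" "theta (Inr i) = dk_xibar i"
  by (simp_all add: theta_def)

lemma dual_index_simps [simp]: "dual_index (Inl i) = Inr i" "dual_index (Inr i) = Inl i"
  "dual_index (dual_index a) = a" "dual_index a \<noteq> a" "a \<noteq> dual_index a"
  by (simp_all add: dual_index_def split: sum.splits)

lemma inj_dual_index: "inj dual_index"
  by (metis injI dual_index_simps(3))

lemma KK [simp]: "dk_K * dk_K = 1" "dk_K * (dk_K * x) = x"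
  and KbKb [simp]: "dk_Kbar * dk_Kbar = 1" "dk_Kbar * (dk_Kbar * x) = x"
  by (simp_all add: dk_rels dk_group_left)

lemma theta_sq [simp]: "theta a * theta a = 0" "theta a * (theta a * x) = 0"
  by (cases a; simp add: dk_rels flip: mult.assoc)+

lemma K_theta: "dk_K * theta a = - (theta a * dk_K)" "dk_K * (theta a * x) = - (theta a * (dk_K * x))"
  and Kb_theta: "dk_Kbar * theta a = - (theta a * dk_Kbar)"
    "dk_Kbar * (theta a * x) = - (theta a * (dk_Kbar * x))"
  by (cases a; simp add: dk_rels(6-9) flip: mult.assoc)+

text \<open>A single Clifford relation for all odd generators. Its central value
  \<open>1 - dk_L\<close> becomes 0 on the block \<open>P\<close> and 2 on the block
  \<open>Q\<close>.\<close>

lemma theta_anticommute: "theta a * theta b = (if b = dual_index a then 1 - dk_L else 0) - theta b * theta a"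
proof (cases "b = dual_index a")
  case True
  then show ?thesis by (cases a) (simp_all add: dk_L_def dk_rels(12))
next
  case False
  have "theta a * theta b = - (theta b * theta a)"
  proof (cases a; cases b)
    fix i j assume "a = Inr i" "b = Inl j"
    then show ?thesis using False by (simp add: dk_xi_xibar)
  qed (use False in \<open>auto simp: dk_xi_xibar intro: dk_rels(10,11)\<close>)
  then show ?thesis using False by simp
qed

text \<open>\<open>dk_K\<close> and \<open>dk_Kbar\<close> each contribute a sign against an odd
  generator, and the two signs cancel.\<close>

lemma dk_L_central: "dk_L * x = x * dk_L"
proof (induction x rule: dk_induct)
  case (gen g x)
  have "dk_L * dk_gen g = dk_gen g * dk_L"
    by (cases g) (simp_all add: dk_L_def dk_group_left mult.assoc)
  then show ?case by (metis gen mult.assoc)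
qed (simp_all add: distrib_left distrib_right)

lemma dk_L_left: "x * (dk_L * y) = dk_L * (x * y)"
  by (metis dk_L_central mult.assoc)

lemma dk_one_minus_L_left: "x * ((1 - dk_L) * y) = (1 - dk_L) * (x * y)"
  by (simp add: left_diff_distrib right_diff_distrib dk_L_left)

lemma dk_L_sq [simp]: "dk_L * dk_L = 1" "dk_L * (dk_L * x) = x"
proof -
  show *: "dk_L * dk_L = 1" by (simp only: dk_L_def dk_rels(3))
  show "dk_L * (dk_L * x) = x" using * by (metis mult.assoc mult_1_left)
qed

lemma dk_center_iff: "z \<in> dk_center \<longleftrightarrow> (\<forall>g. z * dk_gen g = dk_gen g * z)"
proof
  assume *: "\<forall>g. z * dk_gen g = dk_gen g * z"
  have "z * x = x * z" for x
  proof (induction x rule: dk_induct)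
    case (gen g x)
    then show ?case by (metis * mult.assoc)
  qed (simp_all add: distrib_left distrib_right)
  then show "z \<in> dk_center" by (simp add: dk_center_def)
qed (simp add: dk_center_def)

lemma dk_center_iff_theta:
  "z \<in> dk_center \<longleftrightarrow> z * dk_K = dk_K * z \<and> z * dk_Kbar = dk_Kbar * z \<and> (\<forall>a. z * theta a = theta a * z)"
proof -
  have 1: "(\<forall>g. R g) \<longleftrightarrow> R gen_K \<and> R gen_Kbar \<and> (\<forall>i. R (gen_xi i)) \<and> (\<forall>i. R (gen_xibar i))"
    for R :: "'n gen \<Rightarrow> bool" by (metis gen.exhaust)
  show ?thesis unfolding dk_center_iff 1 by (auto simp: theta_def split: sum.splits)
qed

lemma theta_word_K: "dk_K * theta_word l = (- 1) ^ length l *\<^sub>C (theta_word l * dk_K)"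
  and theta_word_Kb: "dk_Kbar * theta_word l = (- 1) ^ length l *\<^sub>C (theta_word l * dk_Kbar)"
  by (induction l) (simp_all add: K_theta Kb_theta mult.assoc)

lemma xi_word_theta: "xi_word A = theta_word (map Inl (sorted_list_of_set A))"
  and xibar_word_theta: "xibar_word A = theta_word (map Inr (sorted_list_of_set A))"
  by (simp_all add: xi_word_def xibar_word_def comp_def)

lemma xi_word_insert:
  "finite A \<Longrightarrow> \<exists>c. dk_xi i * xi_word A = c *\<^sub>C xi_word (insert i A)"
  unfolding xi_word_def by (rule anticommuting_word_insert[OF dk_rels(10)])

lemma xibar_word_insert:
  "finite A \<Longrightarrow> \<exists>c. dk_xibar i * xibar_word A = c *\<^sub>C xibar_word (insert i A)"
  unfolding xibar_word_def by (rule anticommuting_word_insert[OF dk_rels(11)])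

text \<open>On its way to the right \<open>dk_xibar i\<close> meets \<open>dk_xi i\<close> at most
  once and leaves one contraction. The clause on \<open>c\<close> gives the contraction-free
  reordering used in \<open>xi_xibar_pairs\<close>.\<close>

lemma xibar_xi_word_list:
  assumes "distinct l"
  shows "\<exists>c. dk_xibar i * prod_list (map dk_xi l)
    = (- 1) ^ length l *\<^sub>C (prod_list (map dk_xi l) * dk_xibar i)
      + c *\<^sub>C ((1 - dk_L) * prod_list (map dk_xi (remove1 i l)))
    \<and> (i \<notin> set l \<longrightarrow> c = 0)"
  using assms
proof (induction l)
  case (Cons j l)
  let ?w = "prod_list (map dk_xi l)"
  obtain c where c: "dk_xibar i * ?w = (- 1) ^ length l *\<^sub>C (?w * dk_xibar i)
      + c *\<^sub>C ((1 - dk_L) * prod_list (map dk_xi (remove1 i l)))"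
    "i \<notin> set l \<longrightarrow> c = 0"
    using Cons by auto
  show ?case
  proof (cases "i = j")
    case True
    have "dk_xibar i * (dk_xi j * ?w) = (1 - dk_L) * ?w - dk_xi j * (dk_xibar i * ?w)"
      using theta_anticommute[of "Inr i" "Inl j"] True
      by (simp add: left_diff_distrib flip: mult.assoc)
    then show ?thesis using True Cons.prems c by (intro exI[of _ 1]) (simp add: mult.assoc)
  next
    case False
    have "dk_xibar i * (dk_xi j * ?w) = - (dk_xi j * (dk_xibar i * ?w))"
      using theta_anticommute[of "Inr i" "Inl j"] False by (simp flip: mult.assoc)
    also have "\<dots> = (- 1) ^ length (j # l) *\<^sub>C (prod_list (map dk_xi (j # l)) * dk_xibar i)
      + (- c) *\<^sub>C ((1 - dk_L) * prod_list (map dk_xi (remove1 i (j # l))))"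
      using False by (simp add: c(1) distrib_left mult.assoc dk_one_minus_L_left)
    finally show ?thesis using c False by (intro exI[of _ "-c"]) auto
  qed
qed (intro exI[of _ 0], simp)

lemma xibar_xi_word:
  assumes "finite A"
  shows "\<exists>c. dk_xibar i * xi_word A = (- 1) ^ card A *\<^sub>C (xi_word A * dk_xibar i)
      + c *\<^sub>C ((1 - dk_L) * xi_word (A - {i}))"
  using xibar_xi_word_list[of "sorted_list_of_set A" i] assms
  by (auto simp: xi_word_def sorted_list_of_set_remove)

section \<open>PBW spanning sets\<close>

text \<open>A filtration by the number of odd letters, with group part taken from \<open>G\<close>:
  \<open>K_set\<close> for the whole algebra, \<open>L_set\<close> for the elements built from odd
  letters alone.\<close>

definition pbw_span :: "'n::{finite,linorder} dk set \<Rightarrow> nat \<Rightarrow> 'n dk set" where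
  "pbw_span G d = cvec.span {g * xi_word A * xibar_word B | g A B. g \<in> G \<and> card A + card B \<le> d}"

lemma pbw_subspace: "cvec.subspace (pbw_span G d)"
  by (simp add: pbw_span_def)

lemma pbw_base: "g \<in> G \<Longrightarrow> card A + card B \<le> d \<Longrightarrow> g * xi_word A * xibar_word B \<in> pbw_span G d"
  unfolding pbw_span_def by (rule cvec.span_base) blast

lemma pbw_scale: "x \<in> pbw_span G d \<Longrightarrow> c *\<^sub>C x \<in> pbw_span G d"
  and pbw_add: "x \<in> pbw_span G d \<Longrightarrow> y \<in> pbw_span G d \<Longrightarrow> x + y \<in> pbw_span G d"
  and pbw_diff: "x \<in> pbw_span G d \<Longrightarrow> y \<in> pbw_span G d \<Longrightarrow> x - y \<in> pbw_span G d"
  by (simp_all add: pbw_span_def cvec.span_scale cvec.span_add cvec.span_diff)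

lemma pbw_mono: "d \<le> e \<Longrightarrow> G \<subseteq> G' \<Longrightarrow> pbw_span G d \<subseteq> pbw_span G' e"
  unfolding pbw_span_def by (rule cvec.span_mono) fastforce

lemma pbw_bounded: "pbw_span (G :: 'n::{finite,linorder} dk set) d \<subseteq> pbw_span G (2 * CARD('n))"
  unfolding pbw_span_def
proof (rule cvec.span_mono)
  have "card A + card B \<le> 2 * CARD('n)" for A B :: "'n set"
    using card_mono[of UNIV A] card_mono[of UNIV B] by simp
  then show "{g * xi_word A * xibar_word B |g A B. g \<in> G \<and> card A + card B \<le> d}
    \<subseteq> {g * xi_word A * xibar_word B |g A B. g \<in> G \<and> card A + card B \<le> 2 * CARD('n)}"
    by blast
qed

text \<open>A letter \<open>xi\<close> is absorbed by the left word. A letter \<open>xibar\<close>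
  first crosses that word; the contraction loses a letter but multiplies the group part by
  \<open>1 - dk_L\<close>, hence the closure of \<open>G\<close> under \<open>dk_L\<close>.\<close>

lemma pbw_theta:
  fixes G :: "'n::{finite,linorder} dk set"
  assumes L: "\<And>g. g \<in> G \<Longrightarrow> g * dk_L \<in> G"
    and comm: "\<And>g. g \<in> G \<Longrightarrow> \<exists>c. \<forall>a. theta a * g = c *\<^sub>C (g * theta a)"
    and "x \<in> pbw_span G d"
  shows "theta a * x \<in> pbw_span G (Suc d)"
proof (rule clinear_span_mem[OF clinear_mult_left pbw_subspace _ assms(3)[unfolded pbw_span_def]])
  fix b :: "'n dk" assume "b \<in> {g * xi_word A * xibar_word B |g A B. g \<in> G \<and> card A + card B \<le> d}"
  then obtain g A B where b: "b = g * xi_word A * xibar_word B" and g: "g \<in> G"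
    and d: "card A + card B \<le> d" by blast
  obtain c where c: "theta a * g = c *\<^sub>C (g * theta a)" using comm[OF g] by blast
  have *: "theta a * b = c *\<^sub>C (g * (theta a * xi_word A * xibar_word B))"
    by (simp add: b c flip: mult.assoc)
  show "theta a * b \<in> pbw_span G (Suc d)"
  proof (cases a)
    case (Inl i)
    obtain e where e: "dk_xi i * xi_word A = e *\<^sub>C xi_word (insert i A)"
      using xi_word_insert[of A i] by auto
    have "theta a * b = (c * e) *\<^sub>C (g * xi_word (insert i A) * xibar_word B)"
      by (subst *) (simp only: Inl theta_simps e, simp add: mult.assoc)
    also have "\<dots> \<in> pbw_span G (Suc d)"
      using d card_insert_le_m1[of "Suc (card A)" A i] by (intro pbw_scale pbw_base g) simp
    finally show ?thesis .
  next
    case (Inr i)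
    obtain e where e: "dk_xibar i * xi_word A = (- 1) ^ card A *\<^sub>C (xi_word A * dk_xibar i)
      + e *\<^sub>C ((1 - dk_L) * xi_word (A - {i}))"
      using xibar_xi_word[of A i] by auto
    obtain f where f: "dk_xibar i * xibar_word B = f *\<^sub>C xibar_word (insert i B)"
      using xibar_word_insert[of B i] by auto
    have "theta a * b = c *\<^sub>C (((- 1) ^ card A * f) *\<^sub>C (g * xi_word A * xibar_word (insert i B))
        + e *\<^sub>C (g * xi_word (A - {i}) * xibar_word B - g * dk_L * xi_word (A - {i}) * xibar_word B))"
      by (subst *) (simp only: Inr theta_simps e, simp add: f mult.assoc distrib_left distrib_right left_diff_distrib right_diff_distrib)
    also have "\<dots> \<in> pbw_span G (Suc d)"
      using d card_insert_le_m1[of "Suc (card B)" B i] card_Diff1_le[of A i]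
      by (intro pbw_scale pbw_add pbw_diff pbw_base g L[OF g]) simp_all
    finally show ?thesis .
  qed
qed

abbreviation L_set :: "'n dk set" where "L_set \<equiv> {1, dk_L}"
abbreviation K_set :: "'n dk set" where "K_set \<equiv> {1, dk_K, dk_Kbar, dk_L}"

lemma K_L [simp]: "dk_K * dk_L = dk_Kbar" "dk_Kbar * dk_L = dk_K"
    "dk_L * dk_K = dk_Kbar" "dk_L * dk_Kbar = dk_K"
  by (simp_all add: dk_L_def dk_group_left mult.assoc)

lemma K_L_left [simp]: "dk_K * (dk_L * x) = dk_Kbar * x" "dk_Kbar * (dk_L * x) = dk_K * x"
    "dk_L * (dk_K * x) = dk_Kbar * x" "dk_L * (dk_Kbar * x) = dk_K * x"
  by (simp_all flip: mult.assoc)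

lemma K_Kb [simp]: "dk_K * dk_Kbar = dk_L" "dk_Kbar * dk_K = dk_L"
  by (simp_all add: dk_L_def dk_group_left)

lemma K_Kb_left [simp]: "dk_K * (dk_Kbar * x) = dk_L * x" "dk_Kbar * (dk_K * x) = dk_L * x"
  by (simp_all flip: mult.assoc)

lemma theta_K_set: "g \<in> K_set \<Longrightarrow> \<exists>c. \<forall>a. theta a * g = c *\<^sub>C (g * theta a)"
proof -
  assume "g \<in> K_set"
  then consider "g \<in> {1, dk_L}" | "g \<in> {dk_K, dk_Kbar}" by blast
  then show ?thesis
  proof cases
    case 1
    then show ?thesis by (intro exI[of _ 1]) (auto simp: dk_L_central)
  next
    case 2
    then show ?thesis by (intro exI[of _ "-1"]) (auto simp: K_theta Kb_theta)
  qed
qed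

lemma pbw_theta_L: "x \<in> pbw_span L_set d \<Longrightarrow> theta a * x \<in> pbw_span L_set (Suc d)"
  by (rule pbw_theta) (auto intro: theta_K_set)

lemma pbw_theta_K: "x \<in> pbw_span K_set d \<Longrightarrow> theta a * x \<in> pbw_span K_set (Suc d)"
  by (rule pbw_theta) (auto intro: theta_K_set[simplified])

lemma pbw_K_mult:
  fixes x :: "'n::{finite,linorder} dk"
  assumes "h \<in> K_set" "x \<in> pbw_span K_set d"
  shows "h * x \<in> pbw_span K_set d"
proof (rule clinear_span_mem[OF clinear_mult_left pbw_subspace _ assms(2)[unfolded pbw_span_def]])
  fix b :: "'n dk" assume "b \<in> {g * xi_word A * xibar_word B |g A B. g \<in> K_set \<and> card A + card B \<le> d}"
  then obtain g A B where b: "b = g * xi_word A * xibar_word B" "g \<in> K_set" "card A + card B \<le> d"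
    by blast
  have "h * g \<in> K_set" using assms(1) b(2) by auto
  then show "h * b \<in> pbw_span K_set d"
    using pbw_base[of "h * g" K_set A B d] b by (simp add: mult.assoc)
qed

lemma pbw_one: "1 \<in> G \<Longrightarrow> 1 \<in> pbw_span G d"
  using pbw_base[of 1 G "{}" "{}" d] by (simp add: xi_word_def xibar_word_def)

lemma theta_word_L: "theta_word l \<in> pbw_span L_set (length l)"
  by (induction l) (simp_all add: pbw_one pbw_theta_L)

lemma pbw_theta_word_mult:
  "x \<in> pbw_span K_set d \<Longrightarrow> theta_word l * x \<in> pbw_span K_set (length l + d)"
  by (induction l) (simp_all add: pbw_theta_K mult.assoc)

lemma length_xi_word:
  "length (map Inl (sorted_list_of_set A)) = card (A :: 'n::{finite,linorder} set)"
  "length (map Inr (sorted_list_of_set A)) = card (A :: 'n::{finite,linorder} set)"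
  by simp_all

text \<open>The left factor acts letter by letter, and each odd letter raises the degree bound by
  one, so degrees add.\<close>

lemma pbw_mult:
  fixes x :: "'n::{finite,linorder} dk"
  assumes "x \<in> pbw_span K_set d" "y \<in> pbw_span K_set e"
  shows "x * y \<in> pbw_span K_set (d + e)"
proof (rule clinear_span_mem[OF clinear_mult_right pbw_subspace _ assms(1)[unfolded pbw_span_def]])
  fix b :: "'n dk" assume "b \<in> {g * xi_word A * xibar_word B |g A B. g \<in> K_set \<and> card A + card B \<le> d}"
  then obtain g A B where b: "b = g * xi_word A * xibar_word B" "g \<in> K_set" "card A + card B \<le> d"
    by blast
  have "b * y = g * (xi_word A * (xibar_word B * y))" by (simp add: b mult.assoc)
  also have "\<dots> \<in> pbw_span K_set (card A + (card B + e))"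
    unfolding xi_word_theta xibar_word_theta
    using pbw_K_mult[OF b(2) pbw_theta_word_mult[OF pbw_theta_word_mult[OF assms(2)]]]
    by (metis length_xi_word)
  also have "\<dots> \<subseteq> pbw_span K_set (d + e)"
    using b(3) by (intro pbw_mono) auto
  finally show "b * y \<in> pbw_span K_set (d + e)" .
qed

text \<open>An odd generator raises the degree bound, but a PBW monomial has at most
  \<open>2 n\<close> odd letters, so by \<open>pbw_bounded\<close> the bound falls back.\<close>

lemma pbw_UNIV: "(x :: 'n::{finite,linorder} dk) \<in> pbw_span K_set (2 * CARD('n))"
proof (induction x rule: dk_induct)
  case (gen g x)
  show ?case
  proof (cases g)
    case gen_K
    then show ?thesis using pbw_K_mult[OF _ gen] by simp
  next
    case gen_Kbar
    then show ?thesis using pbw_K_mult[OF _ gen] by simp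
  next
    case (gen_xi i)
    then show ?thesis using pbw_theta_K[OF gen, of "Inl i"] pbw_bounded by auto
  next
    case (gen_xibar i)
    then show ?thesis using pbw_theta_K[OF gen, of "Inr i"] pbw_bounded by auto
  qed
qed (simp_all add: pbw_one pbw_add pbw_scale)

lemma dk_pbw_basis_eq:
  "(dk_pbw_basis :: 'n::{finite,linorder} dk set) = {g * xi_word A * xibar_word B | g A B. g \<in> K_set}"
proof -
  have "(\<exists>a b. P (dk_K ^ a * dk_Kbar ^ b) \<and> a \<in> {0, 1} \<and> b \<in> {0, 1 :: nat}) \<longleftrightarrow> (\<exists>g \<in> K_set. P g)"
    for P :: "'n dk \<Rightarrow> bool" by (simp add: conj_disj_distribL ex_disj_distrib)
  note eq = this[of "\<lambda>g. \<exists>A B. x = g * xi_word A * xibar_word B" for x]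
  show ?thesis
  proof (rule Set.set_eqI)
    fix x :: "'n dk"
    have "x \<in> dk_pbw_basis \<longleftrightarrow>
      (\<exists>a b. (\<exists>A B. x = dk_K ^ a * dk_Kbar ^ b * xi_word A * xibar_word B) \<and> a \<in> {0, 1} \<and> b \<in> {0, 1})"
      unfolding dk_pbw_basis_def by blast
    also note eq
    also have "(\<exists>g\<in>K_set. \<exists>A B. x = g * xi_word A * xibar_word B) \<longleftrightarrow>
       x \<in> {g * xi_word A * xibar_word B | g A B. g \<in> K_set}" by blast
    finally show "x \<in> dk_pbw_basis \<longleftrightarrow> x \<in> {g * xi_word A * xibar_word B | g A B. g \<in> K_set}" .
  qed
qed

lemma span_dk_pbw_basis: "cvec.span dk_pbw_basis = (UNIV :: 'n::{finite,linorder} dk set)"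
proof -
  have "{g * xi_word A * xibar_word B | g A B. g \<in> K_set \<and> card A + card B \<le> d}
     \<subseteq> (dk_pbw_basis :: 'n dk set)" for d
    unfolding dk_pbw_basis_eq by blast
  from cvec.span_mono[OF this, of "2 * CARD('n)"] show ?thesis
    using pbw_UNIV unfolding pbw_span_def by blast
qed

section \<open>The Fock representation and the PBW basis\<close>

text \<open>Linear endomorphisms of a function space, made a type because \<open>free_hom\<close>
  takes its values in a type of class \<open>complex_algebra\<close>.\<close>

typedef 's endo = "{f :: ('s \<Rightarrow> complex) \<Rightarrow> 's \<Rightarrow> complex.
    (\<forall>u v. f (\<lambda>s. u s + v s) = (\<lambda>s. f u s + f v s)) \<and> (\<forall>c v. f (\<lambda>s. c * v s) = (\<lambda>s. c * f v s))}"
  morphisms endo_app Endo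
  by (rule exI[of _ id]) simp

setup_lifting type_definition_endo

lemma endo_app_linear:
  "endo_app f (\<lambda>s. u s + v s) = (\<lambda>s. endo_app f u s + endo_app f v s)"
  "endo_app f (\<lambda>s. c * v s) = (\<lambda>s. c * endo_app f v s)"
  using endo_app[of f] by auto

instantiation endo :: (type) complex_algebra
begin
lift_definition zero_endo :: "'a endo" is "\<lambda>v s. 0" by simp
lift_definition one_endo :: "'a endo" is "\<lambda>v. v" by simp
lift_definition plus_endo :: "'a endo \<Rightarrow> 'a endo \<Rightarrow> 'a endo" is "\<lambda>f g v s. f v s + g v s"
  by (auto simp: algebra_simps)
lift_definition uminus_endo :: "'a endo \<Rightarrow> 'a endo" is "\<lambda>f v s. - f v s" by auto
lift_definition minus_endo :: "'a endo \<Rightarrow> 'a endo \<Rightarrow> 'a endo" is "\<lambda>f g v s. f v s - g v s"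
  by (auto simp: algebra_simps)
lift_definition times_endo :: "'a endo \<Rightarrow> 'a endo \<Rightarrow> 'a endo" is "\<lambda>f g v. f (g v)" by auto
lift_definition scaleC_endo :: "complex \<Rightarrow> 'a endo \<Rightarrow> 'a endo" is "\<lambda>c f v s. c * f v s"
  by (auto simp: algebra_simps)
instance
proof
  show "(0 :: 'a endo) \<noteq> 1"
    by transfer (metis (mono_tags) zero_neq_one)
qed (transfer; auto simp: algebra_simps)+
end

lemma endo_app_simps [simp]:
  "endo_app 0 v s = 0" "endo_app 1 v = v" "endo_app (f + g) v s = endo_app f v s + endo_app g v s"
  "endo_app (- f) v s = - endo_app f v s" "endo_app (f - g) v s = endo_app f v s - endo_app g v s"
  "endo_app (f * g) v = endo_app f (endo_app g v)" "endo_app (c *\<^sub>C f) v s = c * endo_app f v s"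
  by (transfer; simp)+

lemma endo_eqI: "(\<And>v s. endo_app f v s = endo_app g v s) \<Longrightarrow> f = g"
  by transfer blast

text \<open>Any strict total order on the modes would do for the signs.\<close>

fun mode_less :: "'n::linorder + 'n \<Rightarrow> 'n + 'n \<Rightarrow> bool" where
  "mode_less (Inl i) (Inl j) \<longleftrightarrow> i < j"
| "mode_less (Inl i) (Inr j) \<longleftrightarrow> True"
| "mode_less (Inr i) (Inl j) \<longleftrightarrow> False"
| "mode_less (Inr i) (Inr j) \<longleftrightarrow> i < j"

lemma mode_less_total: "a \<noteq> b \<Longrightarrow> mode_less b a \<longleftrightarrow> \<not> mode_less a b"
  and mode_less_irrefl [simp]: "\<not> mode_less a a"
  by (cases a; cases b; auto)+

text \<open>The Jordan-Wigner sign, which makes operators at different modes anticommute.\<close>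

definition fock_sign :: "'n::{finite,linorder} + 'n \<Rightarrow> ('n + 'n) set \<Rightarrow> complex" where
  "fock_sign a S = (- 1) ^ card {b \<in> S. mode_less b a}"

lemma fock_sign_insert [simp]:
  assumes "b \<notin> S"
  shows "fock_sign a (insert b S) = (if mode_less b a then - fock_sign a S else fock_sign a S)"
proof -
  have "{c \<in> insert b S. mode_less c a} =
      (if mode_less b a then insert b {c \<in> S. mode_less c a} else {c \<in> S. mode_less c a})" by auto
  then show ?thesis using assms by (simp add: fock_sign_def)
qed

lemma fock_sign_remove [simp]:
  assumes "b \<in> S"
  shows "fock_sign a (S - {b}) = (if mode_less b a then - fock_sign a S else fock_sign a S)"
  using fock_sign_insert[of b "S - {b}" a] assms by (simp add: insert_absorb split: if_splits)

lemma fock_sign_sq [simp]: "fock_sign a S * fock_sign a S = 1" "fock_sign a S * (fock_sign a S * c) = c"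
  by (simp_all add: fock_sign_def flip: mult.assoc power_mult_distrib)

lemma fock_sign_nonzero [simp]: "fock_sign a S \<noteq> 0"
  by (simp add: fock_sign_def)

text \<open>The set holds the occupied modes. The two bits carry the regular representation of the
  four-element group generated by \<open>K\<close> and \<open>Kbar\<close>, so that its elements
  stay independent.\<close>

type_synonym 'n fock = "('n + 'n) set \<times> bool \<times> bool"

text \<open>Operators act on amplitude functions, so the new amplitude at \<open>S\<close> is read
  off at \<open>S - {a}\<close>. The action on basis states runs in the opposite direction, see
  \<open>fock_state_create\<close>.\<close>

lift_definition fock_create :: "'n::{finite,linorder} + 'n \<Rightarrow> 'n fock endo" is
  "\<lambda>a v (S, p, q). if a \<in> S then fock_sign a S * v (S - {a}, p, q) else 0"
  by (auto simp: algebra_simps)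

lift_definition fock_annihilate :: "'n::{finite,linorder} + 'n \<Rightarrow> 'n fock endo" is
  "\<lambda>a v (S, p, q). if a \<in> S then 0 else fock_sign a S * v (insert a S, p, q)"
  by (auto simp: algebra_simps)

lift_definition fock_K :: "'n::{finite,linorder} fock endo" is
  "\<lambda>v (S, p, q). (- 1) ^ card S * v (S, \<not> p, q)"
  by (auto simp: algebra_simps)

lift_definition fock_Kbar :: "'n::{finite,linorder} fock endo" is
  "\<lambda>v (S, p, q). (- 1) ^ card S * v (S, p, \<not> q)"
  by (auto simp: algebra_simps)

lemma fock_app [simp]:
  "endo_app (fock_create a) v (S, p, q) = (if a \<in> S then fock_sign a S * v (S - {a}, p, q) else 0)"
  "endo_app (fock_annihilate a) v (S, p, q) = (if a \<in> S then 0 else fock_sign a S * v (insert a S, p, q))"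
  "endo_app fock_K v (S, p, q) = (- 1) ^ card S * v (S, \<not> p, q)"
  "endo_app fock_Kbar v (S, p, q) = (- 1) ^ card S * v (S, p, \<not> q)"
  by (transfer; simp)+

lemma fock_create_create:
  fixes a b :: "'n::{finite,linorder} + 'n"
  shows "fock_create a * fock_create b = - (fock_create b * fock_create a)"
proof (rule endo_eqI)
  fix v :: "'n fock \<Rightarrow> complex" and s :: "'n fock"
  obtain S p q where s: "s = (S, p, q)" by (cases s)
  have *: "S - {a} - {b} = S - {b} - {a}" by blast
  show "endo_app (fock_create a * fock_create b) v s = endo_app (- (fock_create b * fock_create a)) v s"
    using mode_less_total[of a b] by (cases "a = b") (auto simp: s *)
qed

lemma fock_annihilate_annihilate:
  fixes a b :: "'n::{finite,linorder} + 'n"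
  shows "fock_annihilate a * fock_annihilate b = - (fock_annihilate b * fock_annihilate a)"
proof (rule endo_eqI)
  fix v :: "'n fock \<Rightarrow> complex" and s :: "'n fock"
  obtain S p q where s: "s = (S, p, q)" by (cases s)
  have *: "insert a (insert b S) = insert b (insert a S)" by blast
  show "endo_app (fock_annihilate a * fock_annihilate b) v s
      = endo_app (- (fock_annihilate b * fock_annihilate a)) v s"
    using mode_less_total[of a b] by (cases "a = b") (auto simp: s *)
qed

lemma fock_annihilate_create:
  fixes a b :: "'n::{finite,linorder} + 'n"
  shows "fock_annihilate a * fock_create b = (if a = b then 1 else 0) - fock_create b * fock_annihilate a"
proof (rule endo_eqI)
  fix v :: "'n fock \<Rightarrow> complex" and s :: "'n fock"
  obtain S p q where s: "s = (S, p, q)" by (cases s)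
  show "endo_app (fock_annihilate a * fock_create b) v s
      = endo_app ((if a = b then 1 else 0) - fock_create b * fock_annihilate a) v s"
    using mode_less_total[of a b]
    by (cases "a = b") (auto simp: s insert_absorb insert_Diff_if)
qed

lemma minus_one_power_sq [simp]: "(- 1) ^ k * ((- 1) ^ k * c) = (c :: complex)"
  by (simp flip: mult.assoc power_mult_distrib)

lemma fock_K_mult:
  "fock_K * fock_K = 1" "fock_Kbar * fock_Kbar = 1" "fock_Kbar * fock_K = fock_K * fock_Kbar"
  by (rule endo_eqI; auto)+

lemma card_remove_sign:
  "finite S \<Longrightarrow> a \<in> S \<Longrightarrow> (- 1) ^ (card S - Suc 0) = - ((- 1) ^ card S :: complex)"
  by (cases "card S") auto

lemma fock_K_anticommute:
  "fock_K * fock_create a = - (fock_create a * fock_K)"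
  "fock_Kbar * fock_create a = - (fock_create a * fock_Kbar)"
  "fock_K * fock_annihilate a = - (fock_annihilate a * fock_K)"
  "fock_Kbar * fock_annihilate a = - (fock_annihilate a * fock_Kbar)"
  by (rule endo_eqI; auto simp: card_remove_sign[OF finite])+

text \<open>The generator \<open>\<xi>\<^sub>i\<close> creates a mode; \<open>\<xi>bar\<^sub>i\<close> creates a second mode and, through the defect
  \<open>1 - K Kbar\<close>, annihilates the first one, which reproduces the mixed anticommutator.\<close>

definition fock_defect :: "'n::{finite,linorder} fock endo" where
  "fock_defect = 1 - fock_K * fock_Kbar"

fun fock_gen :: "'n::{finite,linorder} gen \<Rightarrow> 'n fock endo" where
  "fock_gen gen_K = fock_K"
| "fock_gen gen_Kbar = fock_Kbar"
| "fock_gen (gen_xi i) = fock_create (Inl i)"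
| "fock_gen (gen_xibar i) = fock_create (Inr i) + fock_defect * fock_annihilate (Inl i)"

text \<open>Anticommuting with both \<open>fock_K\<close> and \<open>fock_Kbar\<close> means
  commuting with their product.\<close>

lemma fock_defect_commute:
  fixes f :: "'n::{finite,linorder} fock endo"
  assumes "fock_K * f = - (f * fock_K)" "fock_Kbar * f = - (f * fock_Kbar)"
  shows "f * fock_defect = fock_defect * f" "f * (fock_defect * h) = fock_defect * (f * h)"
proof -
  have "fock_K * fock_Kbar * f = - ((fock_K * f) * fock_Kbar)"
    by (simp add: assms(2) mult.assoc)
  also have "\<dots> = f * (fock_K * fock_Kbar)"
    by (simp add: assms(1) mult.assoc)
  finally show *: "f * fock_defect = fock_defect * f"
    by (simp add: fock_defect_def left_diff_distrib right_diff_distrib)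
  show "f * (fock_defect * h) = fock_defect * (f * h)"
    using arg_cong[OF *, of "\<lambda>x. x * h"] by (simp add: mult.assoc)
qed

lemmas fock_defect_simps =
  fock_defect_commute[OF fock_K_anticommute(1,2)] fock_defect_commute[OF fock_K_anticommute(3,4)]

lemma fock_K_defect:
  fixes h :: "'n::{finite,linorder} fock endo"
  shows "fock_K * (fock_defect * h) = fock_defect * (fock_K * h)"
  "fock_Kbar * (fock_defect * h) = fock_defect * (fock_Kbar * h)"
proof -
  have "fock_K * (fock_K * x) = x" "fock_Kbar * (fock_Kbar * x) = x"
    "fock_Kbar * (fock_K * x) = fock_K * (fock_Kbar * x)" for x :: "'n fock endo"
    by (simp_all add: fock_K_mult flip: mult.assoc)
  then have "fock_K * (fock_defect :: 'n fock endo) = fock_defect * fock_K"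
    "fock_Kbar * (fock_defect :: 'n fock endo) = fock_defect * fock_Kbar"
    unfolding fock_defect_def left_diff_distrib right_diff_distrib
    by (simp_all add: fock_K_mult mult.assoc)
  then show "fock_K * (fock_defect * h) = fock_defect * (fock_K * h)"
  "fock_Kbar * (fock_defect * h) = fock_defect * (fock_Kbar * h)"
    by (metis mult.assoc)+
qed

text \<open>The creating part lives on \<open>Inr\<close> modes and the annihilating part on
  \<open>Inl\<close> modes, so all cross terms anticommute and the defect leaves no scalar
  term.\<close>

lemma fock_xibar_anticommute:
  "fock_gen (gen_xibar i) * fock_gen (gen_xibar j) = - (fock_gen (gen_xibar j) * fock_gen (gen_xibar i))"
  by (simp add: distrib_left distrib_right mult.assoc fock_defect_simps fock_annihilate_create
      fock_create_create[of "Inr i" "Inr j"] fock_annihilate_annihilate[of "Inl i" "Inl j"])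

lemma fock_gen_relation:
  assumes "dk_relation l r"
  shows "free_hom fock_gen l = free_hom fock_gen r"
  using assms
proof cases
  case 3
  have "fock_K * fock_Kbar * (fock_K * fock_Kbar) = fock_K * (fock_Kbar * fock_K) * fock_Kbar"
    by (simp only: mult.assoc)
  also have "\<dots> = (fock_K * fock_K) * (fock_Kbar * fock_Kbar)"
    by (simp only: fock_K_mult(3) mult.assoc)
  finally show ?thesis by (simp add: 3 free_hom_simps fock_K_mult)
next
  case (4 i)
  then show ?thesis using neg_self_zero[OF fock_create_create] by (simp add: free_hom_simps)
next
  case (5 i)
  then show ?thesis using neg_self_zero[OF fock_xibar_anticommute]
    by (simp add: free_hom_simps del: fock_gen.simps)
next
  case (11 i j)
  then show ?thesis using fock_xibar_anticommute[of i j]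
    by (simp add: free_hom_simps del: fock_gen.simps)
next
  case (10 i j)
  then show ?thesis using fock_create_create[of "Inl i" "Inl j"] by (simp add: free_hom_simps)
next
  case (12 i j)
  then show ?thesis using fock_create_create[of "Inl i" "Inr j"]
    by (simp add: free_hom_simps distrib_left distrib_right mult.assoc fock_defect_simps
      fock_annihilate_create)
next
  case (13 i)
  \<comment> \<open>Creation and annihilation of the same mode \<open>Inl i\<close> meet here; their
    anticommutator 1 times the defect is the term \<open>1 - K Kbar\<close>.\<close>
  then show ?thesis using fock_create_create[of "Inl i" "Inr i"]
    by (simp add: free_hom_simps distrib_left distrib_right right_diff_distrib mult.assoc fock_defect_simps
      fock_annihilate_create) (simp add: fock_defect_def)
qed (simp_all add: free_hom_simps fock_K_mult fock_K_anticommute distrib_left distrib_right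
      mult.assoc fock_K_defect)

lift_definition fock_rep :: "'n::{finite,linorder} dk \<Rightarrow> 'n fock endo" is "free_hom fock_gen"
  by (rule free_hom_cong[OF fock_gen_relation])

lemma fock_rep_simps [simp]:
  fixes x y :: "'n::{finite,linorder} dk"
  shows "fock_rep (dk_gen g) = fock_gen g" "fock_rep 1 = 1"
  "fock_rep (x + y) = fock_rep x + fock_rep y"
  "fock_rep (c *\<^sub>C x) = c *\<^sub>C fock_rep x"
  "fock_rep (x * y) = fock_rep x * fock_rep y"
proof -
  have "\<exists>p. z = abs_dk p" for z :: "'n dk" by (induction z rule: dk.abs_induct) blast
  then obtain p q where x: "x = abs_dk p" "y = abs_dk q" by metis
  show "fock_rep (dk_gen g) = fock_gen g" "fock_rep 1 = 1"
    "fock_rep (x + y) = fock_rep x + fock_rep y"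
    "fock_rep (x * y) = fock_rep x * fock_rep y"
    by (simp_all add: x free_hom_simps dk_gen_def one_dk_def plus_dk.abs_eq times_dk.abs_eq
        fock_rep.abs_eq)
  show "fock_rep (c *\<^sub>C x) = c *\<^sub>C fock_rep x"
    by (simp add: x free_hom_simps(8) scaleC_dk.abs_eq fock_rep.abs_eq)
qed

definition fock_state :: "'n fock \<Rightarrow> 'n fock \<Rightarrow> complex" where
  "fock_state s = (\<lambda>t. if t = s then 1 else 0)"

lemma fock_state_K:
  "endo_app fock_K (fock_state (S, p, q)) = (\<lambda>t. (- 1) ^ card S * fock_state (S, \<not> p, q) t)"
  "endo_app fock_Kbar (fock_state (S, p, q)) = (\<lambda>t. (- 1) ^ card S * fock_state (S, p, \<not> q) t)"
  by (rule ext; auto simp: fock_state_def split: prod.splits if_splits)+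

lemma fock_state_create:
  assumes "a \<notin> S"
  shows "endo_app (fock_create a) (fock_state (S, p, q)) = (\<lambda>t. fock_sign a S * fock_state (insert a S, p, q) t)"
proof (rule ext)
  fix t :: "'a fock"
  obtain T p' q' where t: "t = (T, p', q')" by (cases t)
  have "a \<in> T \<Longrightarrow> T - {a} = S \<longleftrightarrow> T = insert a S" using assms by blast
  then show "endo_app (fock_create a) (fock_state (S, p, q)) t = fock_sign a S * fock_state (insert a S, p, q) t"
    using assms by (auto simp: t fock_state_def)
qed

lemma fock_state_annihilate:
  assumes "a \<notin> S"
  shows "endo_app (fock_annihilate a) (fock_state (S, p, q)) = (\<lambda>t. 0)"
  using assms by (intro ext) (auto simp: fock_state_def)

lemma endo_app_zero [simp]: "endo_app f (\<lambda>t. 0) = (\<lambda>t. 0)"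
  using endo_app_linear(2)[of f 0 "\<lambda>t. 0"] by simp

text \<open>Without occupied \<open>Inl\<close> modes the annihilating part of every
  \<open>xibar\<close> gives zero, and only the creation of \<open>Inr\<close> modes
  remains.\<close>

lemma fock_state_xibar_word:
  assumes "distinct l"
  shows "\<exists>c. c \<noteq> 0 \<and> endo_app (fock_rep (prod_list (map dk_xibar l))) (fock_state ({}, p, q))
    = (\<lambda>t. c * fock_state (Inr ` set l, p, q) t)"
  using assms
proof (induction l)
  case (Cons i l)
  then obtain c where c: "c \<noteq> 0" "endo_app (fock_rep (prod_list (map dk_xibar l))) (fock_state ({}, p, q))
    = (\<lambda>t. c * fock_state (Inr ` set l, p, q) t)" by auto
  have "endo_app (fock_rep (prod_list (map dk_xibar (i # l)))) (fock_state ({}, p, q))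
    = (\<lambda>t. (c * fock_sign (Inr i) (Inr ` set l)) * fock_state (Inr ` set (i # l), p, q) t)"
    using Cons.prems c(2)
    by (intro ext) (auto simp: endo_app_linear fock_state_create fock_state_annihilate image_iff)
  then show ?case using c(1) fock_sign_nonzero by (intro exI conjI) auto
qed (intro exI[of _ 1], simp)

lemma fock_state_xi_word:
  assumes "distinct l" "Inl ` set l \<inter> S = {}"
  shows "\<exists>c. c \<noteq> 0 \<and> endo_app (fock_rep (prod_list (map dk_xi l))) (fock_state (S, p, q))
    = (\<lambda>t. c * fock_state (Inl ` set l \<union> S, p, q) t)"
  using assms
proof (induction l)
  case (Cons i l)
  then obtain c where c: "c \<noteq> 0" "endo_app (fock_rep (prod_list (map dk_xi l))) (fock_state (S, p, q))
    = (\<lambda>t. c * fock_state (Inl ` set l \<union> S, p, q) t)" by auto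
  have "endo_app (fock_rep (prod_list (map dk_xi (i # l)))) (fock_state (S, p, q))
    = (\<lambda>t. (c * fock_sign (Inl i) (Inl ` set l \<union> S)) * fock_state (Inl ` set (i # l) \<union> S, p, q) t)"
    using Cons.prems c(2)
    by (intro ext) (auto simp: endo_app_linear fock_state_create image_iff)
  then show ?case using c(1) fock_sign_nonzero by (intro exI conjI) auto
qed (intro exI[of _ 1], simp)

text \<open>In PBW order the \<open>xibar\<close> act before any \<open>Inl\<close> mode is
  occupied, so nothing is annihilated and each monomial takes the vacuum to a basis state of its
  own.\<close>

lemma fock_pbw:
  assumes "p \<in> {0, 1}" "q \<in> {0, 1 :: nat}"
  shows "\<exists>c. c \<noteq> 0 \<and> endo_app (fock_rep (dk_K ^ p * dk_Kbar ^ q * xi_word A * xibar_word B))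
      (fock_state ({}, False, False))
    = (\<lambda>t. c * fock_state (Inl ` A \<union> Inr ` B, p = 1, q = 1) t)"
proof -
  obtain c where c: "c \<noteq> 0" "endo_app (fock_rep (xibar_word B)) (fock_state ({}, False, False))
    = (\<lambda>t. c * fock_state (Inr ` B, False, False) t)"
    using fock_state_xibar_word[of "sorted_list_of_set B"] by (auto simp: xibar_word_def)
  obtain d where d: "d \<noteq> 0" "endo_app (fock_rep (xi_word A)) (fock_state (Inr ` B, False, False))
    = (\<lambda>t. d * fock_state (Inl ` A \<union> Inr ` B, False, False) t)"
    using fock_state_xi_word[of "sorted_list_of_set A" "Inr ` B" False False]
    by (auto simp: xi_word_def)
  have "endo_app (fock_rep (dk_Kbar ^ q)) (fock_state (S, False, False))
      = (\<lambda>t. (- 1) ^ (q * card S) * fock_state (S, False, q = 1) t)"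
    "endo_app (fock_rep (dk_K ^ p)) (fock_state (S, False, q = 1))
      = (\<lambda>t. (- 1) ^ (p * card S) * fock_state (S, p = 1, q = 1) t)" for S
    using assms by (auto simp: fock_state_K)
  note powers = this
  have "endo_app (fock_rep (dk_K ^ p * dk_Kbar ^ q * xi_word A * xibar_word B))
      (fock_state ({}, False, False))
    = (\<lambda>t. (c * d * (- 1) ^ (q * card (Inl ` A \<union> Inr ` B)) * (- 1) ^ (p * card (Inl ` A \<union> Inr ` B)))
        * fock_state (Inl ` A \<union> Inr ` B, p = 1, q = 1) t)"
    by (intro ext) (simp add: c(2) d(2) powers endo_app_linear mult.assoc del: One_nat_def)
  then show ?thesis using c(1) d(1) by (intro exI conjI) auto
qed

lemma fock_pbw_coeff:
  assumes "p \<in> {0, 1}" "q \<in> {0, 1 :: nat}" "p' \<in> {0, 1}" "q' \<in> {0, 1 :: nat}"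
  shows "endo_app (fock_rep (dk_K ^ p * dk_Kbar ^ q * xi_word A * xibar_word B))
      (fock_state ({}, False, False)) (Inl ` A' \<union> Inr ` B', p' = 1, q' = 1) = 0
    \<longleftrightarrow> (p, q, A, B) \<noteq> (p', q', A', B')"
proof -
  have *: "Inl ` A' \<union> Inr ` B' = Inl ` A \<union> Inr ` B \<longleftrightarrow> A' = A \<and> B' = B" by blast
  have **: "(p' = 1) = (p = 1) \<longleftrightarrow> p = p'" "(q' = 1) = (q = 1) \<longleftrightarrow> q = q'"
    using assms by auto
  obtain c where c: "c \<noteq> 0" "endo_app (fock_rep (dk_K ^ p * dk_Kbar ^ q * xi_word A * xibar_word B))
      (fock_state ({}, False, False)) = (\<lambda>t. c * fock_state (Inl ` A \<union> Inr ` B, p = 1, q = 1) t)"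
    using fock_pbw[OF assms(1,2)] by blast
  show ?thesis
    by (subst c(2), simp only: fock_state_def prod.inject * **) (use c(1) in \<open>simp; blast\<close>)
qed

lemma dk_pbw_independent: "cvec.independent (dk_pbw_basis :: 'n::{finite,linorder} dk set)"
proof
  assume "cvec.dependent (dk_pbw_basis :: 'n dk set)"
  then obtain x :: "'n dk" where x: "x \<in> dk_pbw_basis" "x \<in> cvec.span (dk_pbw_basis - {x})"
    unfolding cvec.dependent_def by blast
  from x(1) obtain p q A B where pq: "p \<in> {0, 1}" "q \<in> {0, 1 :: nat}"
    "x = dk_K ^ p * dk_Kbar ^ q * xi_word A * xibar_word B" unfolding dk_pbw_basis_def by blast
  \<comment> \<open>The amplitude of the basis state belonging to \<open>x\<close>: it vanishes on
    every other monomial but not on \<open>x\<close>.\<close>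
  define f where "f y = endo_app (fock_rep y) (fock_state ({}, False, False))
     (Inl ` A \<union> Inr ` B, p = 1, q = 1)" for y :: "'n dk"
  have lin: "clinear f" by (rule clinearI) (simp_all add: f_def scaleC_complex_def)
  have zero: "f b \<in> {0}" if b_in: "b \<in> dk_pbw_basis - {x}" for b
  proof -
    obtain p' q' A' B' where b: "p' \<in> {0, 1}" "q' \<in> {0, 1 :: nat}"
      "b = dk_K ^ p' * dk_Kbar ^ q' * xi_word A' * xibar_word B'"
      using DiffD1[OF b_in] unfolding dk_pbw_basis_def by blast
    have "(p', q', A', B') \<noteq> (p, q, A, B)"
    proof
      assume "(p', q', A', B') = (p, q, A, B)"
      then have "b = x" unfolding b(3) pq(3) by simp
      with b_in show False by blast
    qed
    then show ?thesis unfolding f_def b(3) using fock_pbw_coeff[OF b(1,2) pq(1,2)] by blast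
  qed
  have "cvec.subspace {0 :: complex}" by (simp add: cvec.subspace_def)
  from clinear_span_mem[OF lin this zero x(2)] have "f x = 0" by simp
  then show False
    using fock_pbw_coeff[OF pq(1,2,1,2), of A B A B] unfolding f_def pq(3) by blast
qed

section \<open>The integral of the dual\<close>

definition top_word :: "'n::{finite,linorder} dk" where
  "top_word = xi_word UNIV * xibar_word UNIV"

lemma dk_cointegral_linear: "clinear dk_cointegral"
  unfolding dk_cointegral_def
  by (rule clinearI) (simp_all add: cvec.representation_add cvec.representation_scale
      dk_pbw_independent span_dk_pbw_basis scaleC_complex_def distrib_left)

lemma dk_cointegral_pbw:
  assumes "p \<in> {0, 1}" "q \<in> {0, 1 :: nat}"
  shows "dk_cointegral (dk_K ^ p * dk_Kbar ^ q * xi_word A * xibar_word B :: 'n::{finite,linorder} dk) =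
    (if p = 0 \<and> q = 0 \<and> A = UNIV \<and> B = UNIV then 2 else 0)"
proof -
  let ?b = "dk_K ^ p * dk_Kbar ^ q * xi_word A * xibar_word B :: 'n dk"
  let ?t = "dk_K ^ 0 * dk_Kbar ^ 0 * xi_word UNIV * xibar_word UNIV :: 'n dk"
  have "?b \<in> dk_pbw_basis" using assms unfolding dk_pbw_basis_def by blast
  then have "cvec.representation dk_pbw_basis ?b = (\<lambda>x. if x = ?b then 1 else 0)"
    by (rule cvec.representation_basis[OF dk_pbw_independent])
  \<comment> \<open>The basis is a set of elements, so the parameters of a monomial have to be
    recovered from its value; the Fock amplitudes do this.\<close>
  moreover have "?t = ?b \<longleftrightarrow> p = 0 \<and> q = 0 \<and> A = UNIV \<and> B = UNIV"
  proof
    assume *: "?t = ?b"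
    have "\<not> (0, 0, UNIV, UNIV) \<noteq> (p, q, A, B)"
      using fock_pbw_coeff[OF assms assms, of A B A B] fock_pbw_coeff[OF _ _ assms, of 0 0 UNIV UNIV A B]
      unfolding * by blast
    then show "p = 0 \<and> q = 0 \<and> A = UNIV \<and> B = UNIV" by auto
  qed simp
  ultimately show ?thesis by (simp add: dk_cointegral_def)
qed

section \<open>Tensors\<close>

text \<open>Scalars are absorbed into the left leg, so pure tensors and sums suffice.\<close>

lemma tensor_induct [case_names tens add]:
  assumes tens: "\<And>a b. P (a \<otimes>\<^sub>C b)" and add: "\<And>t u. P t \<Longrightarrow> P u \<Longrightarrow> P (t + u)"
  shows "P (t :: ('a::complex_algebra, 'b::complex_algebra) tensor)"
proof -
  have "P (abs_tensor p)" for p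
  proof (induction p rule: poly_mapping_add_induct)
    case (single k c)
    obtain a b where k: "k = (Mon a, Mon b)" by (metis mon.exhaust surj_pair)
    have "Poly_Mapping.single k c = const_pm c * ptens a b"
      by (simp add: mult_single k)
    then have "abs_tensor (Poly_Mapping.single k c) = c *\<^sub>C (a \<otimes>\<^sub>C b)"
      by (simp add: scaleC_tensor.abs_eq tens_def)
    also have "\<dots> = (c *\<^sub>C a) \<otimes>\<^sub>C b" by (simp add: tens_simps)
    finally show ?case using tens by simp
  next
    case (add p q)
    then show ?case using assms(2)[of "abs_tensor p" "abs_tensor q"] by (simp add: plus_tensor.abs_eq)
  qed
  then show ?thesis by (induction t rule: tensor.abs_induct) blast
qed

lemma tensor_lift_simps:
  "tensor_lift f (t + u) = tensor_lift f t + tensor_lift f u"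
  "tensor_lift f (c *\<^sub>C t) = c *\<^sub>C tensor_lift f t"
  using tensor_lift_linear[of f] by (auto simp: clinear_iff)

lemma cbilinearI:
  assumes "\<And>a x y. f a (x + y) = f a x + f a y" "\<And>a c x. f a (c *\<^sub>C x) = c *\<^sub>C f a x"
    "\<And>a x y. f (x + y) a = f x a + f y a" "\<And>a c x. f (c *\<^sub>C x) a = c *\<^sub>C f x a"
  shows "cbilinear f"
  using assms by (simp add: cbilinear_def clinear_iff)

section \<open>The Higman ideal\<close>

definition adj_op :: "('n dk, 'n dk) tensor \<Rightarrow> 'n dk \<Rightarrow> 'n dk" where
  "adj_op t x = tensor_lift (\<lambda>a b. dk_antipode b * x * a) t"

lemma adj_op_bilinear: "cbilinear (\<lambda>a b. dk_antipode b * x * a)"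
  by (rule cbilinearI) (simp_all add: dk_antipode_simps distrib_left distrib_right)

lemma adj_op_simps:
  "adj_op (a \<otimes>\<^sub>C b) x = dk_antipode b * x * a"
  "adj_op (t + u) x = adj_op t x + adj_op u x"
  "adj_op (c *\<^sub>C t) x = c *\<^sub>C adj_op t x"
  by (simp_all add: adj_op_def tensor_lift_tens[OF adj_op_bilinear] tensor_lift_simps)

lemma adj_op_one: "adj_op 1 x = x"
  using adj_op_simps(1)[of 1 1 x] by (simp add: tens_one dk_antipode_simps)

lemma adj_op_add: "adj_op t (x + y) = adj_op t x + adj_op t y"
  by (induction t rule: tensor_induct) (simp_all add: adj_op_simps algebra_simps)

text \<open>The antipode reverses the second legs on the left of \<open>x\<close>, while the first
  legs multiply on the right in order: \<open>t\<close> acts first, then \<open>u\<close>. So the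
  coproduct of a word acts one letter at a time.\<close>

lemma adj_op_mult: "adj_op (t * u) x = adj_op u (adj_op t x)"
proof (induction t rule: tensor_induct)
  case (tens a b)
  show ?case
    by (induction u rule: tensor_induct)
      (simp_all add: adj_op_simps tens_mult dk_antipode_simps mult.assoc distrib_left)
qed (simp_all add: distrib_right adj_op_simps adj_op_add)

lemma ring_inv_K: "ring_inv dk_K = dk_K"
  by (rule ring_inv_eqI) simp_all

lemma higman_map_adj_op: "dk_higman_map x = adj_op (dk_comult dk_integral) x * dk_K"
proof -
  have *: "cbilinear (\<lambda>a b. dk_antipode b * x * a * dk_K)"
    by (rule cbilinearI) (simp_all add: dk_antipode_simps distrib_left distrib_right)
  have "tensor_lift (\<lambda>a b. dk_antipode b * x * a * dk_K) t = adj_op t x * dk_K" for t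
    by (induction t rule: tensor_induct)
      (simp_all add: tensor_lift_tens[OF *] adj_op_simps tensor_lift_simps distrib_right)
  then show ?thesis by (simp add: dk_higman_map_def ring_inv_K)
qed

text \<open>In the variable \<open>y = x K\<close> the adjoint-type action of an odd generator, which occurs in the
  Higman map, becomes a supercommutator. It lowers the degree on the block \<open>Q\<close>, and on the block \<open>P\<close>
  it kills \<open>P y\<close> and multiplies \<open>P y K\<close> by the generator.\<close>

definition scomm :: "'n + 'n \<Rightarrow> 'n dk \<Rightarrow> 'n dk" where
  "scomm a y = theta a * (dk_K * y * dk_K) - y * theta a"

lemma scomm_simps:
  "scomm a (x + y) = scomm a x + scomm a y"
  "scomm a (c *\<^sub>C x) = c *\<^sub>C scomm a x"
  by (simp_all add: scomm_def distrib_left distrib_right cvec.scale_right_diff_distrib)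

lemma fold_scomm_linear: "clinear (fold scomm l)"
proof (rule clinearI)
  show "fold scomm l (x + y) = fold scomm l x + fold scomm l y" for x y
    by (induction l arbitrary: x y) (simp_all add: scomm_simps)
  show "fold scomm l (c *\<^sub>C x) = c *\<^sub>C fold scomm l x" for c x
    by (induction l arbitrary: x) (simp_all add: scomm_simps)
qed

text \<open>\<open>dk_Kbar\<close> is \<open>dk_K\<close> times the central involution
  \<open>dk_L\<close>, which cancels in a conjugation.\<close>

lemma Kb_conj: "dk_Kbar * (x * dk_Kbar) = dk_K * (x * dk_K)"
proof -
  have "dk_Kbar * (x * dk_Kbar) = dk_K * (dk_L * (x * (dk_K * dk_L)))" by simp
  also have "\<dots> = dk_K * (x * dk_K)"
    by (metis dk_L_central dk_L_sq(2) mult.assoc)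
  finally show ?thesis .
qed

text \<open>One term of the coproduct conjugates \<open>x\<close> by \<open>dk_K\<close> or
  \<open>dk_Kbar\<close>, the other leaves it alone. By \<open>Kb_conj\<close> the two kinds of odd
  generators behave alike.\<close>

lemma adj_op_theta: "adj_op (dk_comult (theta a)) x = scomm a (x * dk_K) * dk_K"
proof (cases a)
  case (Inl i)
  then show ?thesis
    by (simp add: scomm_def dk_comult_simps adj_op_simps dk_antipode_simps left_diff_distrib mult.assoc
      dk_group_left)
next
  case (Inr i)
  then show ?thesis
    by (simp add: scomm_def dk_comult_simps adj_op_simps dk_antipode_simps left_diff_distrib mult.assoc
      dk_group_left Kb_conj[of "dk_xibar i * x", unfolded mult.assoc])
qed

lemma adj_op_theta_word:
  "adj_op (dk_comult (theta_word l)) x = fold scomm l (x * dk_K) * dk_K"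
proof (induction l arbitrary: x)
  case Nil
  then show ?case by (simp add: dk_comult_simps adj_op_one mult.assoc)
next
  case (Cons a l)
  then show ?case by (simp add: dk_comult_simps adj_op_mult adj_op_theta mult.assoc)
qed

definition all_modes :: "('n::{finite,linorder} + 'n) list" where
  "all_modes = map Inl (sorted_list_of_set UNIV) @ map Inr (sorted_list_of_set UNIV)"

lemma distinct_all_modes: "distinct all_modes"
  by (auto simp: all_modes_def distinct_map)

lemma length_all_modes: "length (all_modes :: ('n::{finite,linorder} + 'n) list) = 2 * CARD('n)"
  by (simp add: all_modes_def)

lemma theta_all_modes: "theta_word all_modes = top_word"
  by (simp add: all_modes_def top_word_def xi_word_theta xibar_word_theta)

lemma higman_map_scomm:
  "dk_higman_map x = fold scomm all_modes (x * dk_K + dk_K * (x * dk_K) * dk_K)"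
proof -
  have int: "dk_integral = ((1/2) *\<^sub>C (1 + dk_K + dk_Kbar + dk_L)) * theta_word all_modes"
    by (simp add: dk_integral_def theta_all_modes top_word_def mult.assoc)
  have comult_L: "dk_comult dk_L = dk_L \<otimes>\<^sub>C dk_L" and antipode_L: "dk_antipode dk_L = dk_L"
    by (simp_all only: dk_L_def dk_comult_simps comult_gen.simps tens_mult dk_antipode_simps
        antipode_gen.simps dk_Kbar_K)
  have "adj_op (dk_comult dk_integral) x = adj_op (dk_comult (theta_word all_modes))
    ((1/2) *\<^sub>C (x + dk_K * (x * dk_K) + dk_Kbar * (x * dk_Kbar) + dk_L * (x * dk_L)))"
    unfolding int
    by (simp only: dk_comult_simps comult_L comult_gen.simps adj_op_mult adj_op_simps tens_mult adj_op_one
        antipode_L dk_antipode_simps antipode_gen.simps mult.assoc)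
  \<comment> \<open>The central \<open>dk_L\<close> conjugates trivially and \<open>dk_Kbar\<close>
    conjugates like \<open>dk_K\<close>, so the four group terms of the integral pair up.\<close>
  also have "(1/2) *\<^sub>C (x + dk_K * (x * dk_K) + dk_Kbar * (x * dk_Kbar) + dk_L * (x * dk_L))
     = x + dk_K * (x * dk_K)"
  proof -
    have "dk_L * (x * dk_L) = x" by (simp flip: dk_L_central)
    moreover have "(1/2) *\<^sub>C (u + v + v + u) = u + v" for u v :: "'a dk"
    proof -
      have "(1/2) *\<^sub>C (u + v + v + u) = (1/2) *\<^sub>C (2 *\<^sub>C (u + v))"
        by (simp add: two_scaleC add_ac)
      then show ?thesis by simp
    qed
    ultimately show ?thesis by (simp add: Kb_conj)
  qed
  finally show ?thesis
    by (simp add: higman_map_adj_op adj_op_theta_word mult.assoc distrib_right)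
qed

section \<open>The central idempotents of the two blocks\<close>

definition dk_P :: "'n dk" where "dk_P = (1/2) *\<^sub>C (1 + dk_L)"
definition dk_Q :: "'n dk" where "dk_Q = (1/2) *\<^sub>C (1 - dk_L)"

lemma PQ_sum: "dk_P + dk_Q = 1"
proof -
  have "dk_P + dk_Q = (1/2) *\<^sub>C (2 *\<^sub>C 1)"
    unfolding dk_P_def dk_Q_def by (simp add: two_scaleC flip: scaleC_add_right)
  then show ?thesis by simp
qed

lemma PQ_central: "x * dk_P = dk_P * x" "x * dk_Q = dk_Q * x"
  by (simp_all add: dk_P_def dk_Q_def distrib_left distrib_right left_diff_distrib right_diff_distrib
      dk_L_central)

text \<open>The guards keep rewriting from looping when \<open>x\<close> is itself one of the
  idempotents.\<close>

lemma PQ_left: "NO_MATCH dk_P x \<Longrightarrow> NO_MATCH dk_Q x \<Longrightarrow> x * (dk_P * y) = dk_P * (x * y)"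
  "NO_MATCH dk_P x \<Longrightarrow> NO_MATCH dk_Q x \<Longrightarrow> x * (dk_Q * y) = dk_Q * (x * y)"
  by (simp_all only: PQ_central[of x] flip: mult.assoc)

lemma PQ_L [simp]: "dk_P * dk_L = dk_P" "dk_Q * dk_L = - dk_Q"
  "dk_P * (dk_L * x) = dk_P * x" "dk_Q * (dk_L * x) = - (dk_Q * x)"
proof -
  show *: "dk_P * dk_L = dk_P" "dk_Q * dk_L = - dk_Q"
    by (simp_all add: dk_P_def dk_Q_def distrib_right left_diff_distrib add.commute
        flip: cvec.scale_minus_right)
  show "dk_P * (dk_L * x) = dk_P * x" "dk_Q * (dk_L * x) = - (dk_Q * x)"
    using * by (metis mult.assoc mult_minus_left)+
qed

lemma P_Kb: "dk_P * dk_Kbar = dk_P * dk_K" "dk_P * (dk_Kbar * x) = dk_P * (dk_K * x)"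
  and Q_Kb: "dk_Q * dk_Kbar = - (dk_Q * dk_K)" "dk_Q * (dk_Kbar * x) = - (dk_Q * (dk_K * x))"
  using PQ_L(3)[of dk_K] PQ_L(3)[of "dk_K * x"] PQ_L(4)[of dk_K] PQ_L(4)[of "dk_K * x"] by simp_all

lemma PQ_mult [simp]: "dk_P * dk_P = dk_P" "dk_Q * dk_Q = dk_Q" "dk_P * dk_Q = 0" "dk_Q * dk_P = 0"
  "dk_P * (dk_P * x) = dk_P * x" "dk_Q * (dk_Q * x) = dk_Q * x" "dk_P * (dk_Q * x) = 0"
  "dk_Q * (dk_P * x) = 0"
proof -
  have "dk_P * dk_P = (1/2) *\<^sub>C (dk_P + dk_P * dk_L)"
    by (subst (2) dk_P_def) (simp add: distrib_left)
  also have "\<dots> = (1/2) *\<^sub>C (2 *\<^sub>C dk_P)" by (simp add: two_scaleC)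
  finally show 1: "dk_P * dk_P = dk_P" by simp
  have Q: "dk_Q = 1 - dk_P" using PQ_sum by (metis add_diff_cancel_left')
  show 2: "dk_Q * dk_Q = dk_Q" "dk_P * dk_Q = 0" "dk_Q * dk_P = 0"
    by (simp_all add: Q 1 left_diff_distrib right_diff_distrib)
  show "dk_P * (dk_P * x) = dk_P * x" "dk_Q * (dk_Q * x) = dk_Q * x" "dk_P * (dk_Q * x) = 0"
    "dk_Q * (dk_P * x) = 0"
    using 1 2 by (metis mult.assoc mult_zero_left)+
qed

lemma PQ_center: "dk_P \<in> dk_center" "dk_Q \<in> dk_center"
  by (simp_all add: dk_center_def PQ_central)

lemma scomm_central: "z \<in> dk_center \<Longrightarrow> scomm a (z * y) = z * scomm a y"
proof -
  assume "z \<in> dk_center"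
  then have *: "x * z = z * x" for x by (simp add: dk_center_def)
  have "theta a * (dk_K * (z * y) * dk_K) = theta a * (dk_K * z) * y * dk_K"
    by (simp only: mult.assoc)
  also have "\<dots> = theta a * z * dk_K * y * dk_K"
    by (simp only: *[of dk_K] mult.assoc)
  also have "\<dots> = z * (theta a * (dk_K * y * dk_K))"
    by (simp only: *[of "theta a"] mult.assoc)
  finally show ?thesis by (simp add: scomm_def right_diff_distrib mult.assoc)
qed

lemma fold_scomm_central: "z \<in> dk_center \<Longrightarrow> fold scomm l (z * y) = z * fold scomm l y"
  by (induction l arbitrary: y) (simp_all add: scomm_central)

lemma scomm_K_conj: "scomm a (dk_K * y * dk_K) = - (dk_K * scomm a y * dk_K)"
  by (simp add: scomm_def mult.assoc left_diff_distrib right_diff_distrib K_theta)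

lemma fold_scomm_K_conj:
  "fold scomm l (dk_K * y * dk_K) = (- 1) ^ length l *\<^sub>C (dk_K * fold scomm l y * dk_K)"
proof (induction l arbitrary: y)
  case (Cons a l)
  have "fold scomm (a # l) (dk_K * y * dk_K) = fold scomm l ((-1) *\<^sub>C (dk_K * scomm a y * dk_K))"
    by (simp add: scomm_K_conj)
  also have "\<dots> = (- 1) *\<^sub>C fold scomm l (dk_K * scomm a y * dk_K)"
    using fold_scomm_linear[of l] by (simp only: clinear_iff)
  finally show ?case using Cons[of "scomm a y"] by simp
qed simp

text \<open>Conjugation by \<open>dk_K\<close> is the parity automorphism, so this is the Leibniz
  rule of an odd derivation acting from the right.\<close>

lemma scomm_mult: "scomm a (y * z) = scomm a y * (dk_K * z * dk_K) + y * scomm a z"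
  by (simp add: scomm_def left_diff_distrib right_diff_distrib mult.assoc)

lemma scomm_theta: "scomm a (theta b) = - (if b = dual_index a then 1 - dk_L else 0)"
proof -
  have "scomm a (theta b) = - (theta a * theta b) - theta b * theta a"
    by (simp add: scomm_def K_theta mult.assoc)
  then show ?thesis using theta_anticommute[of a b] by simp
qed

lemma K_theta_word_conj: "dk_K * theta_word m * dk_K = (- 1) ^ length m *\<^sub>C theta_word m"
  by (simp add: theta_word_K mult.assoc)

section \<open>Iterated supercommutators on the exterior block\<close>

lemma P_theta_anticommute: "dk_P * (theta a * theta b) = - (dk_P * (theta b * theta a))"
  by (subst theta_anticommute) (simp add: right_diff_distrib)

lemma P_theta_word: "dk_P * (theta a * theta_word m) = (- 1) ^ length m *\<^sub>C (dk_P * (theta_word m * theta a))"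
proof (induction m)
  case (Cons b m)
  have "dk_P * (theta a * theta_word (b # m)) = dk_P * (theta a * theta b) * theta_word m"
    by (simp add: mult.assoc)
  also have "\<dots> = - (theta b * (dk_P * (theta a * theta_word m)))"
    by (subst P_theta_anticommute) (simp add: mult.assoc PQ_left)
  also have "\<dots> = (- 1) ^ length (b # m) *\<^sub>C (dk_P * (theta_word (b # m) * theta a))"
    by (simp add: Cons mult.assoc PQ_left)
  finally show ?case .
qed simp

text \<open>The trailing \<open>dk_K\<close> flips the sign of the second term of
  \<open>scomm\<close>: the two terms that cancel in \<open>scomm_P\<close> now add up.\<close>

lemma scomm_P_K: "scomm a (dk_P * (theta_word m * dk_K)) = 2 *\<^sub>C (dk_P * (theta_word (m @ [a]) * dk_K))"
proof -
  have "scomm a (dk_P * (theta_word m * dk_K))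
    = dk_P * (theta a * (dk_K * theta_word m)) + dk_P * (theta_word m * (theta a * dk_K))"
    by (subst scomm_central[OF PQ_center(1)]) (simp add: scomm_def right_diff_distrib distrib_left mult.assoc K_theta)
  also have "dk_P * (theta a * (dk_K * theta_word m)) =
      (- 1) ^ length m *\<^sub>C (dk_P * (theta a * theta_word m) * dk_K)"
    by (simp add: theta_word_K mult.assoc)
  also have "\<dots> = dk_P * (theta_word m * theta a) * dk_K"
    by (simp add: P_theta_word flip: power_mult_distrib)
  finally show ?thesis by (simp add: mult.assoc two_scaleC)
qed

lemma scomm_P: "scomm a (dk_P * theta_word m) = 0"
proof -
  have "scomm a (dk_P * theta_word m)
    = (- 1) ^ length m *\<^sub>C (dk_P * (theta a * theta_word m)) - dk_P * (theta_word m * theta a)"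
    by (subst scomm_central[OF PQ_center(1)]) (simp add: scomm_def right_diff_distrib K_theta_word_conj)
  then show ?thesis by (simp add: P_theta_word flip: power_mult_distrib)
qed

lemma fold_scomm_P_K:
  "fold scomm l (dk_P * (theta_word m * dk_K)) = 2 ^ length l *\<^sub>C (dk_P * (theta_word (m @ l) * dk_K))"
proof (induction l arbitrary: m)
  case (Cons a l)
  have "fold scomm (a # l) (dk_P * (theta_word m * dk_K))
     = 2 *\<^sub>C fold scomm l (dk_P * (theta_word (m @ [a]) * dk_K))"
    using fold_scomm_linear[of l] by (simp add: scomm_P_K clinear_iff)
  then show ?case using Cons[of "m @ [a]"] by simp
qed simp

lemma fold_scomm_zero: "fold scomm l 0 = 0"
  using fold_scomm_linear[of l] by (metis clinear_iff cvec.scale_zero_left)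

lemma fold_scomm_P: "l \<noteq> [] \<Longrightarrow> fold scomm l (dk_P * theta_word m) = 0"
  by (cases l) (simp_all add: scomm_P fold_scomm_zero)

section \<open>Iterated supercommutators on the Clifford block\<close>

definition Q_words :: "nat \<Rightarrow> 'n dk set" where
  "Q_words d = cvec.span {dk_Q * theta_word m | m. length m \<le> d}"

lemma Q_words_subspace: "cvec.subspace (Q_words d)"
  by (simp add: Q_words_def)

lemma Q_words_base: "length m \<le> d \<Longrightarrow> dk_Q * theta_word m \<in> Q_words d"
  unfolding Q_words_def by (rule cvec.span_base) blast

lemma Q_words_mono: "d \<le> e \<Longrightarrow> Q_words d \<subseteq> Q_words e"
  unfolding Q_words_def by (rule cvec.span_mono) fastforce

lemma Q_words_theta: "x \<in> Q_words d \<Longrightarrow> theta b * x \<in> Q_words (Suc d)"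
proof (rule clinear_span_mem[OF clinear_mult_left Q_words_subspace])
  show "theta b * y \<in> Q_words (Suc d)" if "y \<in> {dk_Q * theta_word m | m. length m \<le> d}" for y
    using that Q_words_base[of "b # _" "Suc d"] by (auto simp: PQ_left)
qed (simp add: Q_words_def)

lemma Q_scomm_theta: "dk_Q * scomm a (theta b) = (if b = dual_index a then - 2 else 0) *\<^sub>C dk_Q"
  by (simp add: scomm_theta right_diff_distrib two_scaleC)

text \<open>Each term of the Leibniz rule loses a letter. The clause for the empty word makes up for
  the truncated difference \<open>0 - 1 = 0\<close>: in the step to a one-letter word the remainder
  has to vanish, not just to have degree 0.\<close>

lemma Q_scomm_word: "dk_Q * scomm a (theta_word m) \<in> Q_words (length m - 1) \<and>
   (m = [] \<longrightarrow> dk_Q * scomm a (theta_word m) = 0)"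
proof (induction m)
  case Nil
  then show ?case by (simp add: scomm_def cvec.subspace_0[OF Q_words_subspace])
next
  case (Cons b m)
  have "dk_Q * scomm a (theta_word (b # m)) = (dk_Q * scomm a (theta b)) * (dk_K * theta_word m * dk_K)
      + theta b * (dk_Q * scomm a (theta_word m))"
    by (simp add: scomm_mult distrib_left mult.assoc PQ_left)
  also have "(dk_Q * scomm a (theta b)) * (dk_K * theta_word m * dk_K) =
      ((if b = dual_index a then - 2 else 0) * (- 1) ^ length m) *\<^sub>C (dk_Q * theta_word m)"
    unfolding Q_scomm_theta K_theta_word_conj by simp
  finally have *: "dk_Q * scomm a (theta_word (b # m)) =
    ((if b = dual_index a then - 2 else 0) * (- 1) ^ length m) *\<^sub>C (dk_Q * theta_word m)
      + theta b * (dk_Q * scomm a (theta_word m))" .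
  have "theta b * (dk_Q * scomm a (theta_word m)) \<in> Q_words (length m)"
  proof (cases "m = []")
    case True
    then show ?thesis using Cons by (simp add: cvec.subspace_0[OF Q_words_subspace])
  next
    case False
    then show ?thesis using Q_words_theta[OF conjunct1[OF Cons], of b] by simp
  qed
  then have "((if b = dual_index a then - 2 else 0) * (- 1) ^ length m) *\<^sub>C (dk_Q * theta_word m)
      + theta b * (dk_Q * scomm a (theta_word m)) \<in> Q_words (length m)"
    by (intro cvec.subspace_add[OF Q_words_subspace] cvec.subspace_scale[OF Q_words_subspace]
        Q_words_base order_refl)
  moreover have "length (b # m) - 1 = length m" by simp
  ultimately show ?case unfolding * by (simp only: list.distinct simp_thms)
qed

lemma scomm_linear: "clinear (scomm a)"
  by (rule clinearI) (simp_all add: scomm_simps)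

lemma scomm_Q_words: "x \<in> Q_words d \<Longrightarrow> scomm a x \<in> Q_words (d - 1)"
proof (rule clinear_span_mem[OF scomm_linear Q_words_subspace])
  show "scomm a y \<in> Q_words (d - 1)" if y_in: "y \<in> {dk_Q * theta_word m | m. length m \<le> d}" for y
  proof -
    obtain m where m: "y = dk_Q * theta_word m" "length m \<le> d" using y_in by blast
    show ?thesis using Q_scomm_word[of a m] Q_words_mono[of "length m - 1" "d - 1"] m
      by (auto simp: scomm_central[OF PQ_center(2)] diff_le_mono)
  qed
qed (simp add: Q_words_def)

lemma fold_scomm_Q_words: "x \<in> Q_words d \<Longrightarrow> fold scomm l x \<in> Q_words (d - length l)"
proof (induction l arbitrary: x d)
  case (Cons a l)
  show ?case using Cons.IH[OF scomm_Q_words[OF Cons.prems]] by simp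
qed simp

lemma Q_words_0: "x \<in> Q_words 0 \<Longrightarrow> \<exists>c. x = c *\<^sub>C dk_Q"
  by (simp add: Q_words_def cvec.span_singleton) blast

lemma Q_scomm_word_zero: "dual_index a \<notin> set m \<Longrightarrow> dk_Q * scomm a (theta_word m) = 0"
proof (induction m)
  case (Cons b m)
  have "dk_Q * scomm a (theta_word (b # m)) = (dk_Q * scomm a (theta b)) * (dk_K * theta_word m * dk_K)
      + theta b * (dk_Q * scomm a (theta_word m))"
    by (simp add: scomm_mult distrib_left mult.assoc PQ_left)
  also have "\<dots> = 0" unfolding Q_scomm_theta using Cons by auto
  finally show ?case .
qed (simp add: scomm_def)

text \<open>Each \<open>scomm a\<close> contracts the last letter, which is its dual; the factor
  \<open>- 2\<close> is minus the value of \<open>1 - dk_L\<close> on this block. This shows that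
  the iterated supercommutator does not vanish there.\<close>

lemma fold_scomm_Q_dual:
  "distinct l \<Longrightarrow> fold scomm l (dk_Q * theta_word (rev (map dual_index l))) = (- 2) ^ length l *\<^sub>C dk_Q"
proof (induction l)
  case (Cons a l)
  let ?w = "theta_word (rev (map dual_index l))"
  have "dual_index a \<notin> set (rev (map dual_index l))"
    using Cons.prems inj_dual_index by (auto dest: injD)
  then have z: "dk_Q * scomm a ?w = 0" by (rule Q_scomm_word_zero)
  have "scomm a (dk_Q * theta_word (rev (map dual_index (a # l))))
    = (dk_Q * scomm a ?w) * (dk_K * theta (dual_index a) * dk_K) + ?w * (dk_Q * scomm a (theta (dual_index a)))"
    by (subst scomm_central[OF PQ_center(2)]) (simp add: scomm_mult distrib_left mult.assoc PQ_left)
  also have "\<dots> = (- 2) *\<^sub>C (dk_Q * ?w)"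
    unfolding z Q_scomm_theta by (simp add: PQ_central)
  finally have "fold scomm (a # l) (dk_Q * theta_word (rev (map dual_index (a # l))))
    = fold scomm l ((- 2) *\<^sub>C (dk_Q * ?w))" by simp
  also have "\<dots> = (- 2) *\<^sub>C fold scomm l (dk_Q * ?w)"
    using fold_scomm_linear[of l] by (simp only: clinear_iff)
  finally show ?case using Cons by simp
qed simp

section \<open>The chirality element\<close>

definition gamma_at :: "'n \<Rightarrow> 'n dk" where
  "gamma_at i = 1 - dk_xi i * dk_xibar i"

definition dk_gamma :: "'n::{finite,linorder} dk" where
  "dk_gamma = prod_list (map gamma_at (sorted_list_of_set UNIV))"

definition site :: "'n + 'n \<Rightarrow> 'n" where
  "site = case_sum id id"

lemma xibar_xi: "dk_xibar i * dk_xi i = 1 - dk_L - dk_xi i * dk_xibar i"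
  using theta_anticommute[of "Inr i" "Inl i"] by simp

lemma theta_pair_commute:
  assumes "dual_index a \<noteq> c" "dual_index b \<noteq> c"
  shows "theta a * theta b * theta c = theta c * (theta a * theta b)"
proof -
  have 1: "theta a * theta c = - (theta c * theta a)" and 2: "theta b * theta c = - (theta c * theta b)"
    using assms theta_anticommute[of a c] theta_anticommute[of b c] by simp_all
  have "theta a * theta b * theta c = - (theta a * theta c * theta b)"
    by (simp add: 2 mult.assoc)
  also have "\<dots> = theta c * (theta a * theta b)" by (simp add: 1 mult.assoc)
  finally show ?thesis .
qed

lemma gamma_at_theta:
  assumes "i \<noteq> site a"
  shows "gamma_at i * theta a = theta a * gamma_at i"
proof -
  have "theta (Inl i) * theta (Inr i) * theta a = theta a * (theta (Inl i) * theta (Inr i))"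
    by (rule theta_pair_commute) (use assms in \<open>auto simp: site_def\<close>)
  then show ?thesis by (simp add: gamma_at_def left_diff_distrib right_diff_distrib)
qed

text \<open>On this block \<open>xi_i\<close> and \<open>xibar_i\<close> have anticommutator 2, so
  half of \<open>xi_i xibar_i\<close> is a projection \<open>e\<close> and \<open>gamma_at i\<close>
  is the reflection \<open>1 - 2 e\<close>, which anticommutes with both generators.\<close>

lemma Q_gamma_at:
  "dk_Q * (gamma_at i * dk_xi i) = - (dk_Q * dk_xi i)" "dk_Q * (dk_xi i * gamma_at i) = dk_Q * dk_xi i"
  "dk_Q * (gamma_at i * dk_xibar i) = dk_Q * dk_xibar i"
  "dk_Q * (dk_xibar i * gamma_at i) = - (dk_Q * dk_xibar i)"
proof -
  have [simp]: "dk_xi i * dk_xi i = 0" "dk_xibar i * dk_xibar i = 0" "dk_xi i * (dk_xi i * x) = 0" for x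
    using theta_sq[of "Inl i"] theta_sq[of "Inr i"] by simp_all
  have 1: "dk_xi i * (dk_xibar i * dk_xi i) = dk_xi i - dk_L * dk_xi i"
    by (simp add: xibar_xi right_diff_distrib dk_L_central)
  have 2: "dk_xibar i * (dk_xi i * dk_xibar i) = dk_xibar i - dk_L * dk_xibar i"
    by (simp add: xibar_xi left_diff_distrib mult.assoc flip: mult.assoc[of "dk_xibar i" "dk_xi i"])
  show "dk_Q * (gamma_at i * dk_xi i) = - (dk_Q * dk_xi i)"
    by (simp add: gamma_at_def left_diff_distrib right_diff_distrib mult.assoc 1)
  show "dk_Q * (dk_xi i * gamma_at i) = dk_Q * dk_xi i"
    by (simp add: gamma_at_def left_diff_distrib right_diff_distrib)
  show "dk_Q * (gamma_at i * dk_xibar i) = dk_Q * dk_xibar i"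
    by (simp add: gamma_at_def left_diff_distrib right_diff_distrib mult.assoc)
  show "dk_Q * (dk_xibar i * gamma_at i) = - (dk_Q * dk_xibar i)"
    by (simp add: gamma_at_def left_diff_distrib right_diff_distrib 2)
qed

lemma Q_gamma_at_theta:
  "dk_Q * (gamma_at i * theta a) = (if i = site a then - 1 else 1) *\<^sub>C (dk_Q * (theta a * gamma_at i))"
proof (cases "i = site a")
  case True
  then show ?thesis by (cases a) (simp_all add: site_def Q_gamma_at)
qed (simp add: gamma_at_theta)

lemma Q_gamma_list_theta:
  "distinct l \<Longrightarrow> dk_Q * (prod_list (map gamma_at l) * theta a)
    = (if site a \<in> set l then - 1 else 1) *\<^sub>C (dk_Q * (theta a * prod_list (map gamma_at l)))"
proof (induction l)
  case (Cons i l)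
  let ?g = "prod_list (map gamma_at l)"
  have "dk_Q * (prod_list (map gamma_at (i # l)) * theta a) = gamma_at i * (dk_Q * (?g * theta a))"
    by (simp add: PQ_left mult.assoc)
  also have "\<dots> = (if site a \<in> set l then - 1 else 1) *\<^sub>C (dk_Q * (gamma_at i * theta a) * ?g)"
    using Cons by (simp add: PQ_left mult.assoc)
  also have "\<dots> = (if site a \<in> set (i # l) then - 1 else 1) *\<^sub>C (dk_Q * (theta a * prod_list (map gamma_at (i # l))))"
    unfolding Q_gamma_at_theta using Cons.prems by (auto simp: mult.assoc)
  finally show ?case .
qed simp

lemma Q_gamma_at_sq: "dk_Q * (gamma_at i * gamma_at i) = dk_Q"
proof -
  have "dk_Q * (gamma_at i * gamma_at i) = dk_Q * gamma_at i - (dk_Q * (gamma_at i * dk_xi i)) * dk_xibar i"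
    by (simp add: gamma_at_def[of i] right_diff_distrib mult.assoc)
  then show ?thesis by (simp add: Q_gamma_at mult.assoc) (simp add: gamma_at_def right_diff_distrib)
qed

lemma Q_gamma_list_sq:
  "distinct l \<Longrightarrow> dk_Q * (prod_list (map gamma_at l) * prod_list (map gamma_at l)) = dk_Q"
proof (induction l)
  case (Cons i l)
  let ?g = "prod_list (map gamma_at l)"
  \<comment> \<open>Site \<open>i\<close> does not occur in \<open>l\<close>, so both letters cross
    \<open>?g\<close> without a sign, and \<open>gamma_at i\<close> commutes with \<open>?g\<close>
    on the block.\<close>
  have "dk_Q * (?g * dk_xi i * dk_xibar i) = dk_Q * (?g * theta (Inl i)) * dk_xibar i"
    by (simp add: mult.assoc)
  also have "\<dots> = dk_xi i * (dk_Q * (?g * theta (Inr i)))"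
    using Cons.prems by (subst Q_gamma_list_theta) (auto simp: mult.assoc PQ_left site_def)
  also have "\<dots> = dk_Q * (dk_xi i * dk_xibar i * ?g)"
    using Cons.prems by (subst Q_gamma_list_theta) (auto simp: mult.assoc PQ_left site_def)
  finally have c: "dk_Q * (?g * gamma_at i) = dk_Q * (gamma_at i * ?g)"
    by (simp add: gamma_at_def left_diff_distrib right_diff_distrib mult.assoc)
  have "dk_Q * (prod_list (map gamma_at (i # l)) * prod_list (map gamma_at (i # l)))
      = gamma_at i * (dk_Q * (?g * gamma_at i)) * ?g"
    by (simp add: PQ_left mult.assoc)
  also have "\<dots> = dk_Q * (gamma_at i * gamma_at i) * (?g * ?g)"
    unfolding c by (simp add: PQ_left mult.assoc)
  also have "\<dots> = dk_Q"
    unfolding Q_gamma_at_sq using Cons by simp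
  finally show ?case .
qed simp

lemma Q_gamma_theta: "dk_Q * (dk_gamma * theta a) = - (dk_Q * (theta a * dk_gamma))"
  unfolding dk_gamma_def by (subst Q_gamma_list_theta) simp_all

lemma Q_gamma_sq: "dk_Q * (dk_gamma * dk_gamma) = dk_Q"
  unfolding dk_gamma_def by (rule Q_gamma_list_sq) simp

lemma gamma_at_K: "dk_K * gamma_at i = gamma_at i * dk_K" "dk_Kbar * gamma_at i = gamma_at i * dk_Kbar"
  using K_theta(1)[of "Inl i"] K_theta(2)[of "Inl i"] K_theta(1)[of "Inr i"]
    Kb_theta(1)[of "Inl i"] Kb_theta(2)[of "Inl i"] Kb_theta(1)[of "Inr i"]
  by (simp_all add: gamma_at_def left_diff_distrib right_diff_distrib mult.assoc)

lemma gamma_list_K: "dk_K * prod_list (map gamma_at l) = prod_list (map gamma_at l) * dk_K"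
    "dk_Kbar * prod_list (map gamma_at l) = prod_list (map gamma_at l) * dk_Kbar"
  by (induction l; simp; metis gamma_at_K mult.assoc)+

lemma gamma_K: "dk_K * dk_gamma = dk_gamma * dk_K" "dk_Kbar * dk_gamma = dk_gamma * dk_Kbar"
  by (simp_all add: dk_gamma_def gamma_list_K)

lemma fold_scomm_add: "fold scomm l (x + y) = fold scomm l x + fold scomm l y"
  and fold_scomm_scale: "fold scomm l (c *\<^sub>C x) = c *\<^sub>C fold scomm l x"
  using fold_scomm_linear[of l] unfolding clinear_iff by blast+

section \<open>Three central elements\<close>

definition u_Q :: "'n dk" where "u_Q = dk_Q"
definition u_G :: "'n::{finite,linorder} dk" where "u_G = dk_Q * (dk_K * dk_gamma)"
definition u_W :: "'n::{finite,linorder} dk" where "u_W = dk_P * (dk_K * top_word)"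

lemma u_G_Q: "u_G * dk_Q = u_G"
  by (subst PQ_central) (simp add: u_G_def)

text \<open>On the block \<open>Q\<close> both \<open>dk_K\<close> and \<open>dk_gamma\<close>
  anticommute with every odd generator, so their product commutes with it.\<close>

lemma u_G_center: "u_G \<in> dk_center"
  unfolding dk_center_iff_theta
proof (intro conjI allI)
  show "u_G * dk_K = dk_K * u_G" "u_G * dk_Kbar = dk_Kbar * u_G"
    by (simp_all add: u_G_def mult.assoc PQ_left gamma_K[symmetric])
  show "u_G * theta a = theta a * u_G" for a
  proof -
    have "u_G * theta a = dk_K * (dk_Q * (dk_gamma * theta a))"
      by (simp add: u_G_def mult.assoc PQ_left)
    also have "\<dots> = theta a * u_G"
      unfolding Q_gamma_theta by (simp add: u_G_def mult.assoc PQ_left K_theta)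
    finally show ?thesis .
  qed
qed

text \<open>On the block \<open>P\<close> all odd generators anticommute, so any letter reaches its
  own copy in the top word and squares to zero.\<close>

lemma P_theta_top: "dk_P * (theta a * top_word) = 0" "dk_P * (top_word * theta a) = 0"
proof -
  have z: "dk_P * (theta a * theta_word m) = 0" if "a \<in> set m" for a :: "'a + 'a" and m
    using that
  proof (induction m)
    case (Cons b m)
    show ?case
    proof (cases "b = a")
      case False
      have "dk_P * (theta a * theta_word (b # m)) = dk_P * (theta a * theta b) * theta_word m"
        by (simp add: mult.assoc)
      also have "\<dots> = - (theta b * (dk_P * (theta a * theta_word m)))"
        by (subst P_theta_anticommute) (simp add: mult.assoc PQ_left)
      finally show ?thesis using Cons False by simp
    qed simp
  qed simp
  have "a \<in> set all_modes" by (cases a) (auto simp: all_modes_def)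
  from z[OF this] show 1: "dk_P * (theta a * top_word) = 0" by (simp add: theta_all_modes)
  show "dk_P * (top_word * theta a) = 0"
    using P_theta_word[of a all_modes] 1 by (simp add: theta_all_modes)
qed

lemma top_word_K: "dk_K * top_word = top_word * dk_K" "dk_Kbar * top_word = top_word * dk_Kbar"
  using theta_word_K[of all_modes] theta_word_Kb[of all_modes]
  by (simp_all add: theta_all_modes length_all_modes)

text \<open>Odd generators annihilate \<open>u_W\<close> from both sides; \<open>dk_K\<close>
  crosses the top word without a sign because its length is even.\<close>

lemma u_W_center: "u_W \<in> dk_center"
  unfolding dk_center_iff_theta
proof (intro conjI allI)
  show "u_W * dk_K = dk_K * u_W" "u_W * dk_Kbar = dk_Kbar * u_W"
    by (simp_all add: u_W_def mult.assoc PQ_left top_word_K[symmetric])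
  show "u_W * theta a = theta a * u_W" for a
  proof -
    have "u_W * theta a = dk_K * (dk_P * (top_word * theta a))"
      by (simp add: u_W_def mult.assoc PQ_left)
    moreover have "theta a * u_W = - (dk_K * (dk_P * (theta a * top_word)))"
      by (simp add: u_W_def mult.assoc PQ_left K_theta)
    ultimately show ?thesis by (simp add: P_theta_top)
  qed
qed

section \<open>The image of the Higman map\<close>

definition higman_span :: "'n::{finite,linorder} dk set" where
  "higman_span = cvec.span {u_W, u_Q, u_G}"

lemma higman_span_subspace: "cvec.subspace higman_span"
  by (simp add: higman_span_def)

lemma higman_span_base: "u_W \<in> higman_span" "u_Q \<in> higman_span" "u_G \<in> higman_span"
  by (simp_all add: higman_span_def cvec.span_base)

lemma dk_center_subspace: "cvec.subspace dk_center"
  by (simp add: cvec.subspace_def dk_center_def distrib_left distrib_right)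

lemma higman_span_center: "higman_span \<subseteq> dk_center"
  unfolding higman_span_def
  by (rule cvec.span_minimal[OF _ dk_center_subspace])
    (simp add: u_G_center u_W_center PQ_center u_Q_def)

lemma gamma_at_word: "x \<in> pbw_span L_set (2 * CARD('n)) \<Longrightarrow>
    prod_list (map gamma_at l) * x \<in> pbw_span L_set (2 * CARD('n))" for x :: "'n::{finite,linorder} dk"
proof (induction l)
  case (Cons i l)
  let ?y = "prod_list (map gamma_at l) * x"
  have th: "theta a * y \<in> pbw_span L_set (2 * CARD('n))" if "y \<in> pbw_span L_set (2 * CARD('n))"
    for a and y :: "'n dk"
    using pbw_theta_L[OF that, of a] pbw_bounded by auto
  have "?y - theta (Inl i) * (theta (Inr i) * ?y) \<in> pbw_span L_set (2 * CARD('n))"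
    by (intro pbw_diff th) (use Cons in auto)
  then show ?case by (simp add: gamma_at_def[of i] left_diff_distrib mult.assoc)
qed simp

lemma Q_pbw_words: "x \<in> pbw_span L_set d \<Longrightarrow> dk_Q * x \<in> Q_words d"
proof (rule clinear_span_mem[OF clinear_mult_left Q_words_subspace])
  show "dk_Q * b \<in> Q_words d"
    if b: "b \<in> {g * xi_word A * xibar_word B | g A B. g \<in> L_set \<and> card A + card B \<le> d}" for b
  proof -
    obtain g A B where g: "b = g * xi_word A * xibar_word B" "g \<in> L_set" "card A + card B \<le> d"
      using b by blast
    let ?m = "map Inl (sorted_list_of_set A) @ map Inr (sorted_list_of_set B)"
    have "dk_Q * b = (if g = 1 then 1 else - 1) *\<^sub>C (dk_Q * theta_word ?m)"
      using g(2) by (auto simp: g(1) xi_word_theta xibar_word_theta mult.assoc)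
    also have "\<dots> \<in> Q_words d"
      by (intro cvec.subspace_scale[OF Q_words_subspace] Q_words_base) (use g(3) in simp)
    finally show ?thesis .
  qed
qed (simp add: pbw_span_def)

lemma all_modes_nonempty: "(all_modes :: ('n::{finite,linorder} + 'n) list) \<noteq> []"
  using length_all_modes[where 'n='n] by (metis list.size(3) zero_less_card_finite mult_is_0 less_numeral_extra(3) zero_neq_numeral)

text \<open>There are four kinds of monomials. In the block \<open>P\<close> a word without
  \<open>dk_K\<close> is killed, and a word with \<open>dk_K\<close> is prolonged by the top word,
  which leaves something only for the empty word. In the block \<open>Q\<close> the
  \<open>2 n\<close> drops in degree leave a multiple of \<open>dk_Q\<close>; a factor
  \<open>dk_K\<close> is traded for the central \<open>u_G\<close>.\<close>

lemma fold_scomm_higman: "fold scomm all_modes y \<in> higman_span" for y :: "'n::{finite,linorder} dk"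
proof -
  let ?F = "fold scomm all_modes :: 'n dk \<Rightarrow> 'n dk"
  have FQ: "?F (dk_Q * x) \<in> cvec.span {dk_Q}" if "x \<in> pbw_span L_set (2 * CARD('n))" for x
    using Q_words_0[OF fold_scomm_Q_words[OF Q_pbw_words[OF that], of all_modes, unfolded length_all_modes diff_self_eq_0]]
    by (auto simp: cvec.span_singleton)
  have FK: "?F (g * theta_word m) \<in> higman_span"
    if m: "theta_word m \<in> pbw_span L_set (2 * CARD('n))" and g: "g \<in> K_set" for g m
  proof -
    have "theta_word m * dk_K = (- 1) ^ length m *\<^sub>C (dk_K * theta_word m)"
      by (simp add: theta_word_K flip: power_mult_distrib)
    then have PK: "dk_P * (dk_K * theta_word m) = (- 1) ^ length m *\<^sub>C (dk_P * (theta_word m * dk_K))"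
      by (simp flip: power_mult_distrib)
    have 1: "?F (dk_P * theta_word m) = 0"
      by (rule fold_scomm_P[OF all_modes_nonempty])
    have top: "dk_P * (theta_word (m @ all_modes) * dk_K) \<in> higman_span"
    proof (cases m rule: rev_cases)
      case Nil
      then show ?thesis using higman_span_base(1)
        by (simp add: u_W_def theta_all_modes top_word_K)
    next
      case (snoc m' a)
      then have "dk_P * (theta_word (m @ all_modes) * dk_K)
         = theta_word m' * (dk_P * (theta a * top_word)) * dk_K"
        by (simp add: theta_all_modes mult.assoc PQ_left)
      then show ?thesis by (simp add: P_theta_top cvec.subspace_0[OF higman_span_subspace])
    qed
    note lin = fold_scomm_add fold_scomm_scale
    have 2: "?F (dk_P * (dk_K * theta_word m)) \<in> higman_span"
      unfolding PK lin fold_scomm_P_K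
      by (intro cvec.subspace_scale[OF higman_span_subspace] top)
    have 3: "?F (dk_Q * theta_word m) \<in> higman_span"
      using FQ[OF m] cvec.span_mono[of "{dk_Q}" "{u_W, u_Q, u_G}"]
      by (auto simp: higman_span_def u_Q_def)
    \<comment> \<open>\<open>dk_gamma\<close> squares to 1 on the block, so inserting it twice
      splits off \<open>u_G\<close>, and the remaining factor is free of
      \<open>dk_K\<close>.\<close>
    have "dk_Q * (dk_K * theta_word m) = u_G * (dk_gamma * theta_word m)"
    proof -
      have "u_G * (dk_gamma * theta_word m) = dk_K * (dk_Q * (dk_gamma * dk_gamma)) * theta_word m"
        by (simp add: u_G_def mult.assoc PQ_left)
      then show ?thesis unfolding Q_gamma_sq by (simp add: mult.assoc PQ_left)
    qed
    also have "\<dots> = u_G * (dk_Q * (dk_gamma * theta_word m))"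
      by (simp add: u_G_def mult.assoc PQ_left)
    finally have 4: "?F (dk_Q * (dk_K * theta_word m)) = u_G * ?F (dk_Q * (dk_gamma * theta_word m))"
      by (simp add: fold_scomm_central[OF u_G_center])
    obtain c where "?F (dk_Q * (dk_gamma * theta_word m)) = c *\<^sub>C dk_Q"
      using FQ[OF gamma_at_word[OF m]] unfolding dk_gamma_def by (auto simp: cvec.span_singleton)
    then have "?F (dk_Q * (dk_K * theta_word m)) = c *\<^sub>C u_G"
      using 4 by (simp add: u_G_Q)
    then have 5: "?F (dk_Q * (dk_K * theta_word m)) \<in> higman_span"
      using cvec.subspace_scale[OF higman_span_subspace higman_span_base(3)] by simp
    have split: "x = dk_P * x + dk_Q * x" for x :: "'n dk"
      by (simp add: PQ_sum flip: distrib_right)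
    obtain c where c: "g * theta_word m = dk_P * theta_word m + c *\<^sub>C (dk_Q * theta_word m) \<or>
      g * theta_word m = dk_P * (dk_K * theta_word m) + c *\<^sub>C (dk_Q * (dk_K * theta_word m))"
    proof -
      consider "g = 1" | "g = dk_L" | "g = dk_K" | "g = dk_Kbar" using g by auto
      then show thesis
      proof cases
        case 1
        then show thesis using that[of 1] split[of "theta_word m"] by simp
      next
        case 2
        then show thesis using that[of "-1"] split[of "dk_L * theta_word m"] by simp
      next
        case 3
        then show thesis using that[of 1] split[of "dk_K * theta_word m"] by simp
      next
        case 4
        then show thesis using that[of "-1"] split[of "dk_Kbar * theta_word m"] by (simp add: P_Kb Q_Kb)
      qed
    qed
    note mem = cvec.subspace_add[OF higman_span_subspace] cvec.subspace_scale[OF higman_span_subspace]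
    from c show ?thesis
    proof
      assume "g * theta_word m = dk_P * theta_word m + c *\<^sub>C (dk_Q * theta_word m)"
      then have eq: "?F (g * theta_word m) = c *\<^sub>C ?F (dk_Q * theta_word m)" by (simp only: lin 1 add_0)
      show ?thesis unfolding eq by (intro mem 3)
    next
      assume "g * theta_word m = dk_P * (dk_K * theta_word m) + c *\<^sub>C (dk_Q * (dk_K * theta_word m))"
      then have eq: "?F (g * theta_word m) = ?F (dk_P * (dk_K * theta_word m)) + c *\<^sub>C ?F (dk_Q * (dk_K * theta_word m))"
        by (simp only: lin)
      show ?thesis unfolding eq by (intro mem 2 5)
    qed
  qed
  show ?thesis
  proof (rule clinear_span_mem[OF fold_scomm_linear higman_span_subspace _ pbw_UNIV[of y, unfolded pbw_span_def]])
    fix b :: "'n dk"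
    assume "b \<in> {g * xi_word A * xibar_word B | g A B. g \<in> K_set \<and> card A + card B \<le> 2 * CARD('n)}"
    then obtain g A B where b: "b = g * xi_word A * xibar_word B" "g \<in> K_set" by blast
    let ?m = "map Inl (sorted_list_of_set A) @ map Inr (sorted_list_of_set B)"
    have "theta_word ?m \<in> pbw_span L_set (2 * CARD('n))"
      using theta_word_L[of ?m] pbw_bounded by blast
    from FK[OF this b(2)] show "?F b \<in> higman_span"
      by (simp add: b(1) xi_word_theta xibar_word_theta mult.assoc)
  qed
qed

text \<open>The iterated supercommutator is already known to be central, hence fixed under
  conjugation by \<open>dk_K\<close>, and the number of modes is even: the two summands in
  \<open>higman_map_scomm\<close> coincide.\<close>

lemma higman_map_fold: "dk_higman_map x = 2 *\<^sub>C fold scomm all_modes (x * dk_K)"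
proof -
  let ?F = "fold scomm all_modes" and ?y = "x * dk_K"
  have "?F ?y \<in> dk_center" using fold_scomm_higman higman_span_center by blast
  then have c: "dk_K * ?F ?y * dk_K = ?F ?y" by (simp add: dk_center_def mult.assoc)
  have "dk_higman_map x = ?F ?y + ?F (dk_K * ?y * dk_K)"
    unfolding higman_map_scomm fold_scomm_add ..
  then show ?thesis unfolding fold_scomm_K_conj c by (simp add: length_all_modes two_scaleC)
qed

lemma dk_higman_eq: "dk_higman = (higman_span :: 'n::{finite,linorder} dk set)"
proof
  show "dk_higman \<subseteq> (higman_span :: 'n dk set)"
    using cvec.subspace_scale[OF higman_span_subspace fold_scomm_higman]
    by (auto simp: dk_higman_def higman_map_fold)
  let ?F = "fold scomm all_modes :: 'n dk \<Rightarrow> 'n dk"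
  note lin = fold_scomm_add fold_scomm_scale
  have mem: "z \<in> dk_higman" if "?F y = c *\<^sub>C z" "c \<noteq> 0" for y z c
  proof -
    have "dk_higman_map ((1 / (2 * c)) *\<^sub>C (y * dk_K)) = z"
      using that by (simp add: higman_map_fold mult.assoc lin)
    then show ?thesis unfolding dk_higman_def by (metis rangeI)
  qed
  have sub: "cvec.subspace (dk_higman :: 'n dk set)"
    unfolding cvec.subspace_def dk_higman_def
  proof (intro conjI allI ballI)
    show "0 \<in> range (dk_higman_map :: 'n dk \<Rightarrow> 'n dk)"
      by (rule range_eqI[of _ _ 0]) (simp add: higman_map_fold fold_scomm_zero)
    fix u v :: "'n dk" and c assume "u \<in> range dk_higman_map" "v \<in> range dk_higman_map"
    then obtain x y where "u = dk_higman_map x" "v = dk_higman_map y" by blast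
    then show "u + v \<in> range dk_higman_map"
      by (intro range_eqI[of _ _ "x + y"]) (simp add: higman_map_fold distrib_right lin scaleC_add_right)
  next
    fix c and u :: "'n dk" assume "u \<in> range dk_higman_map"
    then obtain x where "u = dk_higman_map x" by blast
    then show "c *\<^sub>C u \<in> range dk_higman_map"
      by (intro range_eqI[of _ _ "c *\<^sub>C x"]) (simp add: higman_map_fold lin mult.commute)
  qed
  \<comment> \<open>The preimages, up to scalars and a factor \<open>dk_K\<close>: the full dual
    word for \<open>u_Q\<close>, its product with the central \<open>u_G\<close> for
    \<open>u_G\<close>, and \<open>dk_P * dk_K\<close> for \<open>u_W\<close>.\<close>
  let ?w = "theta_word (rev (map dual_index all_modes)) :: 'n dk"
  have Q: "?F (dk_Q * ?w) = (- 2) ^ (2 * CARD('n)) *\<^sub>C dk_Q"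
    using fold_scomm_Q_dual[OF distinct_all_modes] by (simp only: length_all_modes)
  have "u_Q \<in> (dk_higman :: 'n dk set)" unfolding u_Q_def by (rule mem[OF Q]) simp
  moreover have "u_G \<in> (dk_higman :: 'n dk set)"
  proof (rule mem)
    show "?F (u_G * (dk_Q * ?w)) = (- 2) ^ (2 * CARD('n)) *\<^sub>C u_G"
      unfolding fold_scomm_central[OF u_G_center] Q by (simp add: u_G_Q)
  qed simp
  moreover have "u_W \<in> (dk_higman :: 'n dk set)"
  proof (rule mem)
    show "?F (dk_P * (theta_word [] * dk_K)) = 2 ^ (2 * CARD('n)) *\<^sub>C u_W"
      unfolding fold_scomm_P_K length_all_modes by (simp add: theta_all_modes u_W_def top_word_K)
  qed simp
  ultimately show "higman_span \<subseteq> (dk_higman :: 'n dk set)"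
    unfolding higman_span_def by (intro cvec.span_minimal[OF _ sub]) simp
qed

section \<open>Products over sites\<close>

text \<open>The factors need not commute: the head of a sorted list is least, so prepending it keeps
  every subset product in sorted order. This matches sums over words with products over
  sites.\<close>

lemma prod_list_one_plus:
  fixes f :: "'i::linorder \<Rightarrow> 'a::ring_1"
  assumes "sorted l" "distinct l"
  shows "prod_list (map (\<lambda>i. 1 + f i) l) = (\<Sum>A\<in>Pow (set l). prod_list (map f (sorted_list_of_set A)))"
  using assms
proof (induction l)
  case (Cons x l)
  let ?p = "\<lambda>A. prod_list (map f (sorted_list_of_set A))"
  have p: "?p (insert x A) = f x * ?p A" if "A \<in> Pow (set l)" for A
  proof -
    have "finite A" using that finite_subset by auto
    moreover have "x \<notin> A" using that Cons.prems by auto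
    moreover have "insort x (sorted_list_of_set A) = x # sorted_list_of_set A"
      using that Cons.prems \<open>finite A\<close> by (intro insort_is_Cons) auto
    ultimately show ?thesis by simp
  qed
  have "inj_on (insert x) (Pow (set l))"
    using Cons.prems by (auto simp: inj_on_def)
  then have "(\<Sum>A\<in>insert x ` Pow (set l). ?p A) = (\<Sum>A\<in>Pow (set l). f x * ?p A)"
    by (simp add: sum.reindex p)
  moreover have "Pow (set l) \<inter> insert x ` Pow (set l) = {}" using Cons.prems by auto
  ultimately have "(\<Sum>A\<in>Pow (set (x # l)). ?p A) = (\<Sum>A\<in>Pow (set l). ?p A) + (\<Sum>A\<in>Pow (set l). f x * ?p A)"
    by (simp add: Pow_insert sum.union_disjoint)
  then show ?case using Cons by (simp add: distrib_right sum_distrib_left sum.distrib)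
qed simp

lemma prod_list_commute:
  fixes a :: "'a::monoid_mult"
  assumes "\<And>i. i \<in> set l \<Longrightarrow> a * f i = f i * a"
  shows "a * prod_list (map f l) = prod_list (map f l) * a"
  using assms
proof (induction l)
  case (Cons x l)
  have "a * (f x * prod_list (map f l)) = f x * (a * prod_list (map f l))"
    using Cons.prems[of x] by (simp flip: mult.assoc)
  then show ?case using Cons by (simp add: mult.assoc)
qed simp

lemma prod_list_interleave:
  fixes f g :: "'i \<Rightarrow> 'a::monoid_mult"
  assumes "distinct l" "\<And>i j. i \<noteq> j \<Longrightarrow> g i * f j = f j * g i"
  shows "prod_list (map f l) * prod_list (map g l) = prod_list (map (\<lambda>i. f i * g i) l)"
  using assms(1)
proof (induction l)
  case (Cons x l)
  have c: "g x * prod_list (map f l) = prod_list (map f l) * g x"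
    by (rule prod_list_commute, rule assms(2)) (use Cons.prems in auto)
  have "prod_list (map f (x # l)) * prod_list (map g (x # l))
    = f x * (prod_list (map f l) * g x) * prod_list (map g l)"
    by (simp add: mult.assoc)
  also have "\<dots> = f x * g x * (prod_list (map f l) * prod_list (map g l))"
    unfolding c[symmetric] by (simp add: mult.assoc)
  finally show ?case using Cons by simp
qed simp

lemma prod_list_nilpotent_inverse:
  fixes f :: "'i \<Rightarrow> 'a::ring_1"
  assumes "\<And>i j. f i * f j = f j * f i" "\<And>i. f i * f i = 0"
  shows "prod_list (map (\<lambda>i. 1 + f i) l) * prod_list (map (\<lambda>i. 1 - f i) l) = 1"
proof (induction l)
  case (Cons x l)
  let ?A = "prod_list (map (\<lambda>i. 1 + f i) l)" and ?B = "prod_list (map (\<lambda>i. 1 - f i) l)"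
  have c: "(1 - f x) * ?A = ?A * (1 - f x)"
    by (rule prod_list_commute) (simp add: algebra_simps assms(1)[of x])
  have "(1 + f x) * ?A * ((1 - f x) * ?B) = (1 + f x) * (?A * (1 - f x)) * ?B"
    by (simp only: mult.assoc)
  also have "\<dots> = ((1 + f x) * (1 - f x)) * (?A * ?B)"
    unfolding c[symmetric] by (simp only: mult.assoc)
  also have "(1 + f x) * (1 - f x) = 1" by (simp add: algebra_simps assms(2))
  finally show ?case using Cons by simp
qed simp

lemma prod_list_nilpotent_inverse':
  fixes f :: "'i \<Rightarrow> 'a::ring_1"
  assumes "\<And>i j. f i * f j = f j * f i" "\<And>i. f i * f i = 0"
  shows "prod_list (map (\<lambda>i. 1 - f i) l) * prod_list (map (\<lambda>i. 1 + f i) l) = 1"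
  using prod_list_nilpotent_inverse[of "\<lambda>i. - f i" l] assms by simp

lemma sign_half: "(- 1) ^ (k div 2) * (- 1) ^ k = ((- 1) ^ (Suc k div 2) :: complex)"
proof (cases "even k")
  case True
  then show ?thesis by (auto elim!: evenE)
next
  case False
  then obtain j where "k = 2 * j + 1" by (auto elim!: oddE)
  then show ?thesis by simp
qed

lemma sign_half': "(- 1) ^ k * (- 1) ^ (k div 2) = ((- 1) ^ (Suc k div 2) :: complex)"
  using sign_half[of k] by (simp only: mult.commute)

text \<open>Separating the pairs takes \<open>k (k - 1) / 2\<close> transpositions, a number of the
  same parity as \<open>k div 2\<close>; the indices are distinct, so no contraction
  appears.\<close>

lemma xi_xibar_pairs:
  "distinct m \<Longrightarrow> prod_list (map (\<lambda>i. dk_xi i * dk_xibar i) m)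
    = (- 1) ^ (length m div 2) *\<^sub>C (prod_list (map dk_xi m) * prod_list (map dk_xibar m))"
proof (induction m)
  case (Cons i m)
  have "dk_xibar i * prod_list (map dk_xi m) = (- 1) ^ length m *\<^sub>C (prod_list (map dk_xi m) * dk_xibar i)"
    using xibar_xi_word_list[of m i] Cons.prems by auto
  from arg_cong[OF this, of "\<lambda>x. x * prod_list (map dk_xibar m)"]
  show ?case using Cons by (simp add: mult.assoc sign_half)
qed simp

section \<open>The ribbon element\<close>

text \<open>The exponent combines the reordering sign \<open>k div 2\<close> with the
  \<open>k\<close> minus signs of the factors of \<open>dk_gamma\<close>.\<close>

lemma dk_gamma_sum:
  "(\<Sum>A\<in>UNIV. ((- 1) ^ ((card A + 1) div 2) / 2) *\<^sub>C (xi_word A * xibar_word A))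
    = (1/2) *\<^sub>C (dk_gamma :: 'n::{finite,linorder} dk)"
proof -
  have g: "gamma_at = (\<lambda>i. 1 + (- 1) *\<^sub>C (dk_xi i * dk_xibar i) :: 'n dk)"
    by (rule ext) (simp add: gamma_at_def)
  have s: "prod_list (map (\<lambda>i. (- 1) *\<^sub>C (dk_xi i * dk_xibar i)) m)
     = (- 1) ^ length m *\<^sub>C prod_list (map (\<lambda>i. dk_xi i * dk_xibar i) m)" for m :: "'n list"
    by (induction m) simp_all
  have gamma: "dk_gamma = (\<Sum>A\<in>UNIV. (- 1) ^ ((card A + 1) div 2) *\<^sub>C (xi_word A * xibar_word A) :: 'n dk)"
    unfolding dk_gamma_def g
    by (subst prod_list_one_plus)
      (simp_all only: sorted_list_of_set.sorted_sorted_key_list_of_set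
        sorted_list_of_set.distinct_sorted_key_list_of_set s xi_xibar_pairs, simp add: xi_word_def xibar_word_def
        sign_half')
  show ?thesis by (subst gamma) (simp add: cvec.scale_sum_right)
qed

lemma dk_ribbon_eq: "dk_ribbon = (1/2) *\<^sub>C ((1 + dk_K - dk_Kbar + dk_L) * dk_gamma)"
  unfolding dk_ribbon_def dk_gamma_sum by simp

text \<open>Here \<open>dk_L\<close> is \<open>- 1\<close> and \<open>dk_Kbar\<close> is
  \<open>- dk_K\<close>, so the group factor collapses to \<open>2 * dk_K\<close>. In
  \<open>P_ribbon\<close>, with \<open>dk_Kbar\<close> equal to \<open>dk_K\<close>, it collapses to
  2.\<close>

lemma Q_ribbon: "dk_Q * dk_ribbon = (u_G :: 'n::{finite,linorder} dk)"
proof -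
  have "dk_Q * (1 + dk_K - dk_Kbar + dk_L) = 2 *\<^sub>C (dk_Q * dk_K :: 'n dk)"
    by (simp add: distrib_left right_diff_distrib Q_Kb two_scaleC)
  then have "dk_Q * ((1 + dk_K - dk_Kbar + dk_L) * dk_gamma) = 2 *\<^sub>C (u_G :: 'n dk)"
    unfolding u_G_def by (simp only: mult_scaleC_left flip: mult.assoc)
  then show ?thesis by (simp add: dk_ribbon_eq)
qed

lemma P_ribbon: "dk_P * dk_ribbon = dk_P * (dk_gamma :: 'n::{finite,linorder} dk)"
proof -
  have "dk_P * (1 + dk_K - dk_Kbar + dk_L) = 2 *\<^sub>C (dk_P :: 'n dk)"
    by (simp add: distrib_left right_diff_distrib P_Kb two_scaleC)
  then have "dk_P * ((1 + dk_K - dk_Kbar + dk_L) * dk_gamma) = 2 *\<^sub>C (dk_P * dk_gamma :: 'n dk)"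
    by (simp only: mult_scaleC_left flip: mult.assoc)
  then show ?thesis by (simp add: dk_ribbon_eq)
qed

lemma T_LM_u_Q: "T_LM u_Q = u_G"
  by (simp add: T_LM_def u_Q_def PQ_central Q_ribbon)

lemma T_LM_u_G: "T_LM u_G = u_Q"
proof -
  have "T_LM u_G = dk_Q * dk_ribbon * (dk_K * dk_gamma)"
    by (simp add: T_LM_def u_G_def PQ_left mult.assoc)
  also have "\<dots> = dk_K * dk_K * (dk_Q * (dk_gamma * dk_gamma))"
    unfolding Q_ribbon u_G_def by (simp add: gamma_K[symmetric] mult.assoc PQ_left flip: mult.assoc[of dk_gamma])
  finally show ?thesis by (simp add: Q_gamma_sq u_Q_def)
qed

text \<open>\<open>gamma_at i\<close> differs from 1 by a term whose odd letter annihilates the top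
  word on this block.\<close>

lemma P_gamma_list_top: "dk_P * (prod_list (map gamma_at l) * top_word) = dk_P * top_word"
proof (induction l)
  case (Cons i l)
  have "dk_P * (prod_list (map gamma_at (i # l)) * top_word)
      = gamma_at i * (dk_P * (prod_list (map gamma_at l) * top_word))"
    by (simp add: mult.assoc PQ_left)
  also have "\<dots> = dk_P * top_word - dk_xi i * (dk_P * (theta (Inr i) * top_word))"
    unfolding Cons by (simp add: gamma_at_def left_diff_distrib mult.assoc PQ_left)
  finally show ?case using P_theta_top(1)[of "Inr i"] by simp
qed simp

lemma T_LM_u_W: "T_LM u_W = u_W"
proof -
  have "T_LM u_W = dk_P * dk_ribbon * (dk_K * top_word)"
    by (simp add: T_LM_def u_W_def PQ_left mult.assoc)
  also have "\<dots> = dk_K * (dk_P * (dk_gamma * top_word))"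
    unfolding P_ribbon by (simp add: mult.assoc PQ_left) (simp add: gamma_K flip: mult.assoc)
  also have "\<dots> = u_W" unfolding dk_gamma_def P_gamma_list_top by (simp add: u_W_def PQ_left)
  finally show ?thesis .
qed

section \<open>The $R$-matrix\<close>

definition R_odd :: "'n \<Rightarrow> ('n dk, 'n dk) tensor" where
  "R_odd i = dk_xi i \<otimes>\<^sub>C (dk_xibar i * dk_Kbar)"

definition R_odd_flip :: "'n \<Rightarrow> ('n dk, 'n dk) tensor" where
  "R_odd_flip i = (dk_xibar i * dk_Kbar) \<otimes>\<^sub>C dk_xi i"

definition R_even :: "('n dk, 'n dk) tensor" where
  "R_even = (1/2) *\<^sub>C (1 \<otimes>\<^sub>C 1 + dk_K \<otimes>\<^sub>C 1 + 1 \<otimes>\<^sub>C dk_Kbar - dk_K \<otimes>\<^sub>C dk_Kbar)"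

definition R_even_flip :: "('n dk, 'n dk) tensor" where
  "R_even_flip = (1/2) *\<^sub>C (1 \<otimes>\<^sub>C 1 + 1 \<otimes>\<^sub>C dk_K + dk_Kbar \<otimes>\<^sub>C 1 - dk_Kbar \<otimes>\<^sub>C dk_K)"

abbreviation site_prod :: "('n::{finite,linorder} \<Rightarrow> 'a::monoid_mult) \<Rightarrow> 'a" where
  "site_prod f \<equiv> prod_list (map f (sorted_list_of_set UNIV))"

text \<open>The sign in \<open>dk_R\<close> is the cost of moving each \<open>dk_Kbar\<close> to the
  right across the \<open>xibar\<close>; \<open>xi\<close> and \<open>xibar\<close> sit in different
  legs and do not interact.\<close>

lemma R_odd_word:
  "prod_list (map R_odd m)
    = (- 1) ^ (length m div 2) *\<^sub>C (prod_list (map dk_xi m) \<otimes>\<^sub>C (prod_list (map dk_xibar m) * dk_Kbar ^ length m))"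
proof (induction m)
  case (Cons i m)
  have "dk_Kbar * prod_list (map dk_xibar m) = (- 1) ^ length m *\<^sub>C (prod_list (map dk_xibar m) * dk_Kbar)"
    using theta_word_Kb[of "map Inr m"] by (simp add: comp_def)
  from arg_cong[OF this, of "\<lambda>x. x * dk_Kbar ^ length m"]
  have "dk_Kbar * (prod_list (map dk_xibar m) * dk_Kbar ^ length m)
      = (- 1) ^ length m *\<^sub>C (prod_list (map dk_xibar m) * dk_Kbar ^ Suc (length m))"
    by (simp add: mult.assoc)
  then show ?case using Cons by (simp add: R_odd_def tens_mult mult.assoc tens_simps sign_half)
qed (simp add: tens_one)

text \<open>In this form the inverse is explicit: the site factors are commuting unipotents and the
  even part is an involution.\<close>

lemma dk_R_eq: "dk_R = site_prod (\<lambda>i. 1 + R_odd i) * (R_even :: ('n::{finite,linorder} dk, 'n dk) tensor)"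
proof -
  have "site_prod (\<lambda>i. 1 + R_odd i) = (\<Sum>A\<in>UNIV. (- 1) ^ (card A div 2) *\<^sub>C
      (xi_word A \<otimes>\<^sub>C (xibar_word A * dk_Kbar ^ card A)) :: ('n dk, 'n dk) tensor)"
    by (subst prod_list_one_plus) (simp_all add: R_odd_word xi_word_def xibar_word_def)
  then show ?thesis by (simp add: dk_R_def R_even_def)
qed

lemma flip_bilinear: "cbilinear (\<lambda>a b. b \<otimes>\<^sub>C a)"
  by (rule cbilinearI) (simp_all add: tens_simps)

lemma tensor_flip_simps:
  "tensor_flip (a \<otimes>\<^sub>C b) = b \<otimes>\<^sub>C a"
  "tensor_flip (t + u) = tensor_flip t + tensor_flip u"
  "tensor_flip (c *\<^sub>C t) = c *\<^sub>C tensor_flip t"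
  by (simp_all add: tensor_flip_def tensor_lift_tens[OF flip_bilinear] tensor_lift_simps)

lemma tensor_flip_diff: "tensor_flip (t - u) = tensor_flip t - tensor_flip u"
  using tensor_flip_simps(2)[of "t - u" u] by simp

lemma tensor_flip_one: "tensor_flip 1 = 1"
  using tensor_flip_simps(1)[of 1 1] by (simp add: tens_one)

lemma tensor_flip_mult: "tensor_flip (t * u) = tensor_flip t * tensor_flip u"
proof (induction t rule: tensor_induct)
  case (tens a b)
  show ?case
    by (induction u rule: tensor_induct) (simp_all add: tensor_flip_simps tens_mult distrib_left)
qed (simp add: distrib_right tensor_flip_simps)

lemma tensor_flip_R:
  "tensor_flip dk_R = site_prod (\<lambda>i. 1 + R_odd_flip i) * (R_even_flip :: ('n::{finite,linorder} dk, 'n dk) tensor)"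
proof -
  have "tensor_flip (prod_list (map (\<lambda>i. 1 + R_odd i) l)) = prod_list (map (\<lambda>i. 1 + R_odd_flip i) l)"
    for l :: "'n list"
    by (induction l) (simp_all add: tensor_flip_mult tensor_flip_simps tensor_flip_one R_odd_def R_odd_flip_def)
  moreover have "tensor_flip R_even = (R_even_flip :: ('n dk, 'n dk) tensor)"
    by (simp add: R_even_def R_even_flip_def tensor_flip_simps tensor_flip_diff)
  ultimately show ?thesis by (simp add: dk_R_eq tensor_flip_mult)
qed

lemma xi_sq [simp]: "dk_xi i * dk_xi i = 0" "dk_xi i * (dk_xi i * x) = 0"
  "dk_xibar i * dk_xibar i = 0" "dk_xibar i * (dk_xibar i * x) = 0"
  using theta_sq[of "Inl i"] theta_sq[of "Inr i"] by simp_all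

lemma R_odd_nilpotent: "R_odd i * R_odd j = R_odd j * R_odd i" "R_odd i * R_odd i = 0"
  "R_odd_flip i * R_odd_flip j = R_odd_flip j * R_odd_flip i" "R_odd_flip i * R_odd_flip i = 0"
proof -
  note gl = dk_group_left(5-12)
  have 1: "dk_xi i * dk_xi j = - (dk_xi j * dk_xi i)" "dk_xibar i * dk_xibar j = - (dk_xibar j * dk_xibar i)"
    by (rule dk_rels)+
  show "R_odd i * R_odd j = R_odd j * R_odd i" "R_odd_flip i * R_odd_flip j = R_odd_flip j * R_odd_flip i"
    by (simp_all add: R_odd_def R_odd_flip_def tens_mult mult.assoc gl 1 tens_minus)
  show "R_odd i * R_odd i = 0" "R_odd_flip i * R_odd_flip i = 0"
    by (simp_all add: R_odd_def R_odd_flip_def tens_mult tens_zero)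
qed

lemma half_sq: "((1/2) *\<^sub>C x) * ((1/2) *\<^sub>C x) = (1/4) *\<^sub>C (x * x)" for x :: "'a::complex_algebra"
  by simp

lemma four_quarters: "1 = (1/4) *\<^sub>C (1 + 1 + 1 + 1 :: 'a::complex_algebra)"
proof -
  have "1 + 1 + 1 + 1 = 2 *\<^sub>C 2 *\<^sub>C (1 :: 'a)" by (simp only: two_scaleC add.assoc)
  then show ?thesis by (simp only: cvec.scale_scale) simp
qed

lemma R_even_sq: "R_even * R_even = 1" "R_even_flip * R_even_flip = 1"
proof -
  show "R_even * R_even = 1" "R_even_flip * R_even_flip = 1"
    unfolding R_even_def R_even_flip_def half_sq
    by (subst four_quarters, rule arg_cong[of _ _ "scaleC (1/4)"],
      simp add: tens_mult distrib_left distrib_right left_diff_distrib right_diff_distrib tens_one)+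
qed

lemma ring_inv_R: "ring_inv dk_R = R_even * site_prod (\<lambda>i. 1 - R_odd i)"
  unfolding dk_R_eq
proof (rule ring_inv_eqI)
  let ?A = "site_prod (\<lambda>i. 1 + R_odd i)" and ?B = "site_prod (\<lambda>i. 1 - R_odd i)"
  have "?A * R_even * (R_even * ?B) = ?A * (R_even * R_even) * ?B" by (simp only: mult.assoc)
  then show "?A * R_even * (R_even * ?B) = 1"
    by (simp add: R_even_sq prod_list_nilpotent_inverse R_odd_nilpotent(1)
        R_odd_nilpotent(2))
  have "R_even * ?B * (?A * R_even) = R_even * (?B * ?A) * R_even" by (simp only: mult.assoc)
  then show "R_even * ?B * (?A * R_even) = 1"
    by (simp add: R_even_sq prod_list_nilpotent_inverse'[of R_odd "sorted_list_of_set UNIV", OF R_odd_nilpotent(1,2)])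
qed

lemma ring_inv_R_flip: "ring_inv (tensor_flip dk_R) = R_even_flip * site_prod (\<lambda>i. 1 - R_odd_flip i)"
  unfolding tensor_flip_R
proof (rule ring_inv_eqI)
  let ?A = "site_prod (\<lambda>i. 1 + R_odd_flip i)" and ?B = "site_prod (\<lambda>i. 1 - R_odd_flip i)"
  have "?A * R_even_flip * (R_even_flip * ?B) = ?A * (R_even_flip * R_even_flip) * ?B" by (simp only: mult.assoc)
  then show "?A * R_even_flip * (R_even_flip * ?B) = 1"
    by (simp add: R_even_sq prod_list_nilpotent_inverse[of R_odd_flip "sorted_list_of_set UNIV", OF R_odd_nilpotent(3,4)])
  have "R_even_flip * ?B * (?A * R_even_flip) = R_even_flip * (?B * ?A) * R_even_flip" by (simp only: mult.assoc)
  then show "R_even_flip * ?B * (?A * R_even_flip) = 1"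
    by (simp add: R_even_sq prod_list_nilpotent_inverse'[of R_odd_flip "sorted_list_of_set UNIV", OF R_odd_nilpotent(3,4)])
qed

section \<open>The operator $S_{LM}$\<close>

lemma dk_cointegral_add: "dk_cointegral (x + y) = dk_cointegral x + dk_cointegral y"
  by (rule dk_cointegral_linear[unfolded clinear_iff, THEN conjunct1, rule_format])

lemma dk_cointegral_scale: "dk_cointegral (c *\<^sub>C x) = c * dk_cointegral x"
  by (rule dk_cointegral_linear[unfolded clinear_iff, THEN conjunct2, unfolded scaleC_complex_def, rule_format])

lemma dk_cointegral_diff: "dk_cointegral (x - y) = dk_cointegral x - dk_cointegral y"
  using dk_cointegral_add[of "x - y" y] by simp

definition cointegral_right :: "('n::{finite,linorder} dk, 'n dk) tensor \<Rightarrow> 'n dk" where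
  "cointegral_right = tensor_lift (\<lambda>a b. dk_cointegral b *\<^sub>C a)"

lemma cointegral_right_bilinear: "cbilinear (\<lambda>a b. dk_cointegral b *\<^sub>C a)"
  by (intro cbilinearI)
    (simp_all add: dk_cointegral_add dk_cointegral_scale scaleC_add_right scaleC_add_left mult.commute)

lemma cointegral_right_simps:
  "cointegral_right (a \<otimes>\<^sub>C b) = dk_cointegral b *\<^sub>C a"
  "cointegral_right (t + u) = cointegral_right t + cointegral_right u"
  "cointegral_right (c *\<^sub>C t) = c *\<^sub>C cointegral_right t"
  by (simp_all add: cointegral_right_def tensor_lift_tens[OF cointegral_right_bilinear] tensor_lift_simps)

lemma dk_cointegral_low:
  fixes y :: "'n::{finite,linorder} dk"
  assumes "y \<in> pbw_span K_set d" "d < 2 * CARD('n)"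
  shows "dk_cointegral y = 0"
proof -
  have "dk_cointegral y \<in> {0}"
  proof (rule clinear_span_mem[OF dk_cointegral_linear _ _ assms(1)[unfolded pbw_span_def]])
    fix b :: "'n dk"
    assume "b \<in> {g * xi_word A * xibar_word B | g A B. g \<in> K_set \<and> card A + card B \<le> d}"
    then obtain g A B where b: "b = g * xi_word A * xibar_word B" "g \<in> K_set" "card A + card B \<le> d"
      by blast
    have "\<exists>p\<in>{0, 1}. \<exists>q\<in>{0, 1 :: nat}. g = dk_K ^ p * dk_Kbar ^ q" using b(2) by auto
    then obtain p q where "p \<in> {0, 1}" "q \<in> {0, 1 :: nat}" "g = dk_K ^ p * dk_Kbar ^ q" by blast
    then show "dk_cointegral b \<in> {0}"
      using dk_cointegral_pbw[of p q A B] b(1,3) assms(2) by auto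
  qed (simp add: cvec.subspace_def)
  then show ?thesis by simp
qed

text \<open>Each idempotent contributes half of the top word, which the normalization 2 turns into
  1. A leftover \<open>dk_K\<close> moves the product off the one basis vector that counts.\<close>

lemma dk_cointegral_top:
  "dk_cointegral (dk_Q * top_word :: 'n::{finite,linorder} dk) = 1"
  "dk_cointegral (dk_Q * (dk_K * top_word) :: 'n dk) = 0"
  "dk_cointegral (dk_P * top_word :: 'n dk) = 1"
  "dk_cointegral (dk_P * (dk_K * top_word) :: 'n dk) = 0"
proof -
  have v: "dk_cointegral (top_word :: 'n dk) = 2" "dk_cointegral (dk_L * top_word :: 'n dk) = 0"
    "dk_cointegral (dk_K * top_word :: 'n dk) = 0" "dk_cointegral (dk_Kbar * top_word :: 'n dk) = 0"
    using dk_cointegral_pbw[of 0 0 "UNIV :: 'n set" UNIV] dk_cointegral_pbw[of 1 1 "UNIV :: 'n set" UNIV]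
      dk_cointegral_pbw[of 1 0 "UNIV :: 'n set" UNIV] dk_cointegral_pbw[of 0 1 "UNIV :: 'n set" UNIV]
    by (simp_all add: top_word_def mult.assoc)
  show "dk_cointegral (dk_Q * top_word :: 'n dk) = 1" "dk_cointegral (dk_Q * (dk_K * top_word) :: 'n dk) = 0"
    "dk_cointegral (dk_P * top_word :: 'n dk) = 1" "dk_cointegral (dk_P * (dk_K * top_word) :: 'n dk) = 0"
    by (simp_all add: dk_P_def dk_Q_def distrib_right left_diff_distrib dk_cointegral_add
        dk_cointegral_scale dk_cointegral_diff v)
qed

text \<open>The strict inequality makes \<open>tens_filt 0\<close> trivial, so that error terms of an empty product vanish.\<close>

definition tens_filt :: "nat \<Rightarrow> ('n::{finite,linorder} dk, 'n dk) tensor set" where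
  "tens_filt d = cvec.span {a \<otimes>\<^sub>C y | a y e. e < d \<and> y \<in> pbw_span K_set e}"

lemma tens_filt_subspace: "cvec.subspace (tens_filt d)"
  by (simp add: tens_filt_def)

lemma tens_filt_base: "e < d \<Longrightarrow> y \<in> pbw_span K_set e \<Longrightarrow> a \<otimes>\<^sub>C y \<in> tens_filt d"
  unfolding tens_filt_def by (rule cvec.span_base) blast

text \<open>Both bounds are strict, so one unit is gained: from \<open>k < d\<close> and
  \<open>k' < e\<close> follows \<open>k + k' + 2 \<le> d + e\<close>.\<close>

lemma tens_filt_mult:
  fixes t u :: "('n::{finite,linorder} dk, 'n dk) tensor"
  assumes "t \<in> tens_filt d" "u \<in> tens_filt e" "d + e \<le> Suc f"
  shows "t * u \<in> tens_filt f"
proof (rule clinear_span_mem[OF clinear_mult_right tens_filt_subspace _ assms(1)[unfolded tens_filt_def]])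
  fix b :: "('n dk, 'n dk) tensor"
  assume "b \<in> {a \<otimes>\<^sub>C y | a y e. e < d \<and> y \<in> pbw_span K_set e}"
  then obtain a y k where b: "b = a \<otimes>\<^sub>C y" "k < d" "y \<in> pbw_span K_set k" by blast
  show "b * u \<in> tens_filt f"
  proof (rule clinear_span_mem[OF clinear_mult_left tens_filt_subspace _ assms(2)[unfolded tens_filt_def]])
    fix c :: "('n dk, 'n dk) tensor"
    assume "c \<in> {a \<otimes>\<^sub>C y | a y k. k < e \<and> y \<in> pbw_span K_set k}"
    then obtain a' y' k' where c: "c = a' \<otimes>\<^sub>C y'" "k' < e" "y' \<in> pbw_span K_set k'" by blast
    have "k + k' < f" using b(2) c(2) assms(3) by simp
    then show "b * c \<in> tens_filt f"
      unfolding b(1) c(1) tens_mult using pbw_mult[OF b(3) c(3)] by (rule tens_filt_base)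
  qed
qed

lemma cointegral_right_low:
  fixes t :: "('n::{finite,linorder} dk, 'n dk) tensor"
  assumes "t \<in> tens_filt (2 * CARD('n))"
  shows "cointegral_right t = 0"
proof -
  have lin: "clinear (cointegral_right :: ('n dk, 'n dk) tensor \<Rightarrow> 'n dk)"
    by (rule clinearI) (simp_all add: cointegral_right_simps)
  have "cointegral_right t \<in> {0}"
  proof (rule clinear_span_mem[OF lin _ _ assms[unfolded tens_filt_def]])
    show "cointegral_right b \<in> {0}"
      if b: "b \<in> {a \<otimes>\<^sub>C y | a y e. e < 2 * CARD('n) \<and> y \<in> pbw_span K_set e}"
      for b :: "('n dk, 'n dk) tensor"
      using b dk_cointegral_low by (auto simp: cointegral_right_simps)
  qed (simp add: cvec.subspace_def)
  then show ?thesis by simp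
qed

abbreviation tens_Q :: "('n dk, 'n dk) tensor" where "tens_Q \<equiv> 1 \<otimes>\<^sub>C dk_Q"

lemma tens_center: "z \<in> dk_center \<Longrightarrow> t * (1 \<otimes>\<^sub>C z) = (1 \<otimes>\<^sub>C z) * t"
  by (induction t rule: tensor_induct) (simp_all add: tens_mult distrib_left distrib_right dk_center_def)

lemma tens_center_left:
  "z \<in> dk_center \<Longrightarrow> t * ((1 \<otimes>\<^sub>C z) * u) = (1 \<otimes>\<^sub>C z) * (t * u)"
  by (simp add: tens_center flip: mult.assoc)

lemma tens_Q_idem: "tens_Q * tens_Q = tens_Q"
  by (simp add: tens_mult)

text \<open>Since the cointegral sees only the top degree \<open>2 n\<close> of the second leg, every one of the \<open>n\<close> site
  factors may be replaced by its component of degree 2.\<close>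

lemma site_product_top:
  fixes E D :: "'n::{finite,linorder} \<Rightarrow> ('n dk, 'n dk) tensor"
  assumes E: "\<And>i. tens_Q * E i = tens_Q * (D i + r i)"
    and D: "\<And>i. D i \<in> tens_filt 3" and r: "\<And>i. r i \<in> tens_filt 2"
  shows "\<exists>s\<in>tens_filt (2 * length l). tens_Q * prod_list (map E l) = tens_Q * (prod_list (map D l) + s)"
proof (induction l)
  case Nil
  then show ?case by (intro bexI[of _ 0]) (simp_all add: cvec.subspace_0[OF tens_filt_subspace])
next
  case (Cons i l)
  then obtain s where s: "s \<in> tens_filt (2 * length l)"
    "tens_Q * prod_list (map E l) = tens_Q * (prod_list (map D l) + s)" by blast
  let ?D = "prod_list (map D l)" and ?E = "prod_list (map E l)"
  have one: "1 \<in> (tens_filt 1 :: ('n dk, 'n dk) tensor set)"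
    using tens_filt_base[of 0 1 1 1] by (simp add: pbw_one tens_one)
  \<comment> \<open>Because of the strict bound, the \<open>+ 1\<close> stands for degree at most
    \<open>2 * length m\<close>.\<close>
  have Dl: "prod_list (map D m) \<in> tens_filt (2 * length m + 1)" for m
  proof (induction m)
    case Nil
    then show ?case using one by simp
  next
    case (Cons j m)
    then show ?case using tens_filt_mult[OF D Cons.IH] by simp
  qed
  have "tens_Q * (E i * ?E) = tens_Q * tens_Q * E i * ?E" by (simp add: tens_Q_idem mult.assoc)
  also have "\<dots> = (tens_Q * E i) * (tens_Q * ?E)"
    by (simp only: mult.assoc tens_center_left[OF PQ_center(2), of "E i"])
  also have "\<dots> = (tens_Q * (D i + r i)) * (tens_Q * (?D + s))" unfolding E s(2) ..
  also have "\<dots> = tens_Q * tens_Q * (D i + r i) * (?D + s)"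
    by (simp only: mult.assoc tens_center_left[OF PQ_center(2), of "D i + r i"])
  also have "\<dots> = tens_Q * (D i * ?D + (D i * s + (r i * ?D + r i * s)))"
    by (simp add: tens_Q_idem mult.assoc distrib_left distrib_right add_ac)
  finally have "tens_Q * prod_list (map E (i # l)) = tens_Q * (prod_list (map D (i # l))
     + (D i * s + (r i * ?D + r i * s)))" by simp
  moreover have "D i * s + (r i * ?D + r i * s) \<in> tens_filt (2 * length (i # l))"
    by (intro cvec.subspace_add[OF tens_filt_subspace] tens_filt_mult[OF D s(1)]
        tens_filt_mult[OF r Dl] tens_filt_mult[OF r s(1)]) simp_all
  ultimately show ?case by blast
qed

text \<open>The conjugate of \<open>- R_odd i\<close> by the involution \<open>R_even_flip\<close>,
  which appears when the even parts are collected on the left.\<close>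

definition R_odd_twist :: "'n \<Rightarrow> ('n dk, 'n dk) tensor" where
  "R_odd_twist i = - ((dk_Kbar * dk_xi i) \<otimes>\<^sub>C (dk_L * dk_xibar i))"

lemma xi_K: "dk_xi i * dk_K = - (dk_K * dk_xi i)" "dk_xi i * (dk_K * z) = - (dk_K * (dk_xi i * z))"
  "dk_xi i * dk_Kbar = - (dk_Kbar * dk_xi i)" "dk_xi i * (dk_Kbar * z) = - (dk_Kbar * (dk_xi i * z))"
  "dk_xibar i * dk_K = - (dk_K * dk_xibar i)" "dk_xibar i * (dk_K * z) = - (dk_K * (dk_xibar i * z))"
  "dk_xibar i * dk_Kbar = - (dk_Kbar * dk_xibar i)"
  "dk_xibar i * (dk_Kbar * z) = - (dk_Kbar * (dk_xibar i * z))"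
  by (rule dk_group_left)+

lemma R_odd_R_even_flip: "(- R_odd i) * R_even_flip = R_even_flip * R_odd_twist i"
  by (simp add: R_odd_def R_odd_twist_def R_even_flip_def tens_mult distrib_left distrib_right
      left_diff_distrib right_diff_distrib tens_minus xi_K mult.assoc scaleC_add_right
      cvec.scale_right_diff_distrib)

lemma R_odd_prod_R_even_flip:
  "prod_list (map (\<lambda>i. 1 - R_odd i) l) * R_even_flip
    = R_even_flip * prod_list (map (\<lambda>i. 1 + R_odd_twist i) l)"
proof (induction l)
  case (Cons i l)
  have "(1 - R_odd i) * R_even_flip = R_even_flip * (1 + R_odd_twist i)"
    using R_odd_R_even_flip[of i] by (simp add: left_diff_distrib distrib_left)
  then show ?case using Cons by (simp add: mult.assoc) (simp flip: mult.assoc)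
qed simp

definition S_site :: "'n \<Rightarrow> ('n dk, 'n dk) tensor" where
  "S_site i = (1 + R_odd_twist i) * (1 - R_odd_flip i)"

lemma S_site_commute: "i \<noteq> j \<Longrightarrow> R_odd_flip i * R_odd_twist j = R_odd_twist j * R_odd_flip i"
  using dk_xi_xibar[of i j] dk_xi_xibar[of j i]
  by (simp add: R_odd_twist_def R_odd_flip_def tens_mult xi_K mult.assoc tens_minus dk_L_left)

text \<open>A central \<open>x\<close> passes every factor, so the even parts gather on the left and
  the odd factors of the two inverse R-matrices can be paired site by site.\<close>

lemma S_LM_center:
  assumes "x \<in> dk_center"
  shows "S_LM x = cointegral_right (R_even * R_even_flip * ((1 \<otimes>\<^sub>C x) * site_prod S_site))"
proof -
  let ?A = "site_prod (\<lambda>i. 1 - R_odd i)" and ?B = "site_prod (\<lambda>i. 1 - R_odd_flip i)"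
   and ?Z = "site_prod (\<lambda>i. 1 + R_odd_twist i)" and ?x = "1 \<otimes>\<^sub>C x"
  have "R_even * ?A * ?x * (R_even_flip * ?B) = R_even * (?A * R_even_flip) * ?x * ?B"
    by (simp only: mult.assoc tens_center_left[OF assms, of R_even_flip])
  also have "\<dots> = R_even * R_even_flip * (?x * (?Z * ?B))"
    unfolding R_odd_prod_R_even_flip by (simp only: mult.assoc tens_center_left[OF assms, of ?Z])
  also have "?Z * ?B = site_prod S_site"
    unfolding S_site_def
    by (rule prod_list_interleave)
      (simp_all add: left_diff_distrib right_diff_distrib distrib_left distrib_right S_site_commute)
  finally show ?thesis
    unfolding S_LM_def ring_inv_R ring_inv_R_flip cointegral_right_def by (simp only: mult.assoc)
qed


text \<open>The cointegral keeps only terms free of \<open>dk_K\<close> in the second leg. An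
  argument without \<open>dk_K\<close> therefore selects the first summand and lands in the block
  \<open>P\<close>, while one with \<open>dk_K\<close> selects the second and stays in
  \<open>Q\<close>.\<close>

lemma R_even_Q: "R_even * R_even_flip * tens_Q = (dk_P * dk_K) \<otimes>\<^sub>C dk_Q + (dk_Q * dk_K) \<otimes>\<^sub>C (dk_Q * dk_K)"
proof -
  let ?Y = "(dk_K + dk_Kbar) \<otimes>\<^sub>C dk_Q + (dk_K - dk_Kbar) \<otimes>\<^sub>C (dk_Q * dk_K)"
  have "R_even * R_even_flip * tens_Q = (1/4) *\<^sub>C (?Y + ?Y)"
    unfolding R_even_def R_even_flip_def mult_scaleC_left mult_scaleC_right scaleC_scaleC
    by (rule arg_cong2[of _ _ _ _ scaleC], simp, simp add: tens_mult distrib_left distrib_right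
        left_diff_distrib right_diff_distrib PQ_central Q_Kb tens_minus tens_simps(1,2) tens_diff)
  also have "\<dots> = (1/2) *\<^sub>C ?Y" by (simp flip: two_scaleC)
  also have "\<dots> = ((1/2) *\<^sub>C (dk_K + dk_Kbar)) \<otimes>\<^sub>C dk_Q + ((1/2) *\<^sub>C (dk_K - dk_Kbar)) \<otimes>\<^sub>C (dk_Q * dk_K)"
    unfolding tens_simps(3) by (rule scaleC_add_right)
  also have "(1/2) *\<^sub>C (dk_K + dk_Kbar) = dk_P * dk_K" by (simp add: dk_P_def distrib_right)
  also have "(1/2) *\<^sub>C (dk_K - dk_Kbar) = dk_Q * dk_K" by (simp add: dk_Q_def left_diff_distrib)
  finally show ?thesis .
qed

lemma R_even_P: "R_even * R_even_flip * (1 \<otimes>\<^sub>C dk_P) = dk_P \<otimes>\<^sub>C dk_P + dk_Q \<otimes>\<^sub>C (dk_P * dk_K)"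
proof -
  let ?Y = "(1 + dk_L) \<otimes>\<^sub>C dk_P + (1 - dk_L) \<otimes>\<^sub>C (dk_P * dk_K)"
  have "R_even * R_even_flip * (1 \<otimes>\<^sub>C dk_P) = (1/4) *\<^sub>C (?Y + ?Y)"
    unfolding R_even_def R_even_flip_def mult_scaleC_left mult_scaleC_right scaleC_scaleC
    by (rule arg_cong2[of _ _ _ _ scaleC], simp, simp add: tens_mult distrib_left distrib_right
        left_diff_distrib right_diff_distrib PQ_central P_Kb tens_minus tens_simps(1,2) tens_diff)
  also have "\<dots> = (1/2) *\<^sub>C ?Y" by (simp flip: two_scaleC)
  also have "\<dots> = ((1/2) *\<^sub>C (1 + dk_L)) \<otimes>\<^sub>C dk_P + ((1/2) *\<^sub>C (1 - dk_L)) \<otimes>\<^sub>C (dk_P * dk_K)"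
    unfolding tens_simps(3) by (rule scaleC_add_right)
  finally show ?thesis by (simp add: dk_P_def[symmetric] dk_Q_def[symmetric])
qed

text \<open>\<open>u_W\<close> annihilates every odd letter, so all site factors act as 1; the
  \<open>dk_K\<close> inside \<open>u_W\<close> selects the \<open>dk_Q\<close> summand of
  \<open>R_even_P\<close>.\<close>

lemma S_LM_u_W: "S_LM u_W = (u_Q :: 'n::{finite,linorder} dk)"
proof -
  have z: "(1 \<otimes>\<^sub>C u_W) * R_odd_twist i = 0" "(1 \<otimes>\<^sub>C u_W) * R_odd_flip i = 0" for i :: 'n
  proof -
    have "u_W * theta a = 0" for a :: "'n + 'n"
      using P_theta_top(2)[of a] by (simp add: u_W_def mult.assoc flip: PQ_left)
    from this[of "Inl i"] this[of "Inr i"] have "u_W * dk_xi i = 0" "u_W * dk_xibar i = 0" by simp_all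
    then show "(1 \<otimes>\<^sub>C u_W) * R_odd_twist i = 0" "(1 \<otimes>\<^sub>C u_W) * R_odd_flip i = 0"
      by (simp_all add: R_odd_twist_def R_odd_flip_def tens_mult tens_zero dk_L_left)
  qed
  have "(1 \<otimes>\<^sub>C u_W) * prod_list (map S_site l) = 1 \<otimes>\<^sub>C u_W" for l :: "'n list"
    by (induction l) (simp_all add: S_site_def distrib_left right_diff_distrib z flip: mult.assoc)
  then have "S_LM u_W = cointegral_right (R_even * R_even_flip * (1 \<otimes>\<^sub>C (u_W :: 'n dk)))"
    by (simp add: S_LM_center[OF u_W_center])
  also have "1 \<otimes>\<^sub>C (u_W :: 'n dk) = (1 \<otimes>\<^sub>C dk_P) * (1 \<otimes>\<^sub>C u_W)"
    by (simp add: tens_mult u_W_def)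
  also have "R_even * R_even_flip * \<dots> = (R_even * R_even_flip * (1 \<otimes>\<^sub>C dk_P)) * (1 \<otimes>\<^sub>C u_W)"
    by (simp only: mult.assoc)
  finally show ?thesis
    unfolding R_even_P by (simp add: distrib_right tens_mult cointegral_right_simps u_W_def PQ_left mult.assoc
      dk_cointegral_top u_Q_def)
qed


lemma pbw_theta_1: "dk_xi i \<in> pbw_span K_set 1" "dk_xibar i \<in> pbw_span K_set 1"
  "dk_xi i * dk_xibar i \<in> pbw_span K_set 2"
proof -
  have 0: "1 \<in> pbw_span K_set 0" by (rule pbw_one) simp
  show "dk_xi i \<in> pbw_span K_set 1" and b: "dk_xibar i \<in> pbw_span K_set 1"
    using pbw_theta_K[OF 0, of "Inl i"] pbw_theta_K[OF 0, of "Inr i"] by simp_all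
  show "dk_xi i * dk_xibar i \<in> pbw_span K_set 2"
    using pbw_theta_K[OF b, of "Inl i"] by (simp add: numeral_2_eq_2)
qed

lemma S_site_expand:
  "S_site i = 1 - (dk_Kbar * dk_xi i) \<otimes>\<^sub>C (dk_L * dk_xibar i) - (dk_xibar i * dk_Kbar) \<otimes>\<^sub>C dk_xi i
     + (dk_xi i * dk_xibar i) \<otimes>\<^sub>C (dk_L * (1 - dk_L - dk_xi i * dk_xibar i))"
proof -
  have "(dk_Kbar * dk_xi i) * (dk_xibar i * dk_Kbar) = dk_xi i * dk_xibar i"
    by (simp add: xi_K mult.assoc)
  then have "R_odd_twist i * R_odd_flip i
    = - ((dk_xi i * dk_xibar i) \<otimes>\<^sub>C (dk_L * (1 - dk_L - dk_xi i * dk_xibar i)))"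
    by (simp add: R_odd_twist_def R_odd_flip_def tens_mult mult.assoc xibar_xi)
  from arg_cong[OF this, of "\<lambda>t. 1 + R_odd_twist i - R_odd_flip i - t"] show ?thesis
    by (simp add: S_site_def distrib_right right_diff_distrib diff_diff_eq)
      (simp add: R_odd_twist_def R_odd_flip_def)
qed

text \<open>With \<open>dk_L = - 1\<close>, the product of the two odd terms has second leg
  \<open>xi_i xibar_i - 2\<close>. Its first part is the only contribution of degree 2; the inner
  bracket has degree at most 1.\<close>

lemma Q_S_site:
  "tens_Q * S_site i = tens_Q * ((dk_xi i * dk_xibar i) \<otimes>\<^sub>C (dk_xi i * dk_xibar i)
    + (1 + (dk_Kbar * dk_xi i) \<otimes>\<^sub>C dk_xibar i - (dk_xibar i * dk_Kbar) \<otimes>\<^sub>C dk_xi i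
      - (dk_xi i * dk_xibar i) \<otimes>\<^sub>C 1 - (dk_xi i * dk_xibar i) \<otimes>\<^sub>C 1))"
  by (simp add: S_site_expand distrib_left right_diff_distrib tens_mult tens_minus tens_diff tens_simps)

text \<open>The factor \<open>gamma_at i\<close> adds a second term of degree 2 with first leg
  \<open>- 1\<close>; together with \<open>xi_i xibar_i\<close> this is \<open>- gamma_at i\<close>.
  Thus the chirality element reappears in the first leg.\<close>

lemma Q_gamma_S_site:
  "tens_Q * ((1 \<otimes>\<^sub>C gamma_at i) * S_site i) = tens_Q * ((- gamma_at i) \<otimes>\<^sub>C (dk_xi i * dk_xibar i)
    + (1 + (dk_Kbar * dk_xi i) \<otimes>\<^sub>C dk_xibar i + (dk_xibar i * dk_Kbar) \<otimes>\<^sub>C dk_xi i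
      - (dk_xi i * dk_xibar i) \<otimes>\<^sub>C 1 - (dk_xi i * dk_xibar i) \<otimes>\<^sub>C 1))"
proof -
  have "dk_Q * (gamma_at i * (dk_xi i * dk_xibar i)) = - (dk_Q * (dk_xi i * dk_xibar i))"
    using arg_cong[OF Q_gamma_at(1)[of i], of "\<lambda>x. x * dk_xibar i"] by (simp add: mult.assoc)
  moreover have "dk_Q * gamma_at i = dk_Q - dk_Q * (dk_xi i * dk_xibar i)"
    by (simp add: gamma_at_def right_diff_distrib)
  moreover have "(- gamma_at i) \<otimes>\<^sub>C y = (dk_xi i * dk_xibar i) \<otimes>\<^sub>C y - 1 \<otimes>\<^sub>C y" for y :: "'a dk"
    by (simp add: gamma_at_def tens_diff)
  ultimately show ?thesis
    by (simp add: S_site_expand distrib_left right_diff_distrib tens_mult tens_minus tens_diff tens_simps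
      dk_L_left[of "gamma_at i"] dk_L_central[of "gamma_at i", symmetric] Q_gamma_at)
qed

lemma tens_filt_site:
  "a \<otimes>\<^sub>C (dk_xi i * dk_xibar i) \<in> tens_filt 3" "a \<otimes>\<^sub>C dk_xi i \<in> tens_filt 2"
  "a \<otimes>\<^sub>C dk_xibar i \<in> tens_filt 2" "a \<otimes>\<^sub>C 1 \<in> tens_filt 2" "1 \<in> tens_filt 2"
proof -
  have one: "1 \<in> pbw_span K_set 0" by (rule pbw_one) simp
  show "a \<otimes>\<^sub>C (dk_xi i * dk_xibar i) \<in> tens_filt 3" by (rule tens_filt_base[OF _ pbw_theta_1(3)]) simp
  show "a \<otimes>\<^sub>C dk_xi i \<in> tens_filt 2" by (rule tens_filt_base[OF _ pbw_theta_1(1)]) simp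
  show "a \<otimes>\<^sub>C dk_xibar i \<in> tens_filt 2" by (rule tens_filt_base[OF _ pbw_theta_1(2)]) simp
  show 1: "a \<otimes>\<^sub>C 1 \<in> tens_filt 2" for a by (rule tens_filt_base[OF _ one]) simp
  show "1 \<in> tens_filt 2" using 1[of 1] by (simp add: tens_one)
qed

text \<open>The common part of the two computations on the block \<open>Q\<close>: \<open>h\<close>
  is the group factor of the argument, and \<open>d i\<close> is the first leg of the degree 2 part
  at site \<open>i\<close>.\<close>

lemma cointegral_right_top:
  fixes r E :: "'n::{finite,linorder} \<Rightarrow> ('n dk, 'n dk) tensor"
  assumes E: "\<And>i. tens_Q * E i = tens_Q * ((d i \<otimes>\<^sub>C (dk_xi i * dk_xibar i)) + r i)"
    and r: "\<And>i. r i \<in> tens_filt 2" and h: "h = 1 \<or> h = dk_K"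
  shows "cointegral_right (R_even * R_even_flip * ((1 \<otimes>\<^sub>C (dk_Q * h)) * site_prod E))
    = (- 1) ^ (CARD('n) div 2) *\<^sub>C
      ((dk_cointegral (dk_Q * (h * top_word)) *\<^sub>C (dk_P * dk_K)
        + dk_cointegral (dk_Q * (dk_K * (h * top_word))) *\<^sub>C (dk_Q * dk_K)) * site_prod d)"
proof -
  let ?D = "\<lambda>i. d i \<otimes>\<^sub>C (dk_xi i * dk_xibar i)" and ?c = "(- 1) ^ (CARD('n) div 2) :: complex"
  obtain s where s: "s \<in> tens_filt (2 * CARD('n))"
    "tens_Q * site_prod E = tens_Q * (site_prod ?D + s)"
    using site_product_top[where E = E and D = ?D and r = r and l = "sorted_list_of_set UNIV",
      OF E tens_filt_site(1) r] by auto
  have "prod_list (map ?D m) = prod_list (map d m) \<otimes>\<^sub>C prod_list (map (\<lambda>i. dk_xi i * dk_xibar i) m)" for m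
    by (induction m) (simp_all add: tens_one tens_mult)
  then have top: "site_prod ?D = ?c *\<^sub>C (site_prod d \<otimes>\<^sub>C top_word)"
    by (simp add: xi_xibar_pairs tens_simps top_word_def xi_word_def xibar_word_def)
  have K: "g \<in> K_set \<Longrightarrow> dk_Q * g \<in> pbw_span K_set 0" for g :: "'n dk"
  proof -
    assume g: "g \<in> K_set"
    have "1 \<in> pbw_span K_set 0" by (rule pbw_one) simp
    then have "g \<in> pbw_span K_set 0" "dk_L * g \<in> pbw_span K_set 0"
      using g pbw_K_mult[of g 1 0] pbw_K_mult[of dk_L g 0] by auto
    then show ?thesis by (auto simp: dk_Q_def left_diff_distrib intro!: pbw_scale pbw_diff)
  qed
  let ?R = "(dk_P * dk_K) \<otimes>\<^sub>C (dk_Q * h) + (dk_Q * dk_K) \<otimes>\<^sub>C (dk_Q * dk_K * h)"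
  have "R_even * R_even_flip * ((1 \<otimes>\<^sub>C (dk_Q * h)) * site_prod E)
    = (R_even * R_even_flip * tens_Q) * (1 \<otimes>\<^sub>C h) * (tens_Q * site_prod E)"
    by (simp add: mult.assoc tens_center_left[OF PQ_center(2), of "1 \<otimes>\<^sub>C h"])
       (simp add: tens_mult flip: mult.assoc)
  also have "\<dots> = (R_even * R_even_flip * tens_Q) * (1 \<otimes>\<^sub>C h) * (tens_Q * (site_prod ?D + s))"
    unfolding s(2) ..
  also have "\<dots> = ?R * (site_prod ?D + s)"
  proof -
    have "(R_even * R_even_flip * tens_Q) * (1 \<otimes>\<^sub>C h) * tens_Q = ?R"
      unfolding R_even_Q by (simp add: distrib_right tens_mult PQ_central mult.assoc)
    from arg_cong[OF this, of "\<lambda>t. t * (site_prod ?D + s)"] show ?thesis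
      by (simp only: mult.assoc)
  qed
  also have "cointegral_right \<dots> = cointegral_right (?R * site_prod ?D)"
  proof -
    have "dk_Q * h \<in> pbw_span K_set 0" "dk_Q * dk_K * h \<in> pbw_span K_set 0"
      using h K[of 1] K[of dk_K] K[of "dk_K * h"] by (auto simp: mult.assoc)
    \<comment> \<open>Degree 0 in the second leg, so multiplying by \<open>?R\<close> leaves the
      error term \<open>s\<close> below the top degree.\<close>
    then have "?R \<in> tens_filt 1"
      by (intro cvec.subspace_add[OF tens_filt_subspace] tens_filt_base[of 0]) simp_all
    from tens_filt_mult[OF this s(1), of "2 * CARD('n)"] show ?thesis
      by (simp add: distrib_left cointegral_right_simps cointegral_right_low)
  qed
  also have "\<dots> = ?c *\<^sub>C
      ((dk_cointegral (dk_Q * (h * top_word)) *\<^sub>C (dk_P * dk_K)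
        + dk_cointegral (dk_Q * (dk_K * (h * top_word))) *\<^sub>C (dk_Q * dk_K)) * site_prod d)"
    unfolding top by (simp add: distrib_right tens_mult cointegral_right_simps mult.assoc scaleC_add_right)
  finally show ?thesis .
qed


lemma S_LM_u_Q: "S_LM u_Q = (u_W :: 'n::{finite,linorder} dk)"
proof -
  let ?c = "(- 1) ^ (CARD('n) div 2) :: complex"
  have "S_LM u_Q = cointegral_right (R_even * R_even_flip * ((1 \<otimes>\<^sub>C (dk_Q * 1)) * site_prod S_site :: ('n dk, 'n dk) tensor))"
    unfolding u_Q_def S_LM_center[OF PQ_center(2)] by simp
  also have "\<dots> = ?c *\<^sub>C ((dk_cointegral (dk_Q * (1 * top_word) :: 'n dk) *\<^sub>C (dk_P * dk_K)
        + dk_cointegral (dk_Q * (dk_K * (1 * top_word)) :: 'n dk) *\<^sub>C (dk_Q * dk_K))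
        * site_prod (\<lambda>i. dk_xi i * dk_xibar i))"
    by (rule cointegral_right_top[OF Q_S_site])
      (auto intro!: cvec.subspace_add[OF tens_filt_subspace] cvec.subspace_diff[OF tens_filt_subspace] tens_filt_site)
  also have "\<dots> = ?c *\<^sub>C ((dk_P * dk_K) * site_prod (\<lambda>i. dk_xi i * dk_xibar i :: 'n dk))"
    by (simp add: dk_cointegral_top)
  \<comment> \<open>Both legs are reordered with the same sign, which therefore cancels.\<close>
  also have "site_prod (\<lambda>i. dk_xi i * dk_xibar i :: 'n dk) = ?c *\<^sub>C top_word"
    by (simp add: xi_xibar_pairs top_word_def xi_word_def xibar_word_def)
  finally show ?thesis
    by (simp add: u_W_def mult.assoc flip: power_mult_distrib)
qed

lemma S_LM_u_G:
  assumes "even CARD('n::{finite,linorder})"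
  shows "S_LM u_G = (- 1) ^ (CARD('n) div 2) *\<^sub>C (u_G :: 'n dk)"
proof -
  let ?c = "(- 1) ^ (CARD('n) div 2) :: complex"
  let ?g = "\<lambda>i. (1 :: 'n dk) \<otimes>\<^sub>C (gamma_at i :: 'n dk)"
  have g: "1 \<otimes>\<^sub>C dk_gamma = site_prod ?g"
  proof -
    have "1 \<otimes>\<^sub>C prod_list (map gamma_at m) = prod_list (map ?g m)" for m
    proof (induction m)
      case (Cons i m)
      show ?case by (simp add: tens_mult flip: Cons)
    qed (simp add: tens_one)
    then show ?thesis by (simp add: dk_gamma_def)
  qed
  have commute: "S_site i * ?g j = ?g j * S_site i" if "i \<noteq> j" for i j
  proof -
    have "gamma_at j * dk_xi i = dk_xi i * gamma_at j" "gamma_at j * dk_xibar i = dk_xibar i * gamma_at j"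
      using gamma_at_theta[of j "Inl i"] gamma_at_theta[of j "Inr i"] that by (simp_all add: site_def)
    then have "?g j * R_odd_twist i = R_odd_twist i * ?g j" "?g j * R_odd_flip i = R_odd_flip i * ?g j"
      by (simp_all add: R_odd_twist_def R_odd_flip_def tens_mult dk_L_left mult.assoc)
    then have Z: "?g j * (1 + R_odd_twist i) = (1 + R_odd_twist i) * ?g j"
      and Y: "?g j * (1 - R_odd_flip i) = (1 - R_odd_flip i) * ?g j"
      by (simp_all add: distrib_left distrib_right left_diff_distrib right_diff_distrib)
    have "S_site i * ?g j = (1 + R_odd_twist i) * (?g j * (1 - R_odd_flip i))"
      by (simp only: S_site_def Y mult.assoc)
    also have "\<dots> = ?g j * S_site i"
      by (simp only: S_site_def Z flip: mult.assoc)
    finally show ?thesis .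
  qed
  have "(1 \<otimes>\<^sub>C u_G) * site_prod S_site = (1 \<otimes>\<^sub>C (dk_Q * dk_K)) * (site_prod ?g * site_prod S_site)"
    unfolding g[symmetric] by (simp add: u_G_def tens_mult flip: mult.assoc)
  also have "site_prod ?g * site_prod S_site = site_prod (\<lambda>i. ?g i * S_site i)"
    by (rule prod_list_interleave) (simp_all add: commute)
  finally have "S_LM u_G = cointegral_right (R_even * R_even_flip *
     ((1 \<otimes>\<^sub>C (dk_Q * dk_K)) * site_prod (\<lambda>i. ?g i * S_site i)))"
    unfolding S_LM_center[OF u_G_center] by simp
  also have "\<dots> = ?c *\<^sub>C ((dk_cointegral (dk_Q * (dk_K * top_word) :: 'n dk) *\<^sub>C (dk_P * dk_K)
        + dk_cointegral (dk_Q * (dk_K * (dk_K * top_word)) :: 'n dk) *\<^sub>C (dk_Q * dk_K))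
        * site_prod (\<lambda>i. - gamma_at i))"
    by (rule cointegral_right_top[OF Q_gamma_S_site])
      (auto intro!: cvec.subspace_add[OF tens_filt_subspace] cvec.subspace_diff[OF tens_filt_subspace] tens_filt_site)
  \<comment> \<open>Evenness of \<open>n\<close> removes the sign \<open>(- 1) ^ n\<close>; the
    reordering sign of the second leg has no partner and survives.\<close>
  also have "site_prod (\<lambda>i. - gamma_at i) = (dk_gamma :: 'n dk)"
  proof -
    have "prod_list (map (\<lambda>i. - gamma_at i) m) = (- 1) ^ length m *\<^sub>C prod_list (map gamma_at m)" for m :: "'n list"
      by (induction m) simp_all
    then show ?thesis using assms by (simp add: dk_gamma_def)
  qed
  finally show ?thesis by (simp add: dk_cointegral_top u_G_def mult.assoc)
qed

section \<open>Generators of $\mathrm{SL}(2,\mathbb{Z})$\<close>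

definition mat2 :: "int \<Rightarrow> int \<Rightarrow> int \<Rightarrow> int \<Rightarrow> int^2^2" where
  "mat2 a b c d = vector [vector [a, b], vector [c, d]]"

lemma mat2_entries [simp]:
  "mat2 a b c d $ 1 $ 1 = a" "mat2 a b c d $ 1 $ 2 = b" "mat2 a b c d $ 2 $ 1 = c" "mat2 a b c d $ 2 $ 2 = d"
  by (simp_all add: mat2_def)

lemma mat2_collapse: "A = mat2 (A $ 1 $ 1) (A $ 1 $ 2) (A $ 2 $ 1) (A $ 2 $ 2)"
  by (simp add: vec_eq_iff forall_2)

lemma mat2_mult [simp]:
  "mat2 a b c d ** mat2 a' b' c' d' = mat2 (a*a' + b*c') (a*b' + b*d') (c*a' + d*c') (c*b' + d*d')"
  by (simp add: vec_eq_iff forall_2 matrix_matrix_mult_def sum_2)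

lemma SL2Z_simps:
  "A \<in> carrier SL2Z \<longleftrightarrow> det A = 1" "A \<otimes>\<^bsub>SL2Z\<^esub> B = A ** B" "\<one>\<^bsub>SL2Z\<^esub> = mat2 1 0 0 1"
  by (simp_all add: SL2Z_def vec_eq_iff forall_2 mat_def)

lemma det_mat2 [simp]: "det (mat2 a b c d) = a * d - b * c"
  by (simp add: det_2)

lemma SL2Z_st: "SL2Z_s = mat2 0 (-1) 1 0" "SL2Z_t = mat2 1 1 0 1"
  by (simp_all add: SL2Z_s_def SL2Z_t_def mat2_def)

lemma SL2Z_subgroup_cancel:
  assumes H: "subgroup H SL2Z" and "g \<in> H" "A \<in> carrier SL2Z" "g ** A \<in> H"
  shows "A \<in> H"
proof -
  interpret group SL2Z by (rule group_SL2Z)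
  have g: "g \<in> carrier SL2Z" using H assms(2) by (rule subgroup.mem_carrier)
  have "g \<otimes>\<^bsub>SL2Z\<^esub> A \<in> H" using assms(4) by (simp add: SL2Z_simps(2))
  then have "inv\<^bsub>SL2Z\<^esub> g \<otimes>\<^bsub>SL2Z\<^esub> (g \<otimes>\<^bsub>SL2Z\<^esub> A) \<in> H"
    by (rule subgroup.m_closed[OF H subgroup.m_inv_closed[OF H assms(2)]])
  moreover have "inv\<^bsub>SL2Z\<^esub> g \<otimes>\<^bsub>SL2Z\<^esub> (g \<otimes>\<^bsub>SL2Z\<^esub> A) = A"
    using g assms(3) by (simp flip: m_assoc)
  ultimately show ?thesis by simp
qed

lemma SL2Z_translations:
  assumes H: "subgroup H SL2Z" and t: "SL2Z_t \<in> H"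
  shows "mat2 1 k 0 1 \<in> H"
proof -
  have closed: "A ** B \<in> H" if "A \<in> H" "B \<in> H" for A B
    using subgroup.m_closed[OF H that] by (simp add: SL2Z_simps)
  show ?thesis
  proof (induction k rule: int_induct[where k = 0])
    case base
    then show ?case using subgroup.one_closed[OF H] by (simp add: SL2Z_simps)
  next
    case (step1 k)
    then show ?case using closed[OF t step1(2)] by (simp add: SL2Z_st)
  next
    case (step2 k)
    show ?case
      by (rule SL2Z_subgroup_cancel[OF H t]) (use step2 in \<open>simp_all add: SL2Z_simps SL2Z_st\<close>)
  qed
qed

text \<open>Euclid's algorithm on the first column: multiplying by \<open>s\<close> and a power of
  \<open>t\<close> replaces the entries \<open>a\<close>, \<open>c\<close> by \<open>- c\<close>,
  \<open>a mod c\<close>, so the lower left entry shrinks in absolute value.\<close>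

lemma SL2Z_generated:
  assumes H: "subgroup H SL2Z" and s: "SL2Z_s \<in> H" and t: "SL2Z_t \<in> H"
  shows "H = carrier SL2Z"
proof
  show "H \<subseteq> carrier SL2Z" using H by (rule subgroup.subset)
  have closed: "A ** B \<in> H" if "A \<in> H" "B \<in> H" for A B
    using subgroup.m_closed[OF H that] by (simp add: SL2Z_simps)
  note tr = SL2Z_translations[OF H t]
  have "mat2 a b c d \<in> H" if "a * d - b * c = 1" for a b c d
    using that
  proof (induction "nat \<bar>c\<bar>" arbitrary: a b c d rule: less_induct)
    case less
    show ?case
    proof (cases "c = 0")
      case True
      then have "a * d = 1" using less.prems by simp
      then consider "a = 1" "d = 1" | "a = - 1" "d = - 1" by (auto simp: zmult_eq_1_iff)
      then show ?thesis
      proof cases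
        case 1
        then show ?thesis using tr True by simp
      next
        case 2
        \<comment> \<open>The square of \<open>s\<close> is minus the identity.\<close>
        then show ?thesis using closed[OF closed[OF s s] tr[of "- b"]] True by (simp add: SL2Z_st)
      qed
    next
      case False
      let ?q = "a div c"
      have "mat2 (- c) (- d) (a - ?q * c) (b - ?q * d) \<in> H"
      proof (rule less.hyps)
        have "a - ?q * c = a mod c" by (simp add: minus_div_mult_eq_mod)
        then show "nat \<bar>a - ?q * c\<bar> < nat \<bar>c\<bar>" using False abs_mod_less[of c a] by simp
        show "- c * (b - ?q * d) - - d * (a - ?q * c) = 1" using less.prems by (simp add: algebra_simps)
      qed
      moreover have "mat2 (- c) (- d) (a - ?q * c) (b - ?q * d) = (SL2Z_s ** mat2 1 (- ?q) 0 1) ** mat2 a b c d"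
        by (simp add: SL2Z_st)
      ultimately show ?thesis
        using SL2Z_subgroup_cancel[OF H closed[OF s tr[of "- ?q"]], of "mat2 a b c d"] less.prems
        by (simp add: SL2Z_simps)
    qed
  qed
  then show "carrier SL2Z \<subseteq> H"
    by (metis SL2Z_simps(1) det_mat2 mat2_collapse subsetI)
qed

section \<open>Permutation of the nonzero vectors of $\mathbb{F}_2^2$\<close>

text \<open>The three basis vectors are indexed by the nonzero vectors \<open>(1, 0)\<close>, \<open>(0, 1)\<close>, \<open>(1, 1)\<close>
  of \<open>\<F>\<^sub>2\<^sup>2\<close>, on which matrices act through their reduction mod 2.\<close>

locale permutation_triple =
  fixes u1 u2 u3 :: "'a::complex_algebra"
  assumes independent: "a *\<^sub>C u1 + b *\<^sub>C u2 + c *\<^sub>C u3 = 0 \<Longrightarrow> a = 0 \<and> b = 0 \<and> c = 0"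
begin

definition comb :: "complex \<Rightarrow> complex \<Rightarrow> complex \<Rightarrow> 'a" where
  "comb a b c = a *\<^sub>C u1 + b *\<^sub>C u2 + c *\<^sub>C u3"

definition V :: "'a set" where "V = cvec.span {u1, u2, u3}"

text \<open>With the value 0 at the zero vector, \<open>perm_uvec\<close> and
  \<open>perm_mult\<close> hold for all integer matrices, including those singular mod 2.\<close>

definition uvec :: "int \<Rightarrow> int \<Rightarrow> 'a" where
  "uvec p q = (if even p then if even q then 0 else u2 else if even q then u1 else u3)"

definition perm :: "int^2^2 \<Rightarrow> 'a \<Rightarrow> 'a" where
  "perm g x = (THE y. \<exists>a b c. x = comb a b c \<and>
     y = a *\<^sub>C uvec (g $ 1 $ 1) (g $ 2 $ 1) + b *\<^sub>C uvec (g $ 1 $ 2) (g $ 2 $ 2)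
       + c *\<^sub>C uvec (g $ 1 $ 1 + g $ 1 $ 2) (g $ 2 $ 1 + g $ 2 $ 2))"

lemma comb_inject: "comb a b c = comb a' b' c' \<longleftrightarrow> a = a' \<and> b = b' \<and> c = c'"
proof
  assume "comb a b c = comb a' b' c'"
  then have "(a - a') *\<^sub>C u1 + (b - b') *\<^sub>C u2 + (c - c') *\<^sub>C u3 = 0"
    by (simp add: comb_def cvec.scale_left_diff_distrib algebra_simps)
  then show "a = a' \<and> b = b' \<and> c = c'" using independent by fastforce
qed simp

lemma V_comb: "x \<in> V \<longleftrightarrow> (\<exists>a b c. x = comb a b c)"
proof
  show "x \<in> V \<Longrightarrow> \<exists>a b c. x = comb a b c"
    by (auto simp: V_def cvec.span_insert comb_def algebra_simps)
  show "\<exists>a b c. x = comb a b c \<Longrightarrow> x \<in> V"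
    by (elim exE, simp only: V_def comb_def)
      (intro cvec.span_add cvec.span_scale cvec.span_base; simp)
qed

lemma V_subspace: "cvec.subspace V"
  by (simp add: V_def)

lemma uvec_V: "uvec p q \<in> V"
  by (auto simp: uvec_def V_def cvec.span_base cvec.span_zero)

lemma perm_comb:
  "perm g (comb a b c) = a *\<^sub>C uvec (g $ 1 $ 1) (g $ 2 $ 1) + b *\<^sub>C uvec (g $ 1 $ 2) (g $ 2 $ 2)
       + c *\<^sub>C uvec (g $ 1 $ 1 + g $ 1 $ 2) (g $ 2 $ 1 + g $ 2 $ 2)"
  unfolding perm_def comb_inject by (rule the_equality) auto

lemma perm_V: "x \<in> V \<Longrightarrow> perm g x \<in> V"
  using uvec_V by (auto simp: V_comb[of x] perm_comb
      intro!: cvec.subspace_add[OF V_subspace] cvec.subspace_scale[OF V_subspace])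

lemma perm_add: "x \<in> V \<Longrightarrow> y \<in> V \<Longrightarrow> perm g (x + y) = perm g x + perm g y"
proof -
  assume "x \<in> V" "y \<in> V"
  then obtain a b c a' b' c' where x: "x = comb a b c" "y = comb a' b' c'" by (auto simp: V_comb)
  have "x + y = comb (a + a') (b + b') (c + c')" by (simp add: x comb_def scaleC_add_left algebra_simps)
  then show ?thesis by (simp add: x perm_comb scaleC_add_left algebra_simps)
qed

lemma perm_scale: "x \<in> V \<Longrightarrow> perm g (k *\<^sub>C x) = k *\<^sub>C perm g x"
proof -
  assume "x \<in> V"
  then obtain a b c where x: "x = comb a b c" by (auto simp: V_comb)
  have "k *\<^sub>C x = comb (k * a) (k * b) (k * c)" by (simp add: x comb_def scaleC_add_right)
  then show ?thesis by (simp add: x perm_comb scaleC_add_right)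
qed

lemma comb_unit: "comb 0 0 0 = 0" "comb 1 0 0 = u1" "comb 0 1 0 = u2" "comb 0 0 1 = u3"
  by (simp_all add: comb_def)

lemma perm_u: "perm g 0 = 0" "perm g u1 = uvec (g $ 1 $ 1) (g $ 2 $ 1)" "perm g u2 = uvec (g $ 1 $ 2) (g $ 2 $ 2)"
  "perm g u3 = uvec (g $ 1 $ 1 + g $ 1 $ 2) (g $ 2 $ 1 + g $ 2 $ 2)"
  using perm_comb[of g 0 0 0] perm_comb[of g 1 0 0] perm_comb[of g 0 1 0] perm_comb[of g 0 0 1]
  by (simp_all add: comb_unit)

lemma perm_uvec: "perm g (uvec p q) = uvec (g $ 1 $ 1 * p + g $ 1 $ 2 * q) (g $ 2 $ 1 * p + g $ 2 $ 2 * q)"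
  by (cases "even p"; cases "even q"; simp add: uvec_def[of p q] perm_u; simp add: uvec_def)

lemma perm_mult: "x \<in> V \<Longrightarrow> perm (g ** h) x = perm g (perm h x)"
proof -
  assume "x \<in> V"
  then obtain a b c where x: "x = comb a b c" by (auto simp: V_comb)
  have "perm g (perm h x) = a *\<^sub>C perm g (uvec (h $ 1 $ 1) (h $ 2 $ 1)) + b *\<^sub>C perm g (uvec (h $ 1 $ 2) (h $ 2 $ 2))
       + c *\<^sub>C perm g (uvec (h $ 1 $ 1 + h $ 1 $ 2) (h $ 2 $ 1 + h $ 2 $ 2))"
    by (simp add: x perm_comb[of h] perm_add perm_scale uvec_V cvec.subspace_add[OF V_subspace]
        cvec.subspace_scale[OF V_subspace])
  then show ?thesis
    by (simp add: perm_uvec x perm_comb matrix_matrix_mult_def sum_2 algebra_simps)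
qed

lemma perm_one: "x \<in> V \<Longrightarrow> perm (mat2 1 0 0 1) x = x"
proof -
  assume "x \<in> V"
  then obtain a b c where x: "x = comb a b c" by (auto simp: V_comb)
  show ?thesis unfolding x perm_comb by (simp add: uvec_def comb_def)
qed

lemma perm_inverse:
  assumes "g \<in> carrier SL2Z"
  shows "inv\<^bsub>SL2Z\<^esub> g \<in> carrier SL2Z" "x \<in> V \<Longrightarrow> perm g (perm (inv\<^bsub>SL2Z\<^esub> g) x) = x"
    "x \<in> V \<Longrightarrow> perm (inv\<^bsub>SL2Z\<^esub> g) (perm g x) = x"
proof -
  interpret group SL2Z by (rule group_SL2Z)
  show "inv\<^bsub>SL2Z\<^esub> g \<in> carrier SL2Z" using assms by simp
  have "g ** inv\<^bsub>SL2Z\<^esub> g = mat2 1 0 0 1" "inv\<^bsub>SL2Z\<^esub> g ** g = mat2 1 0 0 1"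
    using r_inv[OF assms] l_inv[OF assms] by (simp_all only: SL2Z_simps)
  then show "x \<in> V \<Longrightarrow> perm g (perm (inv\<^bsub>SL2Z\<^esub> g) x) = x" "x \<in> V \<Longrightarrow> perm (inv\<^bsub>SL2Z\<^esub> g) (perm g x) = x"
    by (simp_all add: perm_one flip: perm_mult)
qed

text \<open>Each group element may carry its own nonzero scalar. This freedom allows
  \<open>s\<close> to act exactly as \<open>S_LM\<close>, sign included.\<close>

lemma perm_projective_rep:
  assumes "\<And>g. k g \<noteq> 0"
  shows "projective_rep V (\<lambda>g x. k g *\<^sub>C perm g x)"
  unfolding projective_rep_def
proof (intro conjI ballI allI V_subspace)
  fix g assume g: "g \<in> carrier SL2Z"
  show "bij_betw (\<lambda>x. k g *\<^sub>C perm g x) V V"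
  proof (rule bij_betwI[where g = "\<lambda>x. (1 / k g) *\<^sub>C perm (inv\<^bsub>SL2Z\<^esub> g) x"])
    show "(\<lambda>x. k g *\<^sub>C perm g x) \<in> V \<rightarrow> V" "(\<lambda>x. (1 / k g) *\<^sub>C perm (inv\<^bsub>SL2Z\<^esub> g) x) \<in> V \<rightarrow> V"
      by (auto intro!: cvec.subspace_scale[OF V_subspace] perm_V)
  qed (simp_all add: perm_scale perm_V perm_inverse[OF g] assms)
next
  fix g h
  show "\<exists>c. c \<noteq> 0 \<and> (\<forall>x\<in>V. k (g \<otimes>\<^bsub>SL2Z\<^esub> h) *\<^sub>C perm (g \<otimes>\<^bsub>SL2Z\<^esub> h) x = c *\<^sub>C k g *\<^sub>C perm g (k h *\<^sub>C perm h x))"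
    by (rule exI[of _ "k (g \<otimes>\<^bsub>SL2Z\<^esub> h) / (k g * k h)"])
      (simp add: assms perm_scale perm_V perm_mult SL2Z_simps)
qed (simp_all add: perm_add perm_scale scaleC_add_right mult.commute)

text \<open>The group elements on which \<open>\<rho>\<close> agrees with \<open>perm\<close> up to
  a nonzero scalar form a subgroup, and it contains both generators.\<close>

lemma projective_rep_perm:
  assumes rep: "projective_rep V \<rho>"
    and s: "\<And>x. x \<in> V \<Longrightarrow> \<rho> SL2Z_s x = b *\<^sub>C perm SL2Z_s x" "b \<noteq> 0"
    and t: "\<And>x. x \<in> V \<Longrightarrow> \<rho> SL2Z_t x = perm SL2Z_t x"
    and g: "g \<in> carrier SL2Z"
  shows "\<exists>c. c \<noteq> 0 \<and> (\<forall>x\<in>V. \<rho> g x = c *\<^sub>C perm g x)"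
proof -
  interpret group SL2Z by (rule group_SL2Z)
  have scale: "\<rho> g (c *\<^sub>C x) = c *\<^sub>C \<rho> g x" if "g \<in> carrier SL2Z" "x \<in> V" for g c x
    using rep that by (auto simp: projective_rep_def)
  have mult: "\<exists>c. c \<noteq> 0 \<and> (\<forall>x\<in>V. \<rho> (g \<otimes>\<^bsub>SL2Z\<^esub> h) x = c *\<^sub>C \<rho> g (\<rho> h x))"
    if "g \<in> carrier SL2Z" "h \<in> carrier SL2Z" for g h
    using rep that by (auto simp: projective_rep_def)
  have bij: "bij_betw (\<rho> g) V V" if "g \<in> carrier SL2Z" for g
    using rep that by (auto simp: projective_rep_def)
  define H where "H = {g \<in> carrier SL2Z. \<exists>c. c \<noteq> 0 \<and> (\<forall>x\<in>V. \<rho> g x = c *\<^sub>C perm g x)}"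
  \<comment> \<open>Multiplicativity makes the image of the identity idempotent up to a scalar;
    being surjective, it is then a scalar itself.\<close>
  have one: "\<exists>c. c \<noteq> 0 \<and> (\<forall>x\<in>V. \<rho> \<one>\<^bsub>SL2Z\<^esub> x = c *\<^sub>C x)"
  proof -
    obtain c where c: "c \<noteq> 0" "\<And>x. x \<in> V \<Longrightarrow> \<rho> \<one>\<^bsub>SL2Z\<^esub> x = c *\<^sub>C \<rho> \<one>\<^bsub>SL2Z\<^esub> (\<rho> \<one>\<^bsub>SL2Z\<^esub> x)"
      using mult[OF one_closed one_closed] by auto
    have "\<rho> \<one>\<^bsub>SL2Z\<^esub> y = (1 / c) *\<^sub>C y" if y_in: "y \<in> V" for y
    proof -
      obtain x where "x \<in> V" "y = \<rho> \<one>\<^bsub>SL2Z\<^esub> x"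
        using bij[OF one_closed] y_in unfolding bij_betw_def by blast
      then have "y = c *\<^sub>C \<rho> \<one>\<^bsub>SL2Z\<^esub> y" using c(2) by simp
      then show ?thesis using c(1) by (metis scaleC_scaleC scaleC_one nonzero_divide_eq_eq)
    qed
    then show ?thesis using c(1) by (intro exI[of _ "1 / c"]) simp
  qed
  have "subgroup H SL2Z"
  proof (rule subgroupI)
    show "H \<subseteq> carrier SL2Z" by (auto simp: H_def)
    have "perm \<one>\<^bsub>SL2Z\<^esub> x = x" if "x \<in> V" for x
      unfolding SL2Z_simps(3) using that by (rule perm_one)
    then have "\<one>\<^bsub>SL2Z\<^esub> \<in> H" unfolding H_def using one one_closed by simp
    then show "H \<noteq> {}" by blast
  next
    fix g assume "g \<in> H"
    then obtain cg where g: "g \<in> carrier SL2Z" "cg \<noteq> 0" "\<And>x. x \<in> V \<Longrightarrow> \<rho> g x = cg *\<^sub>C perm g x"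
      by (auto simp: H_def)
    let ?h = "inv\<^bsub>SL2Z\<^esub> g"
    obtain c where c: "c \<noteq> 0" "\<And>x. x \<in> V \<Longrightarrow> \<rho> (?h \<otimes>\<^bsub>SL2Z\<^esub> g) x = c *\<^sub>C \<rho> ?h (\<rho> g x)"
      using mult[OF inv_closed[OF g(1)] g(1)] by auto
    obtain d where d: "d \<noteq> 0" "\<And>x. x \<in> V \<Longrightarrow> \<rho> \<one>\<^bsub>SL2Z\<^esub> x = d *\<^sub>C x" using one by auto
    have "\<rho> ?h y = (d / (c * cg)) *\<^sub>C perm ?h y" if y: "y \<in> V" for y
    proof -
      have h: "perm ?h y \<in> V" using y by (rule perm_V)
      have "d *\<^sub>C perm ?h y = c *\<^sub>C \<rho> ?h (cg *\<^sub>C y)"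
        using c(2)[OF h] d(2)[OF h] g(3)[OF h] perm_inverse(2)[OF g(1) y] l_inv[OF g(1)] by simp
      also have "\<dots> = (c * cg) *\<^sub>C \<rho> ?h y" using scale[OF inv_closed[OF g(1)] y] by simp
      finally have "(1 / (c * cg)) *\<^sub>C d *\<^sub>C perm ?h y = (1 / (c * cg)) *\<^sub>C (c * cg) *\<^sub>C \<rho> ?h y" by simp
      then show ?thesis using c(1) g(2) by simp
    qed
    then show "?h \<in> H" using c(1) d(1) g(1,2) unfolding H_def by (auto intro!: exI[of _ "d / (c * cg)"])
  next
    fix g h assume "g \<in> H" "h \<in> H"
    then obtain cg ch where g: "g \<in> carrier SL2Z" "cg \<noteq> 0" "\<And>x. x \<in> V \<Longrightarrow> \<rho> g x = cg *\<^sub>C perm g x"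
      and h: "h \<in> carrier SL2Z" "ch \<noteq> 0" "\<And>x. x \<in> V \<Longrightarrow> \<rho> h x = ch *\<^sub>C perm h x"
      by (auto simp: H_def)
    obtain c where c: "c \<noteq> 0" "\<And>x. x \<in> V \<Longrightarrow> \<rho> (g \<otimes>\<^bsub>SL2Z\<^esub> h) x = c *\<^sub>C \<rho> g (\<rho> h x)"
      using mult[OF g(1) h(1)] by auto
    have "\<rho> (g \<otimes>\<^bsub>SL2Z\<^esub> h) x = (c * ch * cg) *\<^sub>C perm (g \<otimes>\<^bsub>SL2Z\<^esub> h) x" if x: "x \<in> V" for x
      using c(2)[OF x] h(3)[OF x] g(3)[OF perm_V[OF x, of h]] scale[OF g(1) perm_V[OF x, of h], of ch]
      by (simp add: SL2Z_simps(2) perm_mult[OF x] mult.assoc)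
    then show "g \<otimes>\<^bsub>SL2Z\<^esub> h \<in> H"
      using m_closed[OF g(1) h(1)] c(1) g(2) h(2) unfolding H_def
      by (auto intro!: exI[of _ "c * ch * cg"])
  qed
  moreover have "SL2Z_s \<in> H" "SL2Z_t \<in> H"
  proof -
    have "SL2Z_s \<in> carrier SL2Z" "SL2Z_t \<in> carrier SL2Z" by (simp_all add: SL2Z_simps SL2Z_st)
    moreover have "\<exists>c. c \<noteq> 0 \<and> (\<forall>x\<in>V. \<rho> SL2Z_t x = c *\<^sub>C perm SL2Z_t x)"
      using t by (intro exI[of _ 1]) simp
    ultimately show "SL2Z_s \<in> H" "SL2Z_t \<in> H" unfolding H_def using s by blast+
  qed
  ultimately have "H = carrier SL2Z" by (rule SL2Z_generated)
  then show ?thesis using g by (auto simp: H_def)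
qed

lemma perm_kernel_congruence:
  "congruence_subgroup_of_level 2 {g \<in> carrier SL2Z. \<exists>c. \<forall>x\<in>V. perm g x = c *\<^sub>C x}" (is "congruence_subgroup_of_level 2 ?K")
proof -
  interpret group SL2Z by (rule group_SL2Z)
  have u_V: "u1 \<in> V" "u2 \<in> V" by (simp_all add: V_def cvec.span_base)
  have nz: "u1 \<noteq> 0" using independent[of 1 0 0] by auto
  have neq: "u3 \<noteq> u2" using independent[of 0 1 "-1"] by auto
  have two: "principal_congruence_subgroup 2 \<subseteq> ?K"
  proof
    fix g assume g: "g \<in> principal_congruence_subgroup 2"
    then have gc: "g \<in> carrier SL2Z" and dvd: "\<And>i j. 2 dvd g $ i $ j - mat 1 $ i $ j"
      by (auto simp: principal_congruence_subgroup_def)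
    have "odd (g $ 1 $ 1)" "even (g $ 1 $ 2)" "even (g $ 2 $ 1)" "odd (g $ 2 $ 2)"
      using dvd[of 1 1] dvd[of 1 2] dvd[of 2 1] dvd[of 2 2] by (simp_all add: mat_def)
    then have "perm g x = 1 *\<^sub>C x" if x_in: "x \<in> V" for x
    proof -
      obtain a b c where x: "x = comb a b c" using x_in by (auto simp: V_comb)
      show ?thesis unfolding x perm_comb using \<open>odd (g $ 1 $ 1)\<close> \<open>even (g $ 1 $ 2)\<close>
          \<open>even (g $ 2 $ 1)\<close> \<open>odd (g $ 2 $ 2)\<close> by (simp add: uvec_def comb_def)
    qed
    then show "g \<in> ?K" using gc by blast
  qed
  have "subgroup ?K SL2Z"
  proof (rule subgroupI)
    have "\<exists>c. \<forall>x\<in>V. perm (mat2 1 0 0 1) x = c *\<^sub>C x" using perm_one by (intro exI[of _ 1]) simp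
    then have "mat2 1 0 0 1 \<in> ?K" by (simp add: SL2Z_simps(1))
    then show "?K \<noteq> {}" by blast
  next
    fix g assume "g \<in> ?K"
    then obtain c where g: "g \<in> carrier SL2Z" "\<And>x. x \<in> V \<Longrightarrow> perm g x = c *\<^sub>C x" by blast
    let ?h = "inv\<^bsub>SL2Z\<^esub> g"
    have *: "x = c *\<^sub>C perm ?h x" if "x \<in> V" for x
      using perm_inverse(3)[OF g(1) that] g(2)[OF that] perm_scale[OF that] by simp
    have "c \<noteq> 0" using *[OF u_V(1)] nz by auto
    have "perm ?h x = (1 / c) *\<^sub>C x" if "x \<in> V" for x
      using arg_cong[OF *[OF that], of "scaleC (1 / c)"] \<open>c \<noteq> 0\<close> by simp
    then show "?h \<in> ?K" using g(1) by blast
  next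
    fix g h assume "g \<in> ?K" "h \<in> ?K"
    then obtain c d where g: "g \<in> carrier SL2Z" "\<And>x. x \<in> V \<Longrightarrow> perm g x = c *\<^sub>C x"
      and h: "h \<in> carrier SL2Z" "\<And>x. x \<in> V \<Longrightarrow> perm h x = d *\<^sub>C x" by blast
    have "perm (g \<otimes>\<^bsub>SL2Z\<^esub> h) x = (d * c) *\<^sub>C x" if "x \<in> V" for x
      using that by (simp add: SL2Z_simps(2) perm_mult h(2) perm_scale g(2))
    then show "g \<otimes>\<^bsub>SL2Z\<^esub> h \<in> ?K" using m_closed[OF g(1) h(1)] by blast
  qed auto
  \<comment> \<open>Level 1 means the whole group, but \<open>SL2Z_t\<close> fixes \<open>u1\<close>
    and moves \<open>u2\<close> to \<open>u3\<close>, so it is no scalar.\<close>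
  moreover have "\<not> principal_congruence_subgroup 1 \<subseteq> ?K"
  proof
    assume "principal_congruence_subgroup 1 \<subseteq> ?K"
    moreover have "SL2Z_t \<in> principal_congruence_subgroup 1"
      by (simp add: principal_congruence_subgroup_def SL2Z_simps SL2Z_st)
    ultimately obtain c where c: "\<And>x. x \<in> V \<Longrightarrow> perm SL2Z_t x = c *\<^sub>C x" by blast
    have "u1 = c *\<^sub>C u1" "u3 = c *\<^sub>C u2"
      using c[OF u_V(1)] c[OF u_V(2)] by (simp_all add: perm_u SL2Z_st uvec_def)
    then have "(c - 1) *\<^sub>C u1 = 0" by (simp add: cvec.scale_left_diff_distrib)
    then have "c = 1" using nz by simp
    then show False using \<open>u3 = c *\<^sub>C u2\<close> neq by simp
  qed
  ultimately show ?thesis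
    using two by (auto simp: congruence_subgroup_of_level_def less_Suc_eq numeral_2_eq_2)
qed

end


section \<open>The projective representation on the Higman ideal\<close>

lemma S_LM_linear: "S_LM (x + y) = S_LM x + S_LM y" "S_LM (c *\<^sub>C x) = c *\<^sub>C S_LM x"
  by (simp_all add: S_LM_def tens_simps distrib_left distrib_right tensor_lift_simps)

text \<open>Only \<open>u_W\<close> has to be shown nonzero, by the cointegral. Multiplication by
  \<open>dk_P\<close> isolates its coefficient, and \<open>S_LM\<close> and \<open>T_LM\<close>
  carry the other two coefficients over to it.\<close>

lemma u_independent:
  fixes a b c :: complex
  assumes even: "even CARD('n::{finite,linorder})"
    and eq: "a *\<^sub>C (u_W :: 'n dk) + b *\<^sub>C u_Q + c *\<^sub>C u_G = 0"
  shows "a = 0 \<and> b = 0 \<and> c = 0"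
proof -
  have "dk_cointegral (dk_K * u_W :: 'n dk) = 1"
    using dk_cointegral_top(3)[where 'n = 'n] by (simp add: u_W_def PQ_left)
  moreover have "dk_cointegral (0 :: 'n dk) = 0" using dk_cointegral_scale[of 0 0] by simp
  ultimately have W: "(u_W :: 'n dk) \<noteq> 0" by auto
  have P: "dk_P * u_W = u_W" "dk_P * u_Q = 0" "dk_P * (u_G :: 'n dk) = 0"
    by (simp_all add: u_W_def u_Q_def u_G_def)
  have "a *\<^sub>C (u_W :: 'n dk) = dk_P * (a *\<^sub>C u_W + b *\<^sub>C u_Q + c *\<^sub>C u_G)"
    by (simp add: distrib_left P)
  then have a: "a = 0" using W by (simp add: eq)
  let ?s = "(- 1) ^ (CARD('n) div 2) :: complex"
  have "S_LM (b *\<^sub>C u_Q + c *\<^sub>C u_G) = b *\<^sub>C u_W + (c * ?s) *\<^sub>C (u_G :: 'n dk)"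
    by (simp add: S_LM_linear S_LM_u_Q S_LM_u_G[OF even])
  moreover have "S_LM 0 = (0 :: 'n dk)" using S_LM_linear(2)[of 0 0] by simp
  ultimately have S: "b *\<^sub>C u_W + (c * ?s) *\<^sub>C (u_G :: 'n dk) = 0" using eq a by simp
  have "b *\<^sub>C (u_W :: 'n dk) = dk_P * (b *\<^sub>C u_W + (c * ?s) *\<^sub>C u_G)"
    by (simp add: distrib_left P)
  then have b: "b = 0" using W by (simp add: S)
  have "c *\<^sub>C u_Q = T_LM (c *\<^sub>C u_G :: 'n dk)" by (simp add: T_LM_u_G[symmetric]) (simp add: T_LM_def)
  also have "c *\<^sub>C u_G = (0 :: 'n dk)" using eq a b by simp
  also have "T_LM 0 = (0 :: 'n dk)" by (simp add: T_LM_def)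
  finally have z: "c *\<^sub>C u_Q = (0 :: 'n dk)" .
  have "c *\<^sub>C (u_W :: 'n dk) = S_LM (c *\<^sub>C u_Q)" by (simp only: S_LM_linear S_LM_u_Q)
  also have "\<dots> = 0" unfolding z by fact
  finally have "c = 0" using W by simp
  with a b show ?thesis by simp
qed

theorem proposition5p3p3:
  assumes "even CARD('n::{finite,linorder})" and "2 \<le> CARD('n)"
  shows "(\<exists>\<rho>. LM_projective_rep (dk_higman :: 'n dk set) \<rho>) \<and>
    (\<forall>\<rho>. LM_projective_rep (dk_higman :: 'n dk set) \<rho> \<longrightarrow>
       congruence_subgroup_of_level 2 (projective_kernel (dk_higman :: 'n dk set) \<rho>))"
proof -
  define s :: complex where "s = (- 1) ^ (CARD('n) div 2)"
  have s: "s \<noteq> 0" "s * s = 1" by (simp_all add: s_def flip: power_mult_distrib)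
  interpret permutation_triple "s *\<^sub>C u_W :: 'n dk" u_Q u_G
  proof
    fix a b c assume "a *\<^sub>C s *\<^sub>C u_W + b *\<^sub>C u_Q + c *\<^sub>C (u_G :: 'n dk) = 0"
    then show "a = 0 \<and> b = 0 \<and> c = 0"
      using u_independent[OF assms(1), of "a * s" b c] s(1) by simp
  qed
  have V: "dk_higman = V"
  proof -
    have sp: "s *\<^sub>C (u_W :: 'n dk) \<in> cvec.span {u_W, u_Q, u_G}"
      "s *\<^sub>C s *\<^sub>C (u_W :: 'n dk) \<in> cvec.span {s *\<^sub>C u_W, u_Q, u_G}"
      by (intro cvec.span_scale cvec.span_base; simp)+
    have "cvec.span {u_W, u_Q, u_G} = cvec.span {s *\<^sub>C u_W, u_Q, u_G :: 'n dk}"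
      by (intro antisym cvec.span_minimal cvec.subspace_span)
        (use sp s(2) in \<open>auto intro: cvec.span_base\<close>)
    then show ?thesis by (simp add: dk_higman_eq higman_span_def V_def)
  qed
  have S: "S_LM x = s *\<^sub>C perm SL2Z_s x" and T: "T_LM x = perm SL2Z_t x" if x_in: "x \<in> V" for x
  proof -
    obtain a b c where x: "x = comb a b c" using x_in by (auto simp: V_comb)
    have "S_LM x = s *\<^sub>C (a *\<^sub>C u_Q + b *\<^sub>C s *\<^sub>C u_W + c *\<^sub>C u_G)"
      unfolding x comb_def using s(2) S_LM_u_G[OF assms(1)]
      by (simp add: S_LM_linear S_LM_u_W S_LM_u_Q s_def[symmetric] scaleC_add_right mult_ac)
    also have "\<dots> = s *\<^sub>C perm SL2Z_s x"
      unfolding x perm_comb by (simp add: SL2Z_st uvec_def)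
    finally show "S_LM x = s *\<^sub>C perm SL2Z_s x" .
    have "T_LM x = a *\<^sub>C s *\<^sub>C u_W + b *\<^sub>C u_G + c *\<^sub>C u_Q"
      unfolding x comb_def
      by (simp add: T_LM_def distrib_left T_LM_u_W[unfolded T_LM_def] T_LM_u_Q[unfolded T_LM_def]
        T_LM_u_G[unfolded T_LM_def])
    also have "\<dots> = perm SL2Z_t x"
      unfolding x perm_comb by (simp add: SL2Z_st uvec_def)
    finally show "T_LM x = perm SL2Z_t x" .
  qed
  have ne: "SL2Z_s \<noteq> SL2Z_t"
    by (metis SL2Z_st mat2_entries(1) zero_neq_one)
  \<comment> \<open>The scalars need not be multiplicative, so a correction at the single element
    \<open>SL2Z_s\<close> suffices; by \<open>ne\<close> it does not disturb
    \<open>SL2Z_t\<close>.\<close>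
  have "LM_projective_rep dk_higman (\<lambda>g x. (if g = SL2Z_s then s else 1) *\<^sub>C perm g x :: 'n dk)"
    unfolding LM_projective_rep_def
  proof (intro conjI)
    show "dk_higman \<subseteq> (dk_center :: 'n dk set)" by (simp add: dk_higman_eq higman_span_center)
    show "projective_rep dk_higman (\<lambda>g x. (if g = SL2Z_s then s else 1) *\<^sub>C perm g x)"
      unfolding V by (rule perm_projective_rep) (simp add: s)
  qed (use ne S T in \<open>auto simp: V\<close>)
  moreover have "congruence_subgroup_of_level 2 (projective_kernel dk_higman \<rho>)"
    if rep: "LM_projective_rep (dk_higman :: 'n dk set) \<rho>" for \<rho>
  proof -
    have scalar: "\<exists>c. c \<noteq> 0 \<and> (\<forall>x\<in>V. \<rho> g x = c *\<^sub>C perm g x)" if "g \<in> carrier SL2Z" for g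
      by (rule projective_rep_perm[OF _ _ s(1) _ that])
        (use rep S T in \<open>simp_all add: LM_projective_rep_def V\<close>)
    \<comment> \<open>A nonzero factor per group element does not affect which elements act by
      scalars, so every admissible \<open>\<rho>\<close> has the kernel of
      \<open>perm\<close>.\<close>
    have "(\<exists>c. \<forall>x\<in>V. \<rho> g x = c *\<^sub>C x) \<longleftrightarrow> (\<exists>c. \<forall>x\<in>V. perm g x = c *\<^sub>C x)"
      if g: "g \<in> carrier SL2Z" for g
    proof -
      obtain d where d: "d \<noteq> 0" "\<And>x. x \<in> V \<Longrightarrow> \<rho> g x = d *\<^sub>C perm g x" using scalar[OF g] by blast
      show ?thesis
      proof
        assume "\<exists>c. \<forall>x\<in>V. \<rho> g x = c *\<^sub>C x"
        then obtain c where c: "\<And>x. x \<in> V \<Longrightarrow> \<rho> g x = c *\<^sub>C x" by blast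
        have "perm g x = (c / d) *\<^sub>C x" if "x \<in> V" for x
        proof -
          have "(1 / d) *\<^sub>C d *\<^sub>C perm g x = (1 / d) *\<^sub>C c *\<^sub>C x" using c[OF that] d(2)[OF that] by simp
          then show ?thesis using d(1) by simp
        qed
        then show "\<exists>c. \<forall>x\<in>V. perm g x = c *\<^sub>C x" by blast
      next
        assume "\<exists>c. \<forall>x\<in>V. perm g x = c *\<^sub>C x"
        then obtain c where "\<And>x. x \<in> V \<Longrightarrow> perm g x = c *\<^sub>C x" by blast
        then have "\<forall>x\<in>V. \<rho> g x = (d * c) *\<^sub>C x" using d(2) by simp
        then show "\<exists>c. \<forall>x\<in>V. \<rho> g x = c *\<^sub>C x" by blast
      qed
    qed
    then have "projective_kernel dk_higman \<rho> = {g \<in> carrier SL2Z. \<exists>c. \<forall>x\<in>V. perm g x = c *\<^sub>C x}"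
      unfolding projective_kernel_def V by blast
    then show ?thesis using perm_kernel_congruence by simp
  qed
  ultimately show ?thesis by blast
qed

end
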